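(* Let $P$ be a homotopically Cohen–Macaulay geometric simplicial poset of dimension $n-1$ and $D$ a diagram on $P^*$ with values in finite sets whose associated sheaf $\mathcal D$ on $X_{P^*}$ is inhabited and flabby. Then the inflation $P_D$ is a homotopically Cohen–Macaulay geometric simplicial poset of dimension $n-1$.
   Context: All posets are finite; $P^*$ is $P$ with reversed order. A geometric simplicial poset is a poset $P$ such that each lower cone $P_{\leqslant I}$ is isomorphic to the poset of nonempty subsets of an $r$-element set for some $r\ge1$; then $\dim I=r-1$; $\dim P$ is the maximal dimension; $P$ is pure if all maximal elements have the same dimension. The geometric realization $|Q|$ of a poset is the realization of its order complex (simplices = nonempty chains). $P$ is homotopically Cohen–Macaulay of dimension $n-1$ if: $P$ is pure of dimension $n-1$; $|P|$ is homotopy equivalent to a wedge of $(n-1)$-spheres; and for each $I\in P$, $|P_{>I}|$ (the realization of the link of $I$) is homotopy equivalent to a wedge of $(n-2-\dim I)$-spheres. Conventions: a wedge of zero spheres is a point, and the empty space is regarded as a wedge of $(-1)$-spheres. A diagram on $P^*$ assigns finite sets $D(I)$ and maps $D(J\geqslant I)\colon D(J)\to D(I)$ for $I\leqslant J$, functorially. The inflation $P_D$ is the poset on $\bigsqcup_{I\in P}D(I)$ with $d\leqslant e$ ($d\in D(I)$, $e\in D(J)$) iff $I\leqslant J$ and $D(J\geqslant I)(e)=d$. Open sets of $X_{P^*}$ are the lower ideals of $P$; the associated sheaf assigns to nonempty open $U$ the set $\mathcal D(U)=\{(v_I)_{I\in U}\in\prod_{I\in U}D(I): D(J\geqslant I)(v_J)=v_I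 \text{ for } I\leqslant J\text{ in }U\}$ with projection restrictions. Inhabited: all $\mathcal D(U)\ne\emptyset$; flabby: all restriction maps between nonempty open sets surjective. *)

theory Defs
  imports "HOL-Analysis.Analysis"
begin

definition finite_poset :: "'a set \<Rightarrow> ('a \<Rightarrow> 'a \<Rightarrow> bool) \<Rightarrow> bool" where
  "finite_poset P le \<longleftrightarrow> finite P \<and>
     (\<forall>x\<in>P. le x x) \<and>
     (\<forall>x\<in>P. \<forall>y\<in>P. le x y \<and> le y x \<longrightarrow> x = y) \<and>
     (\<forall>x\<in>P. \<forall>y\<in>P. \<forall>z\<in>P. le x y \<and> le y z \<longrightarrow> le x z)"

definition lower_cone :: "'a set \<Rightarrow> ('a \<Rightarrow> 'a \<Rightarrow> bool) \<Rightarrow> 'a \<Rightarrow> 'a set" where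
  "lower_cone P le I = {J\<in>P. le J I}"

definition upper_link :: "'a set \<Rightarrow> ('a \<Rightarrow> 'a \<Rightarrow> bool) \<Rightarrow> 'a \<Rightarrow> 'a set" where
  "upper_link P le I = {J\<in>P. le I J \<and> J \<noteq> I}"

definition iso_to_simplex :: "'a set \<Rightarrow> ('a \<Rightarrow> 'a \<Rightarrow> bool) \<Rightarrow> nat \<Rightarrow> bool" where
  "iso_to_simplex Q le r \<longleftrightarrow>
     (\<exists>f. bij_betw f Q {S. S \<noteq> {} \<and> S \<subseteq> {..<r}} \<and>
          (\<forall>x\<in>Q. \<forall>y\<in>Q. le x y \<longleftrightarrow> f x \<subseteq> f y))"

definition geometric_simplicial_poset :: "'a set \<Rightarrow> ('a \<Rightarrow> 'a \<Rightarrow> bool) \<Rightarrow> bool" where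
  "geometric_simplicial_poset P le \<longleftrightarrow> finite_poset P le \<and>
     (\<forall>I\<in>P. \<exists>r\<ge>1. iso_to_simplex (lower_cone P le I) le r)"

definition elem_dim :: "'a set \<Rightarrow> ('a \<Rightarrow> 'a \<Rightarrow> bool) \<Rightarrow> 'a \<Rightarrow> int" where
  "elem_dim P le I = int (THE r. r \<ge> 1 \<and> iso_to_simplex (lower_cone P le I) le r) - 1"

definition poset_dim :: "'a set \<Rightarrow> ('a \<Rightarrow> 'a \<Rightarrow> bool) \<Rightarrow> int" where
  "poset_dim P le = Max (elem_dim P le ` P)"

definition maximal_elem :: "'a set \<Rightarrow> ('a \<Rightarrow> 'a \<Rightarrow> bool) \<Rightarrow> 'a \<Rightarrow> bool" where
  "maximal_elem P le I \<longleftrightarrow> I \<in> P \<and> (\<forall>J\<in>P. le I J \<longrightarrow> J = I)"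

definition pure_of_dim :: "'a set \<Rightarrow> ('a \<Rightarrow> 'a \<Rightarrow> bool) \<Rightarrow> int \<Rightarrow> bool" where
  "pure_of_dim P le m \<longleftrightarrow> P \<noteq> {} \<and> poset_dim P le = m \<and>
     (\<forall>I J. maximal_elem P le I \<and> maximal_elem P le J \<longrightarrow> elem_dim P le I = elem_dim P le J)"

definition is_chain :: "('a \<Rightarrow> 'a \<Rightarrow> bool) \<Rightarrow> 'a set \<Rightarrow> bool" where
  "is_chain le C \<longleftrightarrow> (\<forall>x\<in>C. \<forall>y\<in>C. le x y \<or> le y x)"

text \<open>Points of the realization: barycentric coordinates supported on a nonempty chain of Q.\<close>
definition realization_set :: "'a set \<Rightarrow> ('a \<Rightarrow> 'a \<Rightarrow> bool) \<Rightarrow> ('a \<Rightarrow> real) set" where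
  "realization_set Q le = {x. (\<forall>v. 0 \<le> x v) \<and> {v. x v \<noteq> 0} \<subseteq> Q \<and>
       is_chain le {v. x v \<noteq> 0} \<and> sum x {v. x v \<noteq> 0} = 1}"

definition realization :: "'a set \<Rightarrow> ('a \<Rightarrow> 'a \<Rightarrow> bool) \<Rightarrow> ('a \<Rightarrow> real) topology" where
  "realization Q le = subtopology (powertop_real UNIV) (realization_set Q le)"

text \<open>Wedge of k spheres of dimension d (d \<ge> 0): the i-th sphere is the unit sphere centred at
  e_{(i,0)} in the coordinates (i,0..d); all spheres meet at the origin. For k = 0 it is a point.\<close>
definition wedge_of_spheres :: "nat \<Rightarrow> nat \<Rightarrow> (nat \<times> nat \<Rightarrow> real) set" where
  "wedge_of_spheres k d =
     insert (\<lambda>_. 0) {x. \<exists>i<k. (\<forall>i' j. i' \<noteq> i \<longrightarrow> x (i', j) = 0) \<and> (\<forall>j>d. x (i, j) = 0) \<and>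
        (x (i, 0) - 1)\<^sup>2 + (\<Sum>j\<in>{1..d}. (x (i, j))\<^sup>2) = 1}"

definition wedge_top :: "nat \<Rightarrow> nat \<Rightarrow> (nat \<times> nat \<Rightarrow> real) topology" where
  "wedge_top k d = subtopology (powertop_real UNIV) (wedge_of_spheres k d)"

definition htpy_wedge_of_spheres :: "'b topology \<Rightarrow> int \<Rightarrow> bool" where
  "htpy_wedge_of_spheres X d \<longleftrightarrow>
     (if d < 0 then topspace X = {}
      else (\<exists>k. X homotopy_equivalent_space wedge_top k (nat d)))"

definition htpy_CM :: "'a set \<Rightarrow> ('a \<Rightarrow> 'a \<Rightarrow> bool) \<Rightarrow> nat \<Rightarrow> bool" where
  "htpy_CM P le n \<longleftrightarrow>
     pure_of_dim P le (int n - 1) \<and>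
     htpy_wedge_of_spheres (realization P le) (int n - 1) \<and>
     (\<forall>I\<in>P. htpy_wedge_of_spheres (realization (upper_link P le I) le)
               (int n - 2 - elem_dim P le I))"

definition diagram :: "'a set \<Rightarrow> ('a \<Rightarrow> 'a \<Rightarrow> bool) \<Rightarrow> ('a \<Rightarrow> 'b set) \<Rightarrow> ('a \<Rightarrow> 'a \<Rightarrow> 'b \<Rightarrow> 'b) \<Rightarrow> bool" where
  "diagram P le D Dm \<longleftrightarrow>
     (\<forall>I\<in>P. finite (D I)) \<and>
     (\<forall>I\<in>P. \<forall>J\<in>P. le I J \<longrightarrow> Dm J I ` D J \<subseteq> D I) \<and>
     (\<forall>I\<in>P. \<forall>d\<in>D I. Dm I I d = d) \<and>
     (\<forall>I\<in>P. \<forall>J\<in>P. \<forall>K\<in>P. le I J \<and> le J K \<longrightarrow> (\<forall>e\<in>D K. Dm J I (Dm K J e) = Dm K I e))"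

definition inflation :: "'a set \<Rightarrow> ('a \<Rightarrow> 'b set) \<Rightarrow> ('a \<times> 'b) set" where
  "inflation P D = {(I, d). I \<in> P \<and> d \<in> D I}"

definition inflation_le :: "('a \<Rightarrow> 'a \<Rightarrow> bool) \<Rightarrow> ('a \<Rightarrow> 'a \<Rightarrow> 'b \<Rightarrow> 'b) \<Rightarrow> ('a \<times> 'b) \<Rightarrow> ('a \<times> 'b) \<Rightarrow> bool" where
  "inflation_le le Dm x y \<longleftrightarrow> le (fst x) (fst y) \<and> Dm (fst y) (fst x) (snd y) = snd x"

text \<open>Open sets of X_{P^*}: lower ideals of P.\<close>
definition lower_ideal :: "'a set \<Rightarrow> ('a \<Rightarrow> 'a \<Rightarrow> bool) \<Rightarrow> 'a set \<Rightarrow> bool" where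
  "lower_ideal P le U \<longleftrightarrow> U \<subseteq> P \<and> (\<forall>I\<in>P. \<forall>J\<in>U. le I J \<longrightarrow> I \<in> U)"

definition sections :: "('a \<Rightarrow> 'a \<Rightarrow> bool) \<Rightarrow> ('a \<Rightarrow> 'b set) \<Rightarrow> ('a \<Rightarrow> 'a \<Rightarrow> 'b \<Rightarrow> 'b) \<Rightarrow> 'a set \<Rightarrow> ('a \<Rightarrow> 'b) set" where
  "sections le D Dm U = {v. v \<in> (\<Pi>\<^sub>E I\<in>U. D I) \<and>
       (\<forall>I\<in>U. \<forall>J\<in>U. le I J \<longrightarrow> Dm J I (v J) = v I)}"

definition sheaf_inhabited :: "'a set \<Rightarrow> ('a \<Rightarrow> 'a \<Rightarrow> bool) \<Rightarrow> ('a \<Rightarrow> 'b set) \<Rightarrow> ('a \<Rightarrow> 'a \<Rightarrow> 'b \<Rightarrow> 'b) \<Rightarrow> bool" where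
  "sheaf_inhabited P le D Dm \<longleftrightarrow>
     (\<forall>U. lower_ideal P le U \<and> U \<noteq> {} \<longrightarrow> sections le D Dm U \<noteq> {})"

definition sheaf_flabby :: "'a set \<Rightarrow> ('a \<Rightarrow> 'a \<Rightarrow> bool) \<Rightarrow> ('a \<Rightarrow> 'b set) \<Rightarrow> ('a \<Rightarrow> 'a \<Rightarrow> 'b \<Rightarrow> 'b) \<Rightarrow> bool" where
  "sheaf_flabby P le D Dm \<longleftrightarrow>
     (\<forall>U V. lower_ideal P le U \<and> lower_ideal P le V \<and> V \<noteq> {} \<and> V \<subseteq> U \<longrightarrow>
        (\<lambda>v. restrict v V) ` sections le D Dm U = sections le D Dm V)"

end

theory Submission
  imports Defs
begin

text \<open>Flabbiness is local: a compatible family on an ideal strictly below \<open>J\<close> extends to \<open>J\<close>. Hence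
  the part of the inflation above an element is again the inflation of a flabby diagram, on a link
  of \<open>P\<close>, and one can induct on the dimension. For a fixed \<open>P\<close> one inducts on the size of the
  inflation. If all \<open>D(I)\<close> are singletons, the inflation is \<open>P\<close>. Otherwise choose \<open>I\<close> minimal with two
  elements \<open>x \<noteq> x'\<close> in \<open>D(I)\<close>; they have the same boundary, and removing everything above \<open>x'\<close> leaves
  the inflation of a smaller flabby diagram. The removed elements other than \<open>x'\<close> are added back from
  the top along contractible links. The link of \<open>x'\<close> is the join of the boundary of a simplex with a
  wedge of spheres, and it is null-homotopic because by flabbiness there is a retraction folding
  \<open>x'\<close> onto \<open>x\<close>. So adding \<open>x'\<close> wedges on further spheres of top dimension.\<close>

section \<open>Maps out of glued spaces and cone attachments\<close>

text \<open>Only the homotopy types of the pieces are known, so everything rests on one gluing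
  statement that is invariant under homotopy equivalence: take a space equivalent to a wedge of k
  (d+1)-spheres and attach to it, along a null-homotopic map, a cone over a space equivalent to a
  wedge of l d-spheres; the result is equivalent to a wedge of k + l (d+1)-spheres
  (\<open>attach_null_wedge\<close>). Connectivity is never invoked to kill the attaching map. The
  null-homotopy has to be exhibited, and this dictates which element is removed. Minimality of I
  means that nothing can be chosen below I: hence a local section for which x' is forbidden can be
  sent through x, which keeps the smaller diagram flabby, and hence the fold of x' onto x is
  monotone. Inhabitedness and flabbiness enter as a single extension property at one element, with
  possibly empty boundary data; in this form they pass to links and to the smaller diagram.\<close>

abbreviation homotopic_on ::
  "'a::topological_space set \<Rightarrow> 'b::topological_space set \<Rightarrow> ('a \<Rightarrow> 'b) \<Rightarrow> ('a \<Rightarrow> 'b) \<Rightarrow> bool" where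
  "homotopic_on \<equiv> homotopic_with_canon (\<lambda>_. True)"

text \<open>A continuous map from a compact space onto a Hausdorff space is a quotient map, here
  with source the disjoint union of \<open>X\<close> and \<open>B\<close>: the preimage of a closed
  set is a union of two compact images.\<close>

lemma glue_continuous_on:
  fixes i :: "'x::topological_space \<Rightarrow> 'y::topological_space"
    and p :: "'b::topological_space \<Rightarrow> 'y"
    and F :: "'y \<Rightarrow> 'z::topological_space"
  assumes X: "compact X" and B: "compact B" and Y: "Hausdorff_space (top_of_set Y)"
    and i: "continuous_on X i" and p: "continuous_on B p" and cov: "Y = i ` X \<union> p ` B"
    and Fi: "continuous_on X (\<lambda>x. F (i x))" and Fp: "continuous_on B (\<lambda>b. F (p b))"
  shows "continuous_on Y F"
  unfolding continuous_on_closed_invariant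
proof (intro allI impI)
  fix C :: "'z set"
  assume C: "closed C"
  have *: "closedin (top_of_set Y) (q ` (S \<inter> (\<lambda>s. F (q s)) -` C))"
    if "compact S" "continuous_on S q" "q ` S \<subseteq> Y" "continuous_on S (\<lambda>s. F (q s))"
    for q :: "'s::topological_space \<Rightarrow> 'y" and S
  proof -
    have "closedin (top_of_set S) (S \<inter> (\<lambda>s. F (q s)) -` C)"
      by (rule continuous_closedin_preimage[OF that(4) C])
    then have "compact (S \<inter> (\<lambda>s. F (q s)) -` C)"
      using closedin_compact that(1) by blast
    then have "compact (q ` (S \<inter> (\<lambda>s. F (q s)) -` C))"
      using compact_continuous_image continuous_on_subset[OF that(2)] by (metis Int_lower1)
    then have "compactin (top_of_set Y) (q ` (S \<inter> (\<lambda>s. F (q s)) -` C))"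
      using that(3) by (auto simp: compactin_subtopology)
    then show ?thesis
      using Y compactin_imp_closedin by blast
  qed
  have "Y \<inter> F -` C = i ` (X \<inter> (\<lambda>x. F (i x)) -` C) \<union> p ` (B \<inter> (\<lambda>b. F (p b)) -` C)"
    unfolding cov by auto
  moreover have "closedin (top_of_set Y) \<dots>"
    by (intro closedin_Un * X B i p Fi Fp) (auto simp: cov)
  ultimately show "\<exists>A. closed A \<and> A \<inter> Y = F -` C \<inter> Y"
    unfolding closedin_closed by (metis inf_commute)
qed

lemma homotopic_canonI:
  assumes "continuous_on ({0..1::real} \<times> S) h" "h ` ({0..1} \<times> S) \<subseteq> T"
    "\<And>x. x \<in> S \<Longrightarrow> h (0,x) = f x" "\<And>x. x \<in> S \<Longrightarrow> h (1,x) = g x"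
  shows "homotopic_on S T f g"
  using assms by (subst homotopic_with) (auto intro!: exI[of _ h])

lemma homotopic_canonE:
  assumes "homotopic_on S T f g"
  obtains h where "continuous_on ({0..1::real} \<times> S) h" "h ` ({0..1} \<times> S) \<subseteq> T"
    "\<And>x. h (0,x) = f x" "\<And>x. h (1,x) = g x"
  using assms unfolding homotopic_with_def by auto

text \<open>\<open>Y\<close> is a quotient of the disjoint union of \<open>X\<close> and
  \<open>B\<close>. As \<open>i\<close> is injective, a map out of \<open>Y\<close> only has to
  respect identifications of points of \<open>B\<close> with points of \<open>X\<close> or with each
  other.\<close>

locale gluing =
  fixes X :: "'x::topological_space set" and B :: "'b::topological_space set"
    and Y :: "'y::topological_space set" and i :: "'x \<Rightarrow> 'y" and p :: "'b \<Rightarrow> 'y"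
  assumes compX: "compact X" and compB: "compact B" and HY: "Hausdorff_space (top_of_set Y)"
    and conti: "continuous_on X i" and contp: "continuous_on B p"
    and cov: "Y = i ` X \<union> p ` B" and inji: "inj_on i X"
begin

text \<open>Compactness keeps the product with the interval a quotient of the same kind, so
  homotopies on \<open>Y\<close> can also be defined piece by piece.\<close>

lemma product:
  "gluing ({0..1::real} \<times> X) ({0..1::real} \<times> B) ({0..1::real} \<times> Y)
     (\<lambda>(w,x). (w, i x)) (\<lambda>(w,b). (w, p b))"
proof
  show "compact ({0..1::real} \<times> X)" "compact ({0..1::real} \<times> B)"
    using compX compB by (auto intro: compact_Times)
  have "Hausdorff_space (prod_topology (top_of_set {0..1::real}) (top_of_set Y))"
    using HY unfolding Hausdorff_space_prod_topology
    by (simp add: Hausdorff_space_subtopology)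
  then show "Hausdorff_space (top_of_set ({0..1::real} \<times> Y))"
    by (simp only: prod_topology_subtopology_eu)
  show "continuous_on ({0..1} \<times> X) (\<lambda>(w::real, x). (w, i x))"
    "continuous_on ({0..1} \<times> B) (\<lambda>(w::real, b). (w, p b))"
    using conti contp
    by (auto simp: case_prod_unfold intro!: continuous_intros elim!: continuous_on_compose2)
  show "{0..1} \<times> Y = (\<lambda>(w::real, x). (w, i x)) ` ({0..1} \<times> X) \<union> (\<lambda>(w, b). (w, p b)) ` ({0..1} \<times> B)"
    unfolding cov by force
  show "inj_on (\<lambda>(w::real, x). (w, i x)) ({0..1} \<times> X)"
    using inji by (auto simp: inj_on_def)
qed

lemma extend:
  assumes g: "continuous_on X g" "g ` X \<subseteq> Z" and H: "continuous_on B H" "H ` B \<subseteq> Z"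
    and gH: "\<And>x b. x \<in> X \<Longrightarrow> b \<in> B \<Longrightarrow> i x = p b \<Longrightarrow> g x = H b"
    and HH: "\<And>b b'. b \<in> B \<Longrightarrow> b' \<in> B \<Longrightarrow> p b = p b' \<Longrightarrow> H b = H b'"
  obtains F where "continuous_on Y F" "F ` Y \<subseteq> Z"
    "\<And>x. x \<in> X \<Longrightarrow> F (i x) = g x" "\<And>b. b \<in> B \<Longrightarrow> F (p b) = H b"
proof
  define F where "F y = (if y \<in> i ` X then g (inv_into X i y) else H (inv_into B p y))" for y
  show *: "F (i x) = g x" if "x \<in> X" for x
    using that inji by (simp add: F_def)
  show **: "F (p b) = H b" if "b \<in> B" for b
  proof (cases "p b \<in> i ` X")
    case True
    then show ?thesis using * gH that by auto
  next
    case False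
    then show ?thesis
      unfolding F_def using HH that by (metis f_inv_into_f image_eqI inv_into_into)
  qed
  show "continuous_on Y F"
    by (rule glue_continuous_on[OF compX compB HY conti contp cov])
      (use g(1) H(1) in \<open>simp_all add: * ** cong: continuous_on_cong\<close>)
  show "F ` Y \<subseteq> Z" using g(2) H(2) unfolding cov by (auto simp: * **)
qed

lemma homotopy:
  assumes h: "continuous_on ({0..1::real} \<times> X) h" "h ` ({0..1} \<times> X) \<subseteq> Z"
    and K: "continuous_on ({0..1::real} \<times> B) K" "K ` ({0..1} \<times> B) \<subseteq> Z"
    and hK: "\<And>w x b. w \<in> {0..1} \<Longrightarrow> x \<in> X \<Longrightarrow> b \<in> B \<Longrightarrow> i x = p b \<Longrightarrow> h (w,x) = K (w,b)"
    and KK: "\<And>w b b'. w \<in> {0..1} \<Longrightarrow> b \<in> B \<Longrightarrow> b' \<in> B \<Longrightarrow> p b = p b' \<Longrightarrow> K (w,b) = K (w,b')"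
    and h01: "\<And>x. x \<in> X \<Longrightarrow> h (0,x) = F (i x)" "\<And>x. x \<in> X \<Longrightarrow> h (1,x) = F' (i x)"
    and K01: "\<And>b. b \<in> B \<Longrightarrow> K (0,b) = F (p b)" "\<And>b. b \<in> B \<Longrightarrow> K (1,b) = F' (p b)"
  shows "homotopic_on Y Z F F'"
proof -
  interpret P: gluing "{0..1::real} \<times> X" "{0..1::real} \<times> B" "{0..1::real} \<times> Y"
    "\<lambda>(w,x). (w, i x)" "\<lambda>(w,b). (w, p b)" by (rule product)
  obtain G where G: "continuous_on ({0..1} \<times> Y) G" "G ` ({0..1} \<times> Y) \<subseteq> Z"
    "\<And>x. x \<in> {0..1} \<times> X \<Longrightarrow> G (case x of (w,x) \<Rightarrow> (w, i x)) = h x"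
    "\<And>b. b \<in> {0..1} \<times> B \<Longrightarrow> G (case b of (w,b) \<Rightarrow> (w, p b)) = K b"
    by (rule P.extend[OF h K]) (auto simp: hK intro: KK)
  have 1: "G (w, i x) = h (w,x)" if "w \<in> {0..1}" "x \<in> X" for w x
    using G(3)[of "(w,x)"] that by auto
  have 2: "G (w, p x) = K (w,x)" if "w \<in> {0..1}" "x \<in> B" for w x
    using G(4)[of "(w,x)"] that by auto
  show ?thesis
    by (rule homotopic_canonI[OF G(1,2)]) (auto simp: cov 1 2 h01 K01)
qed

end

text \<open>The space \<open>Y\<close> is \<open>X\<close> with a cone on \<open>A\<close> attached along \<open>f\<close>; the cone coordinate \<open>0\<close> is
  the base and \<open>1\<close> is the apex.\<close>

locale cone_attachment =
  fixes X :: "'x::topological_space set" and A :: "'a::topological_space set"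
    and Y :: "'y::topological_space set" and f :: "'a \<Rightarrow> 'x" and i :: "'x \<Rightarrow> 'y"
    and c :: "'a \<times> real \<Rightarrow> 'y"
  assumes cX: "compact X" and cA: "compact A" and A_ne: "A \<noteq> {}"
    and HausY: "Hausdorff_space (top_of_set Y)"
    and ci: "continuous_on X i" and cc: "continuous_on (A \<times> {0..1}) c"
    and Y_eq: "Y = i ` X \<union> c ` (A \<times> {0..1})" and inj: "inj_on i X"
    and cf: "continuous_on A f" and fA: "f ` A \<subseteq> X"
    and base: "\<And>a. a \<in> A \<Longrightarrow> c (a,0) = i (f a)"
    and apex: "\<And>a a'. a \<in> A \<Longrightarrow> a' \<in> A \<Longrightarrow> c (a,1) = c (a',1)"
    and i_eq_c: "\<And>x a t. x \<in> X \<Longrightarrow> a \<in> A \<Longrightarrow> t \<in> {0..1} \<Longrightarrow> i x = c (a,t) \<Longrightarrow> t = 0"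
    and c_eq_c: "\<And>a t a' t'. a \<in> A \<Longrightarrow> t \<in> {0..1} \<Longrightarrow> a' \<in> A \<Longrightarrow> t' \<in> {0..1} \<Longrightarrow>
      c (a,t) = c (a',t') \<Longrightarrow> t = t' \<and> (t = 0 \<or> t = 1 \<or> a = a')"
begin

sublocale gluing X "A \<times> {0..1}" Y i c
  by unfold_locales (rule cX HausY ci cc Y_eq inj compact_Times[OF cA compact_Icc])+

lemma i_in: "x \<in> X \<Longrightarrow> i x \<in> Y" and c_in: "a \<in> A \<Longrightarrow> t \<in> {0..1} \<Longrightarrow> c (a,t) \<in> Y"
  and f_in: "a \<in> A \<Longrightarrow> f a \<in> X"
  using Y_eq fA by auto

lemma i_eq_cD: "x = f a" if "x \<in> X" "a \<in> A" "t \<in> {0..1}" "i x = c (a,t)"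
  using i_eq_c[OF that] that base[of a] inj f_in[of a] by (auto simp: inj_on_def)

lemma f_eqD: "f a = f a'" if "a \<in> A" "a' \<in> A" "c (a,0) = c (a',0)"
  using that base inj f_in by (auto simp: inj_on_def)

text \<open>A map out of a mapping cone is a map \<open>g\<close> on \<open>X\<close> together with
  a null-homotopy \<open>H\<close> of \<open>g\<close> after \<open>f\<close>.\<close>

lemma map_out:
  assumes g: "continuous_on X g" "g ` X \<subseteq> Z"
    and H: "continuous_on (A \<times> {0..1}) H" "H ` (A \<times> {0..1}) \<subseteq> Z"
    and "\<And>a. a \<in> A \<Longrightarrow> H (a,0) = g (f a)"
    and "\<And>a a'. a \<in> A \<Longrightarrow> a' \<in> A \<Longrightarrow> H (a,1) = H (a',1)"
  obtains F where "continuous_on Y F" "F ` Y \<subseteq> Z" "\<And>x. x \<in> X \<Longrightarrow> F (i x) = g x"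
    "\<And>a t. a \<in> A \<Longrightarrow> 0 \<le> t \<Longrightarrow> t \<le> 1 \<Longrightarrow> F (c (a,t)) = H (a,t)"
proof (rule extend[OF g H])
  fix x b assume "x \<in> X" "b \<in> A \<times> {0..1}" "i x = c b"
  then show "g x = H b"
    using i_eq_c[of x "fst b" "snd b"] i_eq_cD[of x "fst b" "snd b"] assms(5) by auto
next
  fix b b' assume "b \<in> A \<times> {0..1}" "b' \<in> A \<times> {0..1}" "c b = c b'"
  then show "H b = H b'"
    using c_eq_c[of "fst b" "snd b" "fst b'" "snd b'"] f_eqD[of "fst b" "fst b'"] assms(5)[of "fst b"]
      assms(5)[of "fst b'"] assms(6)[of "fst b" "fst b'"]
    by (cases b; cases b') auto
qed (use that in auto)

lemma homotopy_out:
  assumes h: "continuous_on ({0..1::real} \<times> X) h" "h ` ({0..1} \<times> X) \<subseteq> Z"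
    and K: "continuous_on ({0..1::real} \<times> (A \<times> {0..1})) K" "K ` ({0..1} \<times> (A \<times> {0..1})) \<subseteq> Z"
    and base': "\<And>w a. 0 \<le> w \<Longrightarrow> w \<le> 1 \<Longrightarrow> a \<in> A \<Longrightarrow> K (w,a,0) = h (w, f a)"
    and apex': "\<And>w a a'. 0 \<le> w \<Longrightarrow> w \<le> 1 \<Longrightarrow> a \<in> A \<Longrightarrow> a' \<in> A \<Longrightarrow> K (w,a,1) = K (w,a',1)"
    and h01: "\<And>x. x \<in> X \<Longrightarrow> h (0,x) = F (i x)" "\<And>x. x \<in> X \<Longrightarrow> h (1,x) = F' (i x)"
    and K01: "\<And>a t. a \<in> A \<Longrightarrow> 0 \<le> t \<Longrightarrow> t \<le> 1 \<Longrightarrow> K (0,a,t) = F (c (a,t))"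
      "\<And>a t. a \<in> A \<Longrightarrow> 0 \<le> t \<Longrightarrow> t \<le> 1 \<Longrightarrow> K (1,a,t) = F' (c (a,t))"
  shows "homotopic_on Y Z F F'"
proof (rule homotopy[OF h K])
  fix w x b assume "w \<in> {0..1::real}" "x \<in> X" "b \<in> A \<times> {0..1}" "i x = c b"
  then show "h (w,x) = K (w,b)"
    using i_eq_c[of x "fst b" "snd b"] i_eq_cD[of x "fst b" "snd b"] base'[of w] by auto
next
  fix w b b' assume "w \<in> {0..1::real}" "b \<in> A \<times> {0..1}" "b' \<in> A \<times> {0..1}" "c b = c b'"
  then show "K (w,b) = K (w,b')"
    using c_eq_c[of "fst b" "snd b" "fst b'" "snd b'"] f_eqD[of "fst b" "fst b'"] base'[of w "fst b"]
      base'[of w "fst b'"] apex'[of w "fst b" "fst b'"]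
    by (cases b; cases b') auto
qed (use h01 K01 in auto)

end

section \<open>Homotopy invariance of cone attachments\<close>

text \<open>A map of cone attachments over the identity of \<open>X\<close> and a homotopy \<open>N\<close> of the attaching maps:
  the lower half of every cone line runs through \<open>N\<close>.\<close>

definition attach_map ::
  "'x set \<Rightarrow> 'a set \<Rightarrow> ('x \<Rightarrow> 'y) \<Rightarrow> ('a \<times> real \<Rightarrow> 'y) \<Rightarrow> ('x \<Rightarrow> 'y1) \<Rightarrow> ('a \<times> real \<Rightarrow> 'y1) \<Rightarrow>
   (real \<times> 'a \<Rightarrow> 'x) \<Rightarrow> ('y \<Rightarrow> 'y1) \<Rightarrow> bool" where
  "attach_map X A i c i' c' N F \<longleftrightarrow> (\<forall>x\<in>X. F (i x) = i' x) \<and>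
     (\<forall>a\<in>A. \<forall>t\<in>{0..1}. F (c (a,t)) = (if t \<le> 1/2 then i' (N (2*t, a)) else c' (a, 2*t - 1)))"

lemma attach_map_exists:
  assumes "cone_attachment X A Y f i c" and "cone_attachment X A Y' f' i' c'"
    and N: "continuous_on ({0..1} \<times> A) N" "N ` ({0..1} \<times> A) \<subseteq> X"
    and N01: "\<And>a. a \<in> A \<Longrightarrow> N (0,a) = f a" "\<And>a. a \<in> A \<Longrightarrow> N (1,a) = f' a"
  obtains F where "continuous_on Y F" "F ` Y \<subseteq> Y'" "attach_map X A i c i' c' N F"
proof -
  interpret C: cone_attachment X A Y f i c by fact
  interpret D: cone_attachment X A Y' f' i' c' by fact
  define H where "H z = (if snd z \<le> 1/2 then i' (N (2 * snd z, fst z)) else c' (fst z, 2 * snd z - 1))"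
    for z
  have NX: "N (t,a) \<in> X" if "0 \<le> t" "t \<le> 1" "a \<in> A" for t a using N that by auto
  have H_cont: "continuous_on (A \<times> {0..1}) H"
    unfolding H_def
  proof (rule continuous_on_cases_le)
    show "continuous_on {x \<in> A \<times> {0..1}. snd x \<le> 1/2} (\<lambda>x. i' (N (2 * snd x, fst x)))"
      by (intro continuous_on_compose2[OF D.ci] continuous_on_compose2[OF N(1)] continuous_intros)
        (auto simp: NX)
    show "continuous_on {x \<in> A \<times> {0..1}. 1/2 \<le> snd x} (\<lambda>x. c' (fst x, 2 * snd x - 1))"
      by (intro continuous_on_compose2[OF D.cc] continuous_intros) auto
    show "continuous_on (A \<times> {0..1}) snd" by (intro continuous_intros)
    show "i' (N (2 * snd x, fst x)) = c' (fst x, 2 * snd x - 1)"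
      if "x \<in> A \<times> {0..1}" "snd x = 1/2" for x
      using that(1) unfolding that(2) by (auto simp: N01 D.base)
  qed
  show thesis
  proof (rule C.map_out[where g = i' and H = H and Z = Y'])
    show "H ` (A \<times> {0..1}) \<subseteq> Y'"
      by (auto simp: H_def intro!: D.i_in D.c_in NX)
    show "H (a, 1) = H (a', 1)" if "a \<in> A" "a' \<in> A" for a a'
      using D.apex[OF that] by (simp add: H_def)
    fix F
    assume "continuous_on Y F" "F ` Y \<subseteq> Y'" "\<And>x. x \<in> X \<Longrightarrow> F (i x) = i' x"
      "\<And>a t. a \<in> A \<Longrightarrow> 0 \<le> t \<Longrightarrow> t \<le> 1 \<Longrightarrow> F (c (a,t)) = H (a,t)"
    then show thesis
      by (intro that[of F]) (auto simp: attach_map_def H_def)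
  qed (use H_cont D.ci D.i_in in \<open>auto simp: H_def N01\<close>)
qed

lemma attach_homotopic_left_inverse:
  assumes "cone_attachment X A Y f i c" and "cone_attachment X A Y' f' i' c'"
    and N: "continuous_on ({0..1} \<times> A) N" "N ` ({0..1} \<times> A) \<subseteq> X"
    and N01: "\<And>a. a \<in> A \<Longrightarrow> N (0,a) = f a" "\<And>a. a \<in> A \<Longrightarrow> N (1,a) = f' a"
    and F: "attach_map X A i c i' c' N F"
    and G: "attach_map X A i' c' i c (\<lambda>(t,a). N (1 - t, a)) G"
  shows "homotopic_on Y Y (G \<circ> F) id"
proof -
  interpret C: cone_attachment X A Y f i c by fact
  interpret D: cone_attachment X A Y' f' i' c' by fact
  have NX: "N (t,a) \<in> X" if "0 \<le> t" "t \<le> 1" "a \<in> A" for t a using N that by auto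
  \<comment> \<open>Along a cone line \<open>G \<circ> F\<close> runs through \<open>N\<close>
    forwards for \<open>t\<close> up to 1/2, backwards up to 3/4, then up the cone. At time
    \<open>w\<close> this excursion is cut off: it peaks at \<open>t = (1 - w)/2\<close> with value
    \<open>1 - w\<close>, is over at \<open>t = 3 * (1 - w)/4\<close>, and the cone takes the
    rest.\<close>
  define K where "K z = (if snd (snd z) - 3 * (1 - fst z) / 4 \<le> 0
      then i (N (min (2 * snd (snd z)) (3 * (1 - fst z) - 4 * snd (snd z)), fst (snd z)))
      else c (fst (snd z), (4 * snd (snd z) - 3 * (1 - fst z)) / (1 + 3 * fst z)))"
    for z :: "real \<times> 'b \<times> real"
  have quot: "0 \<le> (4 * t - 3 * (1 - w)) / (1 + 3 * w)" "(4 * t - 3 * (1 - w)) / (1 + 3 * w) \<le> 1"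
    if "0 \<le> t - 3 * (1 - w) / 4" "0 \<le> w" "t \<le> 1" for t w :: real
    using that by (auto simp: divide_simps)
  show ?thesis
  proof (rule C.homotopy_out[where h = "\<lambda>z. i (snd z)" and K = K])
    show "continuous_on ({0..1} \<times> X) (\<lambda>z. i (snd z))"
      by (intro continuous_on_compose2[OF C.ci] continuous_intros) auto
    show "(\<lambda>z. i (snd z)) ` ({0..1} \<times> X) \<subseteq> Y" using C.i_in by auto
    show "continuous_on ({0..1} \<times> A \<times> {0..1}) K"
      unfolding K_def
    proof (rule continuous_on_cases_le)
      show "continuous_on {z \<in> {0..1} \<times> A \<times> {0..1}. snd (snd z) - 3 * (1 - fst z) / 4 \<le> 0}
        (\<lambda>z. i (N (min (2 * snd (snd z)) (3 * (1 - fst z) - 4 * snd (snd z)), fst (snd z))))"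
        by (intro continuous_on_compose2[OF C.ci] continuous_on_compose2[OF N(1)] continuous_intros)
          (auto intro!: NX simp: min_def)
      show "continuous_on {z \<in> {0..1} \<times> A \<times> {0..1}. 0 \<le> snd (snd z) - 3 * (1 - fst z) / 4}
        (\<lambda>z. c (fst (snd z), (4 * snd (snd z) - 3 * (1 - fst z)) / (1 + 3 * fst z)))"
        by (intro continuous_on_compose2[OF C.cc] continuous_intros) (use quot in auto)
      show "continuous_on ({0..1} \<times> A \<times> {0..1}) (\<lambda>z::real \<times> 'b \<times> real. snd (snd z) - 3 * (1 - fst z) / 4)"
        by (intro continuous_intros) auto
      fix z :: "real \<times> 'b \<times> real"
      assume z: "z \<in> {0..1} \<times> A \<times> {0..1}" "snd (snd z) - 3 * (1 - fst z) / 4 = 0"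
      then have "3 * (1 - fst z) - 4 * snd (snd z) = 0" "4 * snd (snd z) - 3 * (1 - fst z) = 0"
        by auto
      then show "i (N (min (2 * snd (snd z)) (3 * (1 - fst z) - 4 * snd (snd z)), fst (snd z))) =
         c (fst (snd z), (4 * snd (snd z) - 3 * (1 - fst z)) / (1 + 3 * fst z))"
        using z(1) by (auto simp: N01 C.base)
    qed
    show "K ` ({0..1} \<times> A \<times> {0..1}) \<subseteq> Y"
      using quot by (auto simp: K_def min_def intro!: C.i_in C.c_in NX)
    show "K (w, a, 0) = i (snd (w, f a))" if "0 \<le> w" "w \<le> 1" "a \<in> A" for w a
      using that N01 by (simp add: K_def)
    show "K (w, a, 1) = K (w, a', 1)" if "0 \<le> w" "w \<le> 1" "a \<in> A" "a' \<in> A" for w a a'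
      using that C.apex[of a a'] by (simp add: K_def)
    show "i (snd (0, x)) = (G \<circ> F) (i x)" "i (snd (1, x)) = id (i x)" if "x \<in> X" for x
      using that F G by (simp_all add: attach_map_def)
    fix a t assume a: "a \<in> A" and t: "0 \<le> t" "t \<le> (1::real)"
    show "K (1, a, t) = id (c (a, t))"
      using a t by (auto simp: K_def N01 C.base)
    have F': "F (c (a,t)) = (if t \<le> 1/2 then i' (N (2*t, a)) else c' (a, 2*t - 1))"
      using F a t by (simp add: attach_map_def)
    have G': "G (c' (a,s)) = (if s \<le> 1/2 then i (N (1 - 2 * s, a)) else c (a, 2 * s - 1))"
      if "0 \<le> s" "s \<le> 1" for s
      using F G a t that by (simp_all add: attach_map_def)
    have Gi: "G (i' x) = i x" if "x \<in> X" for x using G that by (simp add: attach_map_def)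
    show "K (0, a, t) = (G \<circ> F) (c (a, t))"
    proof (cases "t \<le> 1/2")
      case True
      then show ?thesis using F' a t by (simp add: K_def Gi NX min_def)
    next
      case False
      then show ?thesis
        using F' G'[of "2 * t - 1"] a t by (simp add: K_def min_def algebra_simps)
    qed
  qed
qed

lemma homotopy_eqvI:
  assumes "continuous_on S F" "F ` S \<subseteq> T" "continuous_on T G" "G ` T \<subseteq> S"
    "homotopic_on S S (G \<circ> F) id"
    "homotopic_on T T (F \<circ> G) id"
  shows "S homotopy_eqv T"
  unfolding homotopy_equivalent_space_def
  using assms by (intro exI[of _ F] exI[of _ G]) (auto simp: id_def)

text \<open>\<open>l\<close> and \<open>r\<close> agree up to homotopy because both are homotopic to
  \<open>l \<circ> g \<circ> r\<close>.\<close>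

lemma one_sided_inverses_homotopy_eqv:
  assumes g: "continuous_on S g" "g ` S \<subseteq> T" and l: "continuous_on T l" "l ` T \<subseteq> S"
    and r: "continuous_on T r" "r ` T \<subseteq> S"
    and lg: "homotopic_on S S (l \<circ> g) id"
    and gr: "homotopic_on T T (g \<circ> r) id"
  shows "S homotopy_eqv T"
proof -
  have "homotopic_on T S (l \<circ> (g \<circ> r)) (l \<circ> id)"
    by (rule homotopic_with_compose_continuous_left[OF gr]) (use l in auto)
  moreover have "homotopic_on T S ((l \<circ> g) \<circ> r) (id \<circ> r)"
    by (rule homotopic_with_compose_continuous_right[OF lg]) (use r in auto)
  ultimately have "homotopic_on T S l r"
    by (metis comp_assoc comp_id id_comp homotopic_with_sym homotopic_with_trans)
  then have "homotopic_on T T (g \<circ> l) (g \<circ> r)"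
    by (rule homotopic_with_compose_continuous_left) (use g in auto)
  then have "homotopic_on T T (g \<circ> l) id" using gr homotopic_with_trans by blast
  then show ?thesis by (rule homotopy_eqvI[OF g l lg])
qed

lemma attach_homotopy_inverses:
  assumes C: "cone_attachment X A Y f i c" and D: "cone_attachment X A Y' f' i' c'"
    and N: "continuous_on ({0..1} \<times> A) N" "N ` ({0..1} \<times> A) \<subseteq> X"
    and N01: "\<And>a. a \<in> A \<Longrightarrow> N (0,a) = f a" "\<And>a. a \<in> A \<Longrightarrow> N (1,a) = f' a"
  obtains F G where "continuous_on Y F" "F ` Y \<subseteq> Y'" "continuous_on Y' G" "G ` Y' \<subseteq> Y"
    "attach_map X A i c i' c' N F"
    "homotopic_on Y Y (G \<circ> F) id" "homotopic_on Y' Y' (F \<circ> G) id"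
proof -
  interpret C: cone_attachment X A Y f i c by fact
  interpret D: cone_attachment X A Y' f' i' c' by fact
  \<comment> \<open>The reversed homotopy yields the inverse map. Reversing twice gives back
    \<open>N\<close>, so the same lemma treats both composites.\<close>
  define M where "M = (\<lambda>(t,a). N (1 - t, a))"
  have M: "continuous_on ({0..1} \<times> A) M" "M ` ({0..1} \<times> A) \<subseteq> X"
    and M01: "\<And>a. a \<in> A \<Longrightarrow> M (0,a) = f' a" "\<And>a. a \<in> A \<Longrightarrow> M (1,a) = f a"
    using N(2) unfolding M_def case_prod_unfold
    by (auto simp: N01 intro!: continuous_on_compose2[OF N(1)] continuous_intros)
  have NM: "N = (\<lambda>(t,a). M (1 - t, a))" by (auto simp: M_def)
  obtain F where F: "continuous_on Y F" "F ` Y \<subseteq> Y'"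
    "attach_map X A i c i' c' N F"
    by (rule attach_map_exists[OF C D N]) (auto simp: N01)
  obtain G where G: "continuous_on Y' G" "G ` Y' \<subseteq> Y"
    "attach_map X A i' c' i c M G"
    by (rule attach_map_exists[OF D C M]) (auto simp: M01)
  show thesis
    using attach_homotopic_left_inverse[OF C D N N01 F(3)] G(3)
      attach_homotopic_left_inverse[OF D C M M01 G(3)] F(3)
    by (intro that[OF F(1,2) G(1,2) F(3)]) (simp_all add: M_def[symmetric] NM[symmetric])
qed

lemma attach_homotopy_eqv:
  assumes C: "cone_attachment X A Y f i c" and D: "cone_attachment X A Y' f' i' c'"
    and hom: "homotopic_on A X f f'"
  shows "Y homotopy_eqv Y'"
proof -
  obtain N where N: "continuous_on ({0..1::real} \<times> A) N" "N ` ({0..1} \<times> A) \<subseteq> X"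
    and N01: "\<And>a. N (0,a) = f a" "\<And>a. N (1,a) = f' a"
    by (rule homotopic_canonE[OF hom]) (blast intro: that)
  show ?thesis
    by (rule attach_homotopy_inverses[OF C D N N01]) (rule homotopy_eqvI)
qed

section \<open>Maps between cones attached at a point\<close>

definition cone_map ::
  "'x set \<Rightarrow> 'a set \<Rightarrow> ('x \<Rightarrow> 'y) \<Rightarrow> ('a \<times> real \<Rightarrow> 'y) \<Rightarrow> ('x1 \<Rightarrow> 'y1) \<Rightarrow> ('a1 \<times> real \<Rightarrow> 'y1) \<Rightarrow>
   ('x \<Rightarrow> 'x1) \<Rightarrow> ('a \<Rightarrow> 'a1) \<Rightarrow> ('y \<Rightarrow> 'y1) \<Rightarrow> bool" where
  "cone_map X A i c i' c' u al F \<longleftrightarrow> (\<forall>x\<in>X. F (i x) = i' (u x)) \<and>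
     (\<forall>a\<in>A. \<forall>t\<in>{0..1}. F (c (a,t)) = c' (al a, t))"

text \<open>As the attaching maps are constant, \<open>u\<close> and \<open>al\<close> can be chosen
  independently. This later allows \<open>X\<close> and \<open>A\<close> to be replaced separately
  by equivalent spaces.\<close>

lemma cone_map_exists:
  assumes "cone_attachment X A Y (\<lambda>_. x0) i c" and "cone_attachment X' A' Y' (\<lambda>_. u x0) i' c'"
    and u: "continuous_on X u" "u ` X \<subseteq> X'" and al: "continuous_on A al" "al ` A \<subseteq> A'"
  obtains F where "continuous_on Y F" "F ` Y \<subseteq> Y'" "cone_map X A i c i' c' u al F"
proof -
  interpret C: cone_attachment X A Y "\<lambda>_. x0" i c by fact
  interpret D: cone_attachment X' A' Y' "\<lambda>_. u x0" i' c' by fact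
  have alA: "al a \<in> A'" if "a \<in> A" for a using al that by auto
  show thesis
  proof (rule C.map_out[where g = "\<lambda>x. i' (u x)" and H = "\<lambda>z. c' (al (fst z), snd z)" and Z = Y'])
    show "continuous_on X (\<lambda>x. i' (u x))"
      using u by (intro continuous_on_compose2[OF D.ci u(1)]) auto
    show "continuous_on (A \<times> {0..1}) (\<lambda>z. c' (al (fst z), snd z))"
      by (intro continuous_on_compose2[OF D.cc] continuous_on_compose2[OF al(1)] continuous_intros)
        (auto simp: alA)
  qed (use u that in \<open>auto simp: cone_map_def alA D.base intro!: D.i_in D.c_in D.apex\<close>)
qed

text \<open>\<open>G \<circ> F\<close> ends in a cone attached at \<open>u' (u x0)\<close>;
  \<open>e\<close> carries this base point back to \<open>x0\<close> along \<open>h\<close>, and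
  then \<open>h\<close> and a homotopy on \<open>A\<close> combine into one homotopy on
  \<open>Y\<close>.\<close>

lemma cone_map_left_inverse:
  assumes "cone_attachment X A Y (\<lambda>_. x0) i c" and F: "cone_map X A i c i' c' u al F"
    and G: "cone_map X' A' i' c' i2 c2 u' al' G"
    and u: "u ` X \<subseteq> X'" "u' ` X' \<subseteq> X" and al: "al ` A \<subseteq> A'" "al' ` A' \<subseteq> A"
    and h: "continuous_on ({0..1} \<times> X) h" "h ` ({0..1} \<times> X) \<subseteq> X"
    and h01: "\<And>x. h (0,x) = u' (u x)" "\<And>x. h (1,x) = x"
    and hal: "homotopic_on A A (al' \<circ> al) id"
    and e: "attach_map X A i2 c2 i c (\<lambda>z. h (fst z, x0)) e"
  shows "homotopic_on Y Y (e \<circ> (G \<circ> F)) id"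
proof -
  interpret C: cone_attachment X A Y "\<lambda>_. x0" i c by fact
  obtain k where k: "continuous_on ({0..1::real} \<times> A) k" "k ` ({0..1} \<times> A) \<subseteq> A"
    and k01: "\<And>a. k (0,a) = al' (al a)" "\<And>a. k (1,a) = a"
    by (rule homotopic_canonE[OF hal]) (erule that; simp)
  have x0: "x0 \<in> X" using C.A_ne C.fA by auto
  have hX: "h (w,x) \<in> X" if "0 \<le> w" "w \<le> 1" "x \<in> X" for w x using h that by auto
  have kA: "k (w,a) \<in> A" if "0 \<le> w" "w \<le> 1" "a \<in> A" for w a using k that by auto
  have uX: "u x \<in> X'" "u' (u x) \<in> X" if "x \<in> X" for x using u that by auto
  have alA: "al a \<in> A'" "al' (al a) \<in> A" if "a \<in> A" for a using al that by auto
  \<comment> \<open>At time \<open>w\<close> the base of the cone lies at \<open>h (w, x0)\<close>.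
    A cone line therefore first follows \<open>h\<close> from time \<open>w\<close> to time 1, which
    takes \<open>t\<close> up to \<open>(1 - w)/2\<close>, and then climbs the rescaled cone over
    \<open>k\<close>.\<close>
  define K where "K z = (if snd (snd z) - (1 - fst z) / 2 \<le> 0
      then i (h (fst z + 2 * snd (snd z), x0))
      else c (k (fst z, fst (snd z)), (2 * snd (snd z) - (1 - fst z)) / (1 + fst z)))"
    for z :: "real \<times> 'b \<times> real"
  have quot: "0 \<le> (2 * t - (1 - w)) / (1 + w)" "(2 * t - (1 - w)) / (1 + w) \<le> 1"
    if "0 \<le> t - (1 - w) / 2" "0 \<le> w" "t \<le> 1" for t w :: real
    using that by (auto simp: divide_simps)
  show ?thesis
  proof (rule C.homotopy_out[where h = "\<lambda>z. i (h z)" and K = K])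
    show "continuous_on ({0..1} \<times> X) (\<lambda>z. i (h z))"
      by (intro continuous_on_compose2[OF C.ci] h)
    show "(\<lambda>z. i (h z)) ` ({0..1} \<times> X) \<subseteq> Y" by (auto intro!: C.i_in hX)
    let ?S = "{0..1::real} \<times> A \<times> {0..1::real}"
    show "continuous_on ?S K"
      unfolding K_def
    proof (rule continuous_on_cases_le)
      show "continuous_on {z \<in> ?S. snd (snd z) - (1 - fst z) / 2 \<le> 0}
        (\<lambda>z. i (h (fst z + 2 * snd (snd z), x0)))"
        by (intro continuous_on_compose2[OF C.ci] continuous_on_compose2[OF h(1)] continuous_intros)
          (auto intro!: hX x0)
      show "continuous_on {z \<in> ?S. 0 \<le> snd (snd z) - (1 - fst z) / 2}
        (\<lambda>z. c (k (fst z, fst (snd z)), (2 * snd (snd z) - (1 - fst z)) / (1 + fst z)))"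
        by (intro continuous_on_compose2[OF C.cc] continuous_on_compose2[OF k(1)] continuous_intros)
          (use quot in \<open>auto simp: kA simp del: divide_le_eq_1 zero_le_divide_iff\<close>)
      show "continuous_on ?S (\<lambda>z. snd (snd z) - (1 - fst z) / 2)" by (intro continuous_intros) auto
      fix z :: "real \<times> 'b \<times> real"
      assume z: "z \<in> ?S" "snd (snd z) - (1 - fst z) / 2 = 0"
      then have 1: "fst z + 2 * snd (snd z) = 1" "2 * snd (snd z) - (1 - fst z) = 0" by auto
      show "i (h (fst z + 2 * snd (snd z), x0)) =
        c (k (fst z, fst (snd z)), (2 * snd (snd z) - (1 - fst z)) / (1 + fst z))"
        unfolding 1 using z(1) by (auto simp: h01 C.base kA)
    qed
    show "K ` ?S \<subseteq> Y"
      using quot by (auto simp: K_def simp del: divide_le_eq_1 zero_le_divide_iff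
          intro!: C.i_in C.c_in hX x0 kA)
    show "K (w, a, 0) = i (h (w, x0))" if "0 \<le> w" "w \<le> 1" "a \<in> A" for w a
      using that by (simp add: K_def)
    show "K (w, a, 1) = K (w, a', 1)" if "0 \<le> w" "w \<le> 1" "a \<in> A" "a' \<in> A" for w a a'
      using that by (auto simp: K_def intro!: C.apex kA)
    show "i (h (0, x)) = (e \<circ> (G \<circ> F)) (i x)" "i (h (1, x)) = id (i x)" if "x \<in> X" for x
      using F G e uX that by (simp_all add: h01 cone_map_def attach_map_def)
    fix a t assume a: "a \<in> A" and t: "0 \<le> t" "t \<le> (1::real)"
    show "K (0, a, t) = (e \<circ> (G \<circ> F)) (c (a, t))"
      using F G e alA[OF a] a t by (simp add: K_def k01 cone_map_def attach_map_def)
    show "K (1, a, t) = id (c (a, t))"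
      using a t by (auto simp: K_def h01 k01 C.base)
  qed
qed

text \<open>A contraction \<open>k\<close> of \<open>A\<close> turns the cone coordinate into time:
  \<open>r\<close> sends the point of height \<open>t\<close> over \<open>a\<close> to
  \<open>f (k (t,a))\<close>, which at the apex does not depend on \<open>a\<close>.\<close>

lemma attach_contractible:
  assumes "cone_attachment X A Y f i c" and "contractible A"
  obtains r where "continuous_on Y r" "r ` Y \<subseteq> X" "\<And>x. x \<in> X \<Longrightarrow> r (i x) = x"
    "homotopic_on Y Y (i \<circ> r) id"
proof -
  interpret C: cone_attachment X A Y f i c by fact
  obtain a0 where ka: "homotopic_on A A id (\<lambda>_. a0)"
    using \<open>contractible A\<close> unfolding contractible_def by auto
  obtain k where k: "continuous_on ({0..1::real} \<times> A) k" "k ` ({0..1} \<times> A) \<subseteq> A"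
    and k01: "\<And>a. k (0,a) = a" "\<And>a. k (1,a) = a0"
    by (rule homotopic_canonE[OF ka]) (erule that; simp)
  have kA: "k (w,a) \<in> A" if "0 \<le> w" "w \<le> 1" "a \<in> A" for w a using k that by auto
  have a0: "a0 \<in> A" using kA[of 1] C.A_ne by (auto simp: k01)
  have prod: "0 \<le> v * t" "v * t \<le> 1" if "0 \<le> v" "v \<le> 1" "0 \<le> t" "t \<le> 1" for v t :: real
    using that by (auto intro: mult_le_one)
  obtain r where r: "continuous_on Y r" "r ` Y \<subseteq> X" and ri: "\<And>x. x \<in> X \<Longrightarrow> r (i x) = x"
    and rc: "\<And>a t. a \<in> A \<Longrightarrow> 0 \<le> t \<Longrightarrow> t \<le> 1 \<Longrightarrow> r (c (a,t)) = f (k (t,a))"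
  proof (rule C.map_out[where g = "\<lambda>x. x" and H = "\<lambda>z. f (k (snd z, fst z))" and Z = X])
    show "continuous_on (A \<times> {0..1}) (\<lambda>z. f (k (snd z, fst z)))"
      by (intro continuous_on_compose2[OF C.cf] continuous_on_compose2[OF k(1)] continuous_intros)
        (auto simp: kA)
  qed (use that in \<open>auto simp: k01 intro!: C.f_in kA\<close>)
  \<comment> \<open>\<open>M\<close> contracts horizontally and keeps the height \<open>t\<close>.
    It is joined to \<open>i \<circ> r\<close> by scaling the height to \<open>w * t\<close>, and to
    the identity by slowing the contraction to time \<open>(1 - w) * t\<close>.\<close>
  obtain M where M: "continuous_on Y M" "M ` Y \<subseteq> Y" and Mi: "\<And>x. x \<in> X \<Longrightarrow> M (i x) = i x"
    and Mc: "\<And>a t. a \<in> A \<Longrightarrow> 0 \<le> t \<Longrightarrow> t \<le> 1 \<Longrightarrow> M (c (a,t)) = c (k (t,a), t)"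
  proof (rule C.map_out[where g = i and H = "\<lambda>z. c (k (snd z, fst z), snd z)" and Z = Y])
    show "continuous_on (A \<times> {0..1}) (\<lambda>z. c (k (snd z, fst z), snd z))"
      by (intro continuous_on_compose2[OF C.cc] continuous_on_compose2[OF k(1)] continuous_intros)
        (auto simp: kA)
  qed (use that in \<open>auto simp: k01 C.base C.i_in C.ci intro!: C.c_in kA C.apex\<close>)
  have "homotopic_on Y Y (i \<circ> r) M"
  proof (rule C.homotopy_out[where h = "\<lambda>z. i (snd z)"
        and K = "\<lambda>z. c (k (snd (snd z), fst (snd z)), fst z * snd (snd z))"])
    show "continuous_on ({0..1} \<times> X) (\<lambda>z. i (snd z))"
      by (intro continuous_on_compose2[OF C.ci] continuous_intros) auto
    show "continuous_on ({0..1} \<times> A \<times> {0..1})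
        (\<lambda>z. c (k (snd (snd z), fst (snd z)), fst z * snd (snd z)))"
      by (intro continuous_on_compose2[OF C.cc] continuous_on_compose2[OF k(1)] continuous_intros)
        (auto simp: kA prod)
  qed (auto simp: k01 C.base C.f_in kA prod ri rc Mi Mc intro!: C.i_in C.c_in)
  moreover have "homotopic_on Y Y M id"
  proof (rule C.homotopy_out[where h = "\<lambda>z. i (snd z)"
        and K = "\<lambda>z. c (k ((1 - fst z) * snd (snd z), fst (snd z)), snd (snd z))"])
    show "continuous_on ({0..1} \<times> X) (\<lambda>z. i (snd z))"
      by (intro continuous_on_compose2[OF C.ci] continuous_intros) auto
    show "continuous_on ({0..1} \<times> A \<times> {0..1})
        (\<lambda>z. c (k ((1 - fst z) * snd (snd z), fst (snd z)), snd (snd z)))"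
      by (intro continuous_on_compose2[OF C.cc] continuous_on_compose2[OF k(1)] continuous_intros)
        (auto simp: kA prod)
  qed (auto simp: k01 C.base C.f_in kA prod Mi Mc intro!: C.i_in C.c_in C.apex)
  ultimately show thesis
    by (intro that[OF r ri]) (auto intro: homotopic_with_trans)
qed

section \<open>Wedges of spheres as reduced suspensions\<close>

lemma Hausdorff_fun: "Hausdorff_space (top_of_set (S :: ('b \<Rightarrow> 'c::t2_space) set))"
proof -
  have "Hausdorff_space (product_topology (\<lambda>_. euclidean :: 'c topology) (UNIV :: 'b set))"
    unfolding Hausdorff_space_product_topology using hausdorff[where 'a = 'c]
    by (auto simp: Hausdorff_space_def disjnt_def)
  then show ?thesis
    by (simp add: euclidean_product_topology Hausdorff_space_subtopology)
qed

lemma compact_box_fun: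
  fixes K :: "'b \<Rightarrow> ('c::topological_space) set"
  assumes "\<And>v. compact (K v)"
  shows "compact {x. \<forall>v. x v \<in> K v}"
proof -
  have "compactin (product_topology (\<lambda>_. euclidean) UNIV) (PiE UNIV K)"
    using assms by (simp add: compactin_PiE)
  then show ?thesis
    by (simp add: euclidean_product_topology PiE_UNIV_domain Pi_def)
qed

text \<open>At a zero of \<open>f\<close> the product tends to 0 by boundedness alone, so
  \<open>b\<close> may jump there. The rescaling factor in \<open>expand\<close> does so at height
  0.\<close>

lemma continuous_on_mult_bounded:
  fixes f b :: "'a::topological_space \<Rightarrow> real"
  assumes f: "continuous_on S f" and b: "continuous_on {x \<in> S. f x \<noteq> 0} b"
    and M: "\<And>x. x \<in> S \<Longrightarrow> \<bar>b x\<bar> \<le> M"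
  shows "continuous_on S (\<lambda>x. f x * b x)"
  unfolding continuous_on_def
proof
  fix x assume x: "x \<in> S"
  have fx: "(f \<longlongrightarrow> f x) (at x within S)" using f x by (auto simp: continuous_on_def)
  show "((\<lambda>x. f x * b x) \<longlongrightarrow> f x * b x) (at x within S)"
  proof (cases "f x = 0")
    case True
    have "((\<lambda>y. f y * b y) \<longlongrightarrow> 0) (at x within S)"
    proof (rule Lim_null_comparison)
      show "\<forall>\<^sub>F y in at x within S. norm (f y * b y) \<le> \<bar>f y\<bar> * \<bar>M\<bar>"
        unfolding eventually_at_topological
        by (rule exI[of _ UNIV])
          (auto simp: abs_mult intro!: mult_left_mono order_trans[OF M])
      show "((\<lambda>y. \<bar>f y\<bar> * \<bar>M\<bar>) \<longlongrightarrow> 0) (at x within S)"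
        using tendsto_mult_left_zero[OF tendsto_rabs_zero] fx True by auto
    qed
    then show ?thesis by (simp add: True)
  next
    case False
    have "(b \<longlongrightarrow> b x) (at x within {x \<in> S. f x \<noteq> 0})"
      using b x False by (auto simp: continuous_on_def)
    moreover have "\<forall>\<^sub>F y in at x within S. f y \<noteq> 0"
      using tendsto_imp_eventually_ne[OF fx False] .
    then have "at x within {x \<in> S. f x \<noteq> 0} = at x within S"
      unfolding at_within_def filter_eq_iff eventually_inf_principal
      by (auto simp: eventually_inf_principal elim: eventually_elim2)
    ultimately show ?thesis using fx by (auto intro: tendsto_mult)
  qed
qed

text \<open>The sphere passes through the origin, so its equation becomes: squared norm equals
  \<open>2 * x (i,0)\<close>. The coordinate \<open>x (i,0)\<close> is thus a height function that
  vanishes only at the wedge point.\<close>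

definition on_sphere :: "nat \<Rightarrow> nat \<Rightarrow> (nat \<times> nat \<Rightarrow> real) \<Rightarrow> bool" where
  "on_sphere d i x \<longleftrightarrow> (\<forall>i' j. i' \<noteq> i \<longrightarrow> x (i',j) = 0) \<and> (\<forall>j>d. x (i,j) = 0) \<and>
     (\<Sum>j\<le>d. (x (i,j))\<^sup>2) = 2 * x (i,0)"

lemma wedge_iff: "x \<in> wedge_of_spheres k d \<longleftrightarrow> x = (\<lambda>_. 0) \<or> (\<exists>i<k. on_sphere d i x)"
proof -
  have "(\<Sum>j\<le>d. (x (i,j))\<^sup>2) = (x (i,0))\<^sup>2 + (\<Sum>j\<in>{1..d}. (x (i,j))\<^sup>2)" for i
    by (simp add: atMost_atLeast0 sum.atLeast_Suc_atMost)
  then have "(\<Sum>j\<le>d. (x (i,j))\<^sup>2) = 2 * x (i,0) \<longleftrightarrow>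
      (x (i, 0) - 1)\<^sup>2 + (\<Sum>j\<in>{1..d}. (x (i, j))\<^sup>2) = 1" for i
    by (auto simp: power2_eq_square algebra_simps)
  then show ?thesis unfolding wedge_of_spheres_def on_sphere_def by auto
qed

lemma zero_in_wedge [simp]: "(\<lambda>_. 0) \<in> wedge_of_spheres k d"
  by (simp add: wedge_iff)

lemma on_sphere_bounds:
  assumes "on_sphere d i x"
  shows "snd v = 0 \<Longrightarrow> 0 \<le> x v" and "\<bar>x v\<bar> \<le> 2"
proof -
  have s: "(\<Sum>j\<le>d. (x (i,j))\<^sup>2) = 2 * x (i,0)" using assms by (simp add: on_sphere_def)
  have 0: "0 \<le> x (i,0)" using sum_nonneg[of "{..d}" "\<lambda>j. (x (i,j))\<^sup>2"] s by auto
  show "0 \<le> x v" if "snd v = 0"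
    using 0 that assms by (cases v; cases "fst v = i") (auto simp: on_sphere_def)
  have sq: "(x (i,j))\<^sup>2 \<le> 2 * x (i,0)" if "j \<le> d" for j
    using s member_le_sum[of j "{..d}" "\<lambda>j. (x (i,j))\<^sup>2"] that by auto
  then have "x (i,0) * x (i,0) \<le> 2 * x (i,0)" by (simp add: power2_eq_square)
  then have 2: "x (i,0) \<le> 2" using 0 mult_right_le_imp_le[of "x (i,0)" "x (i,0)" 2] by force
  have "\<bar>x (i,j)\<bar> \<le> 2" if "j \<le> d" for j
    using sq[OF that] 2 abs_le_square_iff[of "x (i,j)" 2] by auto
  moreover have "x (i,j) = 0" if "\<not> j \<le> d" for j using assms that by (auto simp: on_sphere_def)
  ultimately have "\<bar>x (i,j)\<bar> \<le> 2" for j by (cases "j \<le> d") auto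
  then show "\<bar>x v\<bar> \<le> 2"
    using assms by (cases v; cases "fst v = i") (auto simp: on_sphere_def)
qed

lemma on_sphere_zero:
  assumes that: "on_sphere d i x" "x (i,0) = 0"
  shows "x = (\<lambda>_. 0)"
proof
  fix v
  have "(\<Sum>j\<le>d. (x (i,j))\<^sup>2) = 0" using that by (simp add: on_sphere_def)
  then have "\<forall>j\<le>d. x (i,j) = 0" by (simp add: sum_nonneg_eq_0_iff)
  then have "x (i,j) = 0" for j using that by (cases "j \<le> d") (auto simp: on_sphere_def)
  then show "x v = 0" using that by (cases v; cases "fst v = i") (auto simp: on_sphere_def)
qed

lemma compact_wedge: "compact (wedge_of_spheres k d)"
proof -
  have cl: "closed {x. on_sphere d i x}" for i
    unfolding on_sphere_def
    by (intro closed_Collect_conj closed_Collect_all closed_Collect_imp closed_Collect_eq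
        continuous_intros) auto
  have "compact {x. on_sphere d i x}" for i
  proof -
    have "{x. on_sphere d i x} = {x. \<forall>v. x v \<in> {-2..2}} \<inter> {x. on_sphere d i x}"
      using on_sphere_bounds(2) by (auto simp: abs_le_iff) (smt (verit))+
    moreover have "compact \<dots>"
      by (intro compact_Int_closed compact_box_fun cl) auto
    ultimately show ?thesis by simp
  qed
  then have "compact (insert (\<lambda>_. 0) (\<Union>i<k. {x. on_sphere d i x}))"
    by (intro compact_insert compact_UN) auto
  moreover have "insert (\<lambda>_. 0) (\<Union>i<k. {x. on_sphere d i x}) = wedge_of_spheres k d"
    by (auto simp: wedge_iff)
  ultimately show ?thesis by simp
qed

lemma wedge_bounds:
  assumes "x \<in> wedge_of_spheres k d"
  shows "0 \<le> x (i,0)" "x (i,0) \<le> 2"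
  using assms on_sphere_bounds[of d _ x "(i,0)"] by (auto simp: wedge_iff abs_le_iff)

lemma wedge_vanish:
  assumes "x \<in> wedge_of_spheres k d" "d < j" shows "x (a,j) = 0"
proof -
  have "x (a,j) = 0" if "on_sphere d i x" for i
    using that assms(2) by (cases "a = i") (simp_all add: on_sphere_def)
  then show ?thesis using assms(1) unfolding wedge_iff by auto
qed

text \<open>The reduced suspension coordinates: \<open>t \<mapsto> susp d (s,t)\<close> runs through the circle of diameter
  \<open>[0,s]\<close> in the plane spanned by \<open>s\<close> and the last basis vector; \<open>\<bar>s\<bar>\<^sup>2 = 2 s\<^sub>0\<close> on the sphere.\<close>

definition susp :: "nat \<Rightarrow> (nat \<times> nat \<Rightarrow> real) \<times> real \<Rightarrow> nat \<times> nat \<Rightarrow> real" where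
  "susp d = (\<lambda>(s,t) (i,j). if j \<le> d then s (i,j) * (sin (pi * t))\<^sup>2
     else if j = Suc d then sqrt (2 * s (i,0)) * sin (pi * t) * cos (pi * t) else 0)"

lemma continuous_on_susp:
  assumes "continuous_on S f" "continuous_on S g"
  shows "continuous_on S (\<lambda>z. susp d (f z, g z))"
proof (rule continuous_on_coordinatewise_then_product)
  fix v :: "nat \<times> nat"
  obtain i j where v: "v = (i,j)" by (cases v)
  have "continuous_on S (\<lambda>x. sin (pi * g x))" "continuous_on S (\<lambda>x. cos (pi * g x))"
    by (rule continuous_on_compose2[where t = UNIV];
        auto intro!: continuous_intros assms(2))+
  with v show "continuous_on S (\<lambda>z. susp d (f z, g z) v)"
    unfolding susp_def using assms(2) continuous_on_product_then_coordinatewise[OF assms(1)]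
    by (cases "j \<le> d"; cases "j = Suc d") (auto intro!: continuous_intros)
qed

lemma susp_on_sphere:
  assumes "on_sphere d i s"
  shows "on_sphere (Suc d) i (susp d (s,t))"
proof -
  let ?S = "(sin (pi * t))\<^sup>2"
  have s: "(\<Sum>j\<le>d. (s (i,j))\<^sup>2) = 2 * s (i,0)" and 0: "0 \<le> s (i,0)"
    using assms on_sphere_bounds(1)[OF assms, of "(i,0)"] by (auto simp: on_sphere_def)
  have "(\<Sum>j\<le>Suc d. (susp d (s,t) (i,j))\<^sup>2) =
      (\<Sum>j\<le>d. (s (i,j))\<^sup>2 * ?S\<^sup>2) + 2 * s (i,0) * ?S * (cos (pi * t))\<^sup>2"
    using 0 by (simp add: susp_def power_mult_distrib)
  also have "\<dots> = 2 * s (i,0) * ?S * (?S + (cos (pi * t))\<^sup>2)"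
    unfolding sum_distrib_right[symmetric] s cos_squared_eq
    by (simp add: power2_eq_square algebra_simps)
  also have "\<dots> = 2 * susp d (s,t) (i,0)" by (simp add: susp_def)
  finally show ?thesis using assms by (auto simp: on_sphere_def susp_def)
qed

lemma susp_zero [simp]: "susp d (\<lambda>_. 0, t) = (\<lambda>_. 0)" "susp d (s,0) = (\<lambda>_. 0)" "susp d (s,1) = (\<lambda>_. 0)"
  by (auto simp: susp_def fun_eq_iff)

lemma susp_in_wedge: "s \<in> wedge_of_spheres l d \<Longrightarrow> susp d (s,t) \<in> wedge_of_spheres l (Suc d)"
  using susp_on_sphere by (auto simp: wedge_iff)

lemma sin_pi_pos: "0 < t \<Longrightarrow> t < 1 \<Longrightarrow> 0 < sin (pi * t)"
  by (intro sin_gt_zero) auto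

text \<open>Away from the wedge point the coordinates are recovered in turn: the 0-th one gives
  \<open>sqrt (2 * s (i,0)) * sin (pi * t)\<close>, the last one then \<open>cos (pi * t)\<close>
  and so \<open>t\<close>, and dividing by the squared sine gives \<open>s\<close>.\<close>

lemma susp_inj:
  assumes s: "s \<in> wedge_of_spheres l d" "s' \<in> wedge_of_spheres l d"
    and t: "t \<in> {0..1}" "t' \<in> {0..1}" and eq: "susp d (s,t) = susp d (s',t')"
  shows "susp d (s,t) = (\<lambda>_. 0) \<and> (s = (\<lambda>_. 0) \<or> t = 0 \<or> t = 1) \<or> s = s' \<and> t = t'"
proof (cases "s = (\<lambda>_. 0) \<or> t = 0 \<or> t = 1")
  case True
  then show ?thesis by auto
next
  case False
  then obtain i where i: "on_sphere d i s" using s by (auto simp: wedge_iff)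
  have s0: "0 < s (i,0)"
    using on_sphere_zero[OF i] on_sphere_bounds(1)[OF i, of "(i,0)"] False by force
  have t01: "0 < t" "t < 1" using False t by auto
  have S: "0 < sin (pi * t)" by (rule sin_pi_pos[OF t01])
  have e: "susp d (s,t) v = susp d (s',t') v" for v using eq by simp
  have e0: "s (i,0) * (sin (pi * t))\<^sup>2 = s' (i,0) * (sin (pi * t'))\<^sup>2"
    using e[of "(i,0)"] by (simp add: susp_def)
  have "0 < s (i,0) * (sin (pi * t))\<^sup>2" using s0 S by simp
  then have "s' (i,0) \<noteq> 0" "sin (pi * t') \<noteq> 0" unfolding e0 by auto
  moreover have "0 \<le> s' (i,0)" using wedge_bounds(1)[OF s(2)] .
  moreover have t'01: "0 < t'" "t' < 1" using calculation(2) t(2) by (auto simp: order_less_le)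
  ultimately have s'0: "0 < s' (i,0)" and S': "0 < sin (pi * t')"
    using sin_pi_pos by auto
  have r: "sqrt (2 * s (i,0)) * sin (pi * t) = sqrt (2 * s' (i,0)) * sin (pi * t')"
  proof (rule power2_eq_imp_eq)
    show "(sqrt (2 * s (i,0)) * sin (pi * t))\<^sup>2 = (sqrt (2 * s' (i,0)) * sin (pi * t'))\<^sup>2"
      using e0 s0 s'0 by (simp add: power_mult_distrib)
  qed (use s0 s'0 S S' in auto)
  have "sqrt (2 * s (i,0)) * sin (pi * t) * cos (pi * t) = sqrt (2 * s' (i,0)) * sin (pi * t') * cos (pi * t')"
    using e[of "(i, Suc d)"] by (simp add: susp_def)
  then have cc: "cos (pi * t) = cos (pi * t')"
    using r s0 s'0 S S' by simp
  have "pi * t = pi * t'"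
  proof (rule cos_inj_pi[OF _ _ _ _ cc])
    show "0 \<le> pi * t" "0 \<le> pi * t'" using t by simp_all
    show "pi * t \<le> pi" "pi * t' \<le> pi" by (rule mult_left_le; use t in simp)+
  qed
  then have tt: "t = t'" by simp
  have "s (a,j) = s' (a,j)" for a j
  proof (cases "j \<le> d")
    case True
    then show ?thesis using e[of "(a,j)"] S by (simp add: susp_def tt)
  next
    case False
    then show ?thesis using s by (simp add: wedge_vanish)
  qed
  then show ?thesis using tt by auto
qed

lemma susp_surj:
  assumes "on_sphere (Suc d) i x" and "x \<noteq> (\<lambda>_. 0)"
  shows "\<exists>s t. on_sphere d i s \<and> t \<in> {0..1} \<and> x = susp d (s,t)"
proof -
  have x0: "0 < x (i,0)"
    using on_sphere_zero[OF assms(1)] on_sphere_bounds(1)[OF assms(1), of "(i,0)"] assms(2) by force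
  define y where "y = x (i, Suc d)"
  \<comment> \<open>For \<open>x = susp d (s,t)\<close> the squared last coordinate is
    \<open>2 * x (i,0)\<close> times the squared cosine, so this quotient has to be
    \<open>cos (pi * t)\<close>.\<close>
  define q where "q = y / sqrt (2 * x (i,0))"
  have sum: "(\<Sum>j\<le>d. (x (i,j))\<^sup>2) + y\<^sup>2 = 2 * x (i,0)"
    using assms(1) by (simp add: on_sphere_def y_def)
  have "(x (i,0))\<^sup>2 \<le> (\<Sum>j\<le>d. (x (i,j))\<^sup>2)"
    by (rule member_le_sum[of 0 "{..d}" "\<lambda>j. (x (i,j))\<^sup>2"]) auto
  \<comment> \<open>Strict because \<open>x (i,0)\<close> is positive; this keeps the later
    denominator \<open>1 - q\<^sup>2\<close> away from 0.\<close>
  then have "y\<^sup>2 < 2 * x (i,0)" using sum x0 by (smt (verit) zero_less_power)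
  then have q2: "q\<^sup>2 < 1" using x0 by (simp add: q_def power_divide)
  then have q: "-1 < q" "q < 1" using abs_square_less_1[of q] by auto
  define t where "t = arccos q / pi"
  have cos_t: "cos (pi * t) = q" using q by (simp add: t_def)
  have sin_t: "(sin (pi * t))\<^sup>2 = 1 - q\<^sup>2" by (simp add: sin_squared_eq cos_t)
  have t: "t \<in> {0..1}" using q arccos_lbound[of q] arccos_ubound[of q] by (auto simp: t_def)
  have S0: "0 \<le> sin (pi * t)" using t mult_left_le[of t pi] by (intro sin_ge_zero) (auto simp del: mult_le_cancel_left2)
  define s where "s = (\<lambda>(a::nat,j::nat). if j \<le> d then x (a,j) / (1 - q\<^sup>2) else 0)"
  have q2x: "q\<^sup>2 * (2 * x (i,0)) = y\<^sup>2" using x0 by (simp add: q_def power_divide)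
  have "(\<Sum>j\<le>d. (s (i,j))\<^sup>2) = (\<Sum>j\<le>d. (x (i,j))\<^sup>2) / (1 - q\<^sup>2)\<^sup>2"
    by (simp add: s_def power_divide sum_divide_distrib)
  also have "(\<Sum>j\<le>d. (x (i,j))\<^sup>2) = 2 * x (i,0) * (1 - q\<^sup>2)"
    using sum q2x by (simp add: algebra_simps)
  also have "\<dots> / (1 - q\<^sup>2)\<^sup>2 = 2 * s (i,0)"
    using q2 by (simp add: s_def power2_eq_square)
  finally have on: "on_sphere d i s" using assms(1) by (auto simp: on_sphere_def s_def)
  have last: "sqrt (2 * s (i,0)) * sin (pi * t) = sqrt (2 * x (i,0))"
  proof (rule power2_eq_imp_eq)
    show "(sqrt (2 * s (i,0)) * sin (pi * t))\<^sup>2 = (sqrt (2 * x (i,0)))\<^sup>2"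
      using q2 x0 sin_t by (simp add: power_mult_distrib s_def)
  qed (use x0 S0 q2 in \<open>auto simp: s_def\<close>)
  have "x = susp d (s,t)"
  proof
    fix v :: "nat \<times> nat"
    obtain a j where v: "v = (a,j)" by (cases v)
    consider "j \<le> d" | "j = Suc d" "a = i" | "j = Suc d" "a \<noteq> i" | "j > Suc d" by linarith
    then show "x v = susp d (s,t) v"
    proof cases
      case 1
      then show ?thesis using q2 by (simp add: v susp_def s_def sin_t)
    next
      case 2
      then show ?thesis using x0 by (simp add: v susp_def last cos_t) (simp add: q_def y_def)
    next
      case 3
      then show ?thesis using assms(1) by (simp add: v susp_def s_def on_sphere_def)
    next
      case 4
      then show ?thesis using assms(1) by (cases "a = i") (auto simp: v susp_def on_sphere_def)
    qed
  qed
  with on t show ?thesis by blast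
qed

text \<open>The curve \<open>r \<mapsto> susp d (s, r * t)\<close> runs from the wedge point to
  \<open>susp d (s,t)\<close>. Two-point spheres have no such curves, hence
  \<open>Suc d\<close>.\<close>

lemma path_connected_wedge: "path_connected (wedge_of_spheres k (Suc d))"
proof -
  have "path_component (wedge_of_spheres k (Suc d)) (\<lambda>_. 0) x"
    if x: "x \<in> wedge_of_spheres k (Suc d)" for x
  proof (cases "x = (\<lambda>_. 0)")
    case True
    show ?thesis unfolding True by (rule path_component_refl) (rule zero_in_wedge)
  next
    case False
    then obtain i where i: "i < k" "on_sphere (Suc d) i x" using x by (auto simp: wedge_iff)
    then obtain s t where s: "on_sphere d i s" "t \<in> {0..1}" "x = susp d (s,t)"
      using susp_surj[OF i(2) False] by blast
    define g where "g r = susp d (s, r * t)" for r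
    have "continuous_on {0..1} g" unfolding g_def by (intro continuous_on_susp continuous_intros)
    moreover have "g r \<in> wedge_of_spheres k (Suc d)" for r
      unfolding g_def by (rule susp_in_wedge) (use i s in \<open>auto simp: wedge_iff\<close>)
    ultimately show ?thesis
      unfolding path_component_def path_def path_image_def pathstart_def pathfinish_def
      by (intro exI[of _ g]) (auto simp: g_def s(3))
  qed
  then show ?thesis
    unfolding path_connected_component by (meson path_component_sym path_component_trans)
qed

section \<open>Splitting a wedge into two groups of spheres\<close>

definition shift :: "nat \<Rightarrow> (nat \<times> nat \<Rightarrow> real) \<Rightarrow> nat \<times> nat \<Rightarrow> real" where
  "shift k x = (\<lambda>(i,j). if i < k then 0 else x (i - k, j))"

lemma shift_zero [simp]: "shift k (\<lambda>_. 0) = (\<lambda>_. 0)" by (auto simp: shift_def)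

lemma shift_inj: "shift k x = shift k y \<Longrightarrow> x = y"
proof
  fix v assume eq: "shift k x = shift k y"
  show "x v = y v" using fun_cong[OF eq, of "(fst v + k, snd v)"] by (simp add: shift_def)
qed

lemma continuous_on_shift:
  assumes "continuous_on S f"
  shows "continuous_on S (\<lambda>z. shift k (f z))"
proof (rule continuous_on_coordinatewise_then_product)
  fix v :: "nat \<times> nat"
  show "continuous_on S (\<lambda>z. shift k (f z) v)"
    unfolding shift_def using continuous_on_product_then_coordinatewise[OF assms]
    by (cases v; cases "fst v < k") auto
qed

lemma on_sphere_shift:
  assumes "on_sphere d i x" shows "on_sphere d (k + i) (shift k x)"
  using assms unfolding on_sphere_def shift_def by auto

lemma on_sphere_unshift:
  assumes "on_sphere d i x" "k \<le> i"
  shows "on_sphere d (i - k) (\<lambda>(a,j). x (a + k, j))" "x = shift k (\<lambda>(a,j). x (a + k, j))"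
  using assms unfolding on_sphere_def shift_def by (auto simp: fun_eq_iff)

lemma wedge_inter_shift:
  assumes "x \<in> wedge_of_spheres k d" "x = shift k y" shows "x = (\<lambda>_. 0)"
proof (rule ccontr)
  assume "x \<noteq> (\<lambda>_. 0)"
  then obtain i where "i < k" "on_sphere d i x" using assms by (auto simp: wedge_iff)
  then have "x v = 0" for v using assms(2) by (cases v; cases "fst v = i") (auto simp: on_sphere_def shift_def)
  then show False using \<open>x \<noteq> (\<lambda>_. 0)\<close> by auto
qed

text \<open>Presents the larger wedge by the same two pieces as a cone attachment, a wedge and a
  cylinder, so that maps in both directions can be defined piece by piece.\<close>

lemma wedge_gluing:
  "gluing (wedge_of_spheres k (Suc d)) (wedge_of_spheres l d \<times> {0..1}) (wedge_of_spheres (k + l) (Suc d))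
     (\<lambda>x. x) (\<lambda>b. shift k (susp d b))"
proof
  show "compact (wedge_of_spheres k (Suc d))" "compact (wedge_of_spheres l d \<times> {0..1::real})"
    by (auto intro!: compact_Times compact_wedge)
  show "Hausdorff_space (top_of_set (wedge_of_spheres (k + l) (Suc d)))" by (rule Hausdorff_fun)
  have "continuous_on (wedge_of_spheres l d \<times> {0..1}) (\<lambda>b. shift k (susp d (fst b, snd b)))"
    by (intro continuous_on_shift continuous_on_susp continuous_intros)
  then show "continuous_on (wedge_of_spheres l d \<times> {0..1}) (\<lambda>b. shift k (susp d b))" by simp
  show "wedge_of_spheres (k + l) (Suc d) = (\<lambda>x. x) ` wedge_of_spheres k (Suc d) \<union>
      (\<lambda>b. shift k (susp d b)) ` (wedge_of_spheres l d \<times> {0..1})" (is "?L = ?R")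
  proof
    show "?L \<subseteq> ?R"
    proof
      fix x assume "x \<in> ?L"
      then consider "x = (\<lambda>_. 0)" | i where "i < k" "on_sphere (Suc d) i x"
        | i where "i < k + l" "k \<le> i" "on_sphere (Suc d) i x" "x \<noteq> (\<lambda>_. 0)"
        by (auto simp: wedge_iff) (meson not_le)
      then show "x \<in> ?R"
      proof cases
        case 3
        let ?y = "\<lambda>(a,j). x (a + k, j)"
        have y: "on_sphere (Suc d) (i - k) ?y" "x = shift k ?y"
          using on_sphere_unshift[OF 3(3,2)] by auto
        then have "?y \<noteq> (\<lambda>_. 0)" using 3(4) by (metis shift_zero)
        then obtain s t where st: "on_sphere d (i - k) s" "t \<in> {0..1}" "?y = susp d (s,t)"
          using susp_surj[OF y(1)] by blast
        have "x = shift k (susp d (s,t))" using y(2) st(3) by simp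
        moreover have "s \<in> wedge_of_spheres l d" using st(1) 3 by (auto simp: wedge_iff)
        ultimately show ?thesis using st(2) by blast
      qed (auto simp: wedge_iff)
    qed
    show "?R \<subseteq> ?L"
      using on_sphere_shift[of "Suc d"] susp_on_sphere
      by (auto simp: wedge_iff) (meson nat_add_left_cancel_less trans_less_add1)+
  qed
qed auto

section \<open>Attaching a null-homotopic cone to a wedge of spheres\<close>

text \<open>The wedge of suspensions is the unreduced suspension of the wedge with the suspension of the
  base point collapsed. A homotopy inverse of the collapse comes from the deformation
  \<open>collapse\<close> below, which at time \<open>v = 1\<close> contracts the suspension of the base point to a pole.
  First \<open>expand v\<close> pushes a neighbourhood of the base point of each sphere into the base point;
  \<open>s (i,0)\<close> is used as height function.\<close>

definition cap :: "real \<Rightarrow> real \<Rightarrow> real" where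
  "cap v h = (1 + v) * h / 2 - v"

text \<open>The height \<open>h\<close> becomes \<open>r = 2 * max 0 (cap v h)\<close>. Here
  \<open>cap v 2 = 1\<close>, \<open>cap 0 h = h/2\<close> and \<open>cap 1 h = h - 1\<close>: the
  top of a sphere keeps its height, nothing moves at time 0, and at time 1 the lower half is
  collapsed.\<close>

definition expand :: "real \<Rightarrow> (nat \<times> nat \<Rightarrow> real) \<Rightarrow> nat \<times> nat \<Rightarrow> real" where
  "expand v s = (\<lambda>(i,j). if j = 0 then 2 * max 0 (cap v (s (i,0)))
     else s (i,j) * sqrt ((1 + v) * (2 * max 0 (cap v (s (i,0)))) / s (i,0)))"

lemma cap_le: "2 * cap v h \<le> h" if "0 \<le> v" "h \<le> 2"
proof -
  have "v * h \<le> v * 2" using that by (intro mult_left_mono) auto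
  then show ?thesis by (simp add: cap_def algebra_simps)
qed

text \<open>At height \<open>h\<close> the squares of the other coordinates sum to
  \<open>h * (2 - h)\<close>. Since \<open>2 - 2 * cap v h = (1 + v) * (2 - h)\<close>, the factor
  \<open>(1 + v) * r / h\<close> turns this sum into \<open>r * (2 - r)\<close> for the new height
  \<open>r\<close>.\<close>

lemma expand_on_sphere:
  assumes s: "on_sphere d i s" and v: "0 \<le> v" "v \<le> 1"
  shows "on_sphere d i (expand v s)"
proof -
  let ?h = "s (i,0)" let ?r = "2 * max 0 (cap v (s (i,0)))"
  have h0: "0 \<le> ?h" using on_sphere_bounds(1)[OF s] by simp
  have sum: "(\<Sum>j\<in>{1..d}. (s (i,j))\<^sup>2) = 2 * ?h - ?h\<^sup>2"
    using s by (simp add: on_sphere_def atMost_atLeast0 sum.atLeast_Suc_atMost)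
  have "(\<Sum>j\<le>d. (expand v s (i,j))\<^sup>2) = ?r\<^sup>2 + (\<Sum>j\<in>{1..d}. (expand v s (i,j))\<^sup>2)"
    by (simp add: atMost_atLeast0 sum.atLeast_Suc_atMost expand_def)
  also have "(\<Sum>j\<in>{1..d}. (expand v s (i,j))\<^sup>2) = (\<Sum>j\<in>{1..d}. (s (i,j))\<^sup>2 * ((1 + v) * ?r / ?h))"
    using h0 v by (intro sum.cong) (auto simp: expand_def power_mult_distrib)
  also have "\<dots> = (2 * ?h - ?h\<^sup>2) * ((1 + v) * ?r / ?h)"
    by (simp only: sum_distrib_right[symmetric] sum)
  also have "?r\<^sup>2 + \<dots> = 2 * ?r"
  proof (cases "cap v ?h \<le> 0")
    case True
    then show ?thesis by simp
  next
    case False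
    then have "?h \<noteq> 0" using v by (auto simp: cap_def)
    then have "(2 * ?h - ?h\<^sup>2) * ((1 + v) * ?r / ?h) = (2 - ?h) * (1 + v) * ?r"
      by (simp add: power2_eq_square field_simps)
    then have "?r\<^sup>2 + (2 * ?h - ?h\<^sup>2) * ((1 + v) * ?r / ?h) = (?r + (2 - ?h) * (1 + v)) * ?r"
      by (simp only: power2_eq_square distrib_right)
    also have "?r + (2 - ?h) * (1 + v) = 2" using False by (simp add: cap_def algebra_simps)
    finally show ?thesis .
  qed
  finally have "(\<Sum>j\<le>d. (expand v s (i,j))\<^sup>2) = 2 * expand v s (i,0)" by (simp add: expand_def)
  then show ?thesis using s v by (auto simp: on_sphere_def expand_def cap_def)
qed

lemma expand_zero: "expand v (\<lambda>_. 0) = (\<lambda>_. 0)" if "0 \<le> v"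
  using that by (auto simp: expand_def cap_def)

lemma expand_in_wedge:
  "s \<in> wedge_of_spheres l d \<Longrightarrow> 0 \<le> v \<Longrightarrow> v \<le> 1 \<Longrightarrow> expand v s \<in> wedge_of_spheres l d"
  using expand_on_sphere by (auto simp: wedge_iff expand_zero)

lemma wedge_height_zero:
  assumes "s \<in> wedge_of_spheres l d" "s (i,0) = 0" shows "s (i,j) = 0"
proof -
  have "s (i,j) = 0" if "on_sphere d a s" for a
  proof (cases "a = i")
    case True
    then show ?thesis using on_sphere_zero that assms(2) by metis
  next
    case False
    then show ?thesis using that by (simp add: on_sphere_def)
  qed
  then show ?thesis using assms(1) unfolding wedge_iff by auto
qed

lemma expand_0: "expand 0 s = s" if "s \<in> wedge_of_spheres l d"
proof
  fix w :: "nat \<times> nat"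
  obtain i j where w: "w = (i,j)" by (cases w)
  have 0: "0 \<le> s (i,0)" by (rule wedge_bounds(1)[OF that])
  show "expand 0 s w = s w"
    using 0 wedge_height_zero[OF that, of i j] by (auto simp: w expand_def cap_def)
qed

lemma continuous_on_expand:
  "continuous_on {z. fst z \<in> wedge_of_spheres l d \<and> snd z \<in> {0..1}} (\<lambda>z. expand (snd z) (fst z))"
  (is "continuous_on ?S _")
proof (rule continuous_on_coordinatewise_then_product)
  fix w :: "nat \<times> nat"
  obtain i j where w: "w = (i,j)" by (cases w)
  have c: "continuous_on S (\<lambda>z. fst z u :: real)" for S :: "((nat \<times> nat \<Rightarrow> real) \<times> real) set" and u
    by (rule continuous_on_product_then_coordinatewise) (intro continuous_intros)
  have capc: "continuous_on S (\<lambda>z. cap (snd z) (fst z (i,0)))" for S :: "((nat \<times> nat \<Rightarrow> real) \<times> real) set"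
    unfolding cap_def by (intro continuous_intros c) auto
  show "continuous_on ?S (\<lambda>z. expand (snd z) (fst z) w)"
  proof (cases "j = 0")
    case True
    then show ?thesis by (auto simp: w expand_def intro!: continuous_intros capc)
  next
    case False
    let ?b = "\<lambda>z. sqrt ((1 + snd z) * (2 * max 0 (cap (snd z) (fst z (i,0)))) / fst z (i,0))"
    have nz: "s (i,0) \<noteq> 0" if "s \<in> wedge_of_spheres l d" "s (i,j) \<noteq> 0" for s
      using that wedge_height_zero by blast
    \<comment> \<open>\<open>?b\<close> jumps at height 0 and time 0. It is bounded by
      \<open>sqrt 2\<close> because \<open>2 * cap v h \<le> h\<close> and
      \<open>1 + v \<le> 2\<close>.\<close>
    have "continuous_on ?S (\<lambda>z. fst z (i,j) * ?b z)"
    proof (rule continuous_on_mult_bounded[where M = "sqrt 2"])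
      show "continuous_on {z \<in> ?S. fst z (i,j) \<noteq> 0} ?b"
        by (intro continuous_intros c capc) (use nz in auto)
      fix z assume z: "z \<in> ?S"
      have h: "0 \<le> fst z (i,0)" "fst z (i,0) \<le> 2" using z wedge_bounds by auto
      have v: "0 \<le> snd z" "snd z \<le> 1" using z by auto
      have "(1 + snd z) * (2 * max 0 (cap (snd z) (fst z (i,0)))) \<le> 2 * fst z (i,0)"
        using cap_le[OF v(1) h(2)] h v by (intro mult_mono) auto
      then have "(1 + snd z) * (2 * max 0 (cap (snd z) (fst z (i,0)))) / fst z (i,0) \<le> 2"
        using h by (cases "fst z (i,0) = 0") (auto simp: divide_le_eq)
      moreover have "0 \<le> (1 + snd z) * (2 * max 0 (cap (snd z) (fst z (i,0)))) / fst z (i,0)"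
        using h v by auto
      ultimately show "\<bar>?b z\<bar> \<le> sqrt 2" by simp
    qed (rule c)
    then show ?thesis using False by (simp add: w expand_def)
  qed
qed

text \<open>The cone height used by the deformation \<open>psi\<close> below.
  \<open>t / (1 - v / 2)\<close> rises to 1 at the switching time \<open>t = 1 - v / 2\<close>, from
  where \<open>3 - 2 * t - v\<close> falls to \<open>1 - v\<close>. The term with \<open>cap\<close>
  bounds the line over the wedge point by \<open>1 - v\<close>, so that this line shrinks to height
  0 at \<open>v = 1\<close>. On the wedge at most one summand is nonzero, so the sum is the height
  of \<open>s\<close>.\<close>

definition level :: "nat \<Rightarrow> real \<Rightarrow> (nat \<times> nat \<Rightarrow> real) \<Rightarrow> real \<Rightarrow> real" where
  "level l v s t = min 1 (min (1 + cap v (\<Sum>i<l. s (i,0))) (min (t / (1 - v / 2)) (3 - 2 * t - v)))"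

lemma wedge_height:
  assumes "s \<in> wedge_of_spheres l d" "s \<noteq> (\<lambda>_. 0)"
  obtains i where "on_sphere d i s" "(\<Sum>i<l. s (i,0)) = s (i,0)"
proof -
  obtain i where i: "i < l" "on_sphere d i s" using assms by (auto simp: wedge_iff)
  have "(\<Sum>a<l. s (a,0)) = (\<Sum>a\<in>{i}. s (a,0))"
    using i by (intro sum.mono_neutral_right) (auto simp: on_sphere_def)
  with i that show thesis by auto
qed

lemma height_nonneg: "0 \<le> (\<Sum>i<l. s (i,0))" if "s \<in> wedge_of_spheres l d"
  by (intro sum_nonneg wedge_bounds(1)[OF that])

lemma level_bounds:
  assumes "s \<in> wedge_of_spheres l d" "0 \<le> v" "v \<le> 1" "0 \<le> t" "t \<le> 1"
  shows "0 \<le> level l v s t" "level l v s t \<le> 1"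
proof -
  have "0 \<le> (1 + v) * (\<Sum>i<l. s (i,0)) / 2" using height_nonneg[OF assms(1)] assms by auto
  then have "0 \<le> 1 + cap v (\<Sum>i<l. s (i,0))" using assms by (simp add: cap_def)
  then show "0 \<le> level l v s t" using assms by (simp add: level_def)
  show "level l v s t \<le> 1" by (simp add: level_def)
qed

text \<open>Makes \<open>psi\<close> well defined where it switches from the line over
  \<open>expand v s\<close> to the line over the wedge point: the two lines meet at the apex, or
  they are the same line.\<close>

lemma level_switch:
  assumes s: "s \<in> wedge_of_spheres l d" and v: "0 \<le> v" "v \<le> 1" and t: "t - (1 - v / 2) = 0"
  shows "level l v s t = 1 \<or> expand v s = (\<lambda>_. 0)"
proof (cases "s = (\<lambda>_. 0)")
  case True
  then show ?thesis using v by (simp add: expand_zero)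
next
  case False
  obtain i where i: "on_sphere d i s" "(\<Sum>i<l. s (i,0)) = s (i,0)" by (rule wedge_height[OF s False])
  show ?thesis
  proof (cases "cap v (s (i,0)) \<le> 0")
    case True
    then show ?thesis
      using on_sphere_zero[OF expand_on_sphere[OF i(1) v]] by (simp add: expand_def)
  next
    case False
    have "t = 1 - v / 2" using t by simp
    then have e: "t / (1 - v / 2) = 1" "3 - 2 * t - v = 1" using v by auto
    have "level l v s t = 1" unfolding level_def i(2) e using False by simp
    then show ?thesis ..
  qed
qed

lemma level_0 [simp]: "level l v s 0 = 0" if "s \<in> wedge_of_spheres l d" "0 \<le> v" "v \<le> 1"
  using that level_bounds(1)[OF that, of 0] by (simp add: level_def)

lemma level_time0: "level l 0 s t = t" if "s \<in> wedge_of_spheres l d" "0 \<le> t" "t \<le> 1"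
  using height_nonneg[OF that(1)] that by (simp add: level_def cap_def)

lemma level_time1: "level l 1 s t = 0"
  if "s \<in> wedge_of_spheres l d" "0 \<le> t" "t \<le> 1" "s = (\<lambda>_. 0) \<or> t = 0 \<or> t = 1"
  using that(4) level_bounds(1)[OF that(1) _ _ that(2,3), of 1] that(2,3)
  by (auto simp: level_def cap_def)

lemma level_end: "level l v s 1 = 1 - v" if "s \<in> wedge_of_spheres l d" "0 \<le> v" "v \<le> 1"
proof -
  have "0 \<le> (1 + v) * (\<Sum>i<l. s (i,0)) / 2" using height_nonneg[OF that(1)] that by auto
  moreover define a where "a = 1 / (1 - v / 2)"
  moreover have "1 \<le> a" using that by (simp add: a_def divide_simps)
  ultimately show ?thesis unfolding level_def a_def[symmetric] using that by (simp add: cap_def)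
qed

text \<open>A cone attached at a point is an unreduced suspension, and \<open>F\<close> collapses
  its arc over the wedge point. The deformation \<open>psi\<close> shrinks this arc inside
  \<open>Y\<close> while the image of the other wedge stays fixed, so its end map factors through
  \<open>F\<close> and gives the inverse.\<close>

lemma attach_wedge_homotopy_eqv:
  assumes "cone_attachment (wedge_of_spheres k (Suc d)) (wedge_of_spheres l d) Y (\<lambda>_ _. 0) i c"
  shows "Y homotopy_eqv wedge_of_spheres (k + l) (Suc d)"
proof -
  let ?X = "wedge_of_spheres k (Suc d)" let ?A = "wedge_of_spheres l d"
  let ?Z = "wedge_of_spheres (k + l) (Suc d)" let ?o = "\<lambda>_ :: nat \<times> nat. 0 :: real"
  let ?sig = "\<lambda>b. shift k (susp d b)"
  interpret C: cone_attachment ?X ?A Y "\<lambda>_. ?o" i c by fact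
  interpret Z: gluing ?X "?A \<times> {0..1}" ?Z "\<lambda>x. x" ?sig by (rule wedge_gluing)
  have sigZ: "?sig (s,t) \<in> ?Z" if "s \<in> ?A" "0 \<le> t" "t \<le> 1" for s t using that Z.cov by auto
  have XZ: "x \<in> ?Z" if "x \<in> ?X" for x using that Z.cov by auto
  have sig_eq: "?sig (s,t) = ?o \<and> ?sig (s',t') = ?o \<and> (s = ?o \<or> t = 0 \<or> t = 1) \<and>
      (s' = ?o \<or> t' = 0 \<or> t' = 1) \<or> s = s' \<and> t = t'"
    if "s \<in> ?A" "s' \<in> ?A" "t \<in> {0..1}" "t' \<in> {0..1}" "?sig (s,t) = ?sig (s',t')" for s s' t t'
    using susp_inj[OF that(1-4) shift_inj[OF that(5)]]
      susp_inj[OF that(2,1,4,3) shift_inj[OF that(5)[symmetric]]] shift_inj[OF that(5)] by auto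
  have X_eq: "x = ?o \<and> (s = ?o \<or> t = 0 \<or> t = 1)"
    if "x \<in> ?X" "s \<in> ?A" "t \<in> {0..1}" "x = ?sig (s,t)" for x s t
  proof -
    have x: "x = ?o" by (rule wedge_inter_shift[OF that(1,4)])
    then have "susp d (s,t) = susp d (s,0)" using that(4) shift_inj[of k "susp d (s,t)" ?o] by simp
    then show ?thesis using x susp_inj[OF that(2,2,3), of 0] by auto
  qed

  obtain F where F: "continuous_on Y F" "F ` Y \<subseteq> ?Z" and Fi: "\<And>x. x \<in> ?X \<Longrightarrow> F (i x) = x"
    and Fc: "\<And>s t. s \<in> ?A \<Longrightarrow> 0 \<le> t \<Longrightarrow> t \<le> 1 \<Longrightarrow> F (c (s,t)) = ?sig (s,t)"
    by (rule C.map_out[where g = "\<lambda>x. x" and H = ?sig and Z = ?Z])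
      (use that in \<open>auto intro!: Z.contp intro: sigZ XZ\<close>)

  \<comment> \<open>Rise along the line over \<open>expand v s\<close>, and after
    \<open>t = 1 - v / 2\<close> move along the line over the wedge point. At \<open>v = 0\<close>
    this is just \<open>c\<close>; at \<open>v = 1\<close> both ends and the whole line over the
    wedge point go to the base point.\<close>
  define psi where "psi v z = (if snd z - (1 - v / 2) \<le> 0 then c (expand v (fst z), level l v (fst z) (snd z))
      else c (?o, level l v (fst z) (snd z)))" for v z
  have psi_cont: "continuous_on {z. fst z \<in> {0..1} \<and> snd z \<in> ?A \<times> {0..1}} (\<lambda>z. psi (fst z) (snd z))"
    (is "continuous_on ?S _")
    unfolding psi_def
  proof (rule continuous_on_cases_le)
    have coord: "continuous_on S (\<lambda>z. fst (snd z) u)"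
      for S :: "(real \<times> (nat \<times> nat \<Rightarrow> real) \<times> real) set" and u
      by (rule continuous_on_product_then_coordinatewise) (intro continuous_intros)
    have cl: "continuous_on S (\<lambda>z. level l (fst z) (fst (snd z)) (snd (snd z)))" if "S \<subseteq> ?S" for S
      unfolding level_def cap_def by (intro continuous_intros coord) (use that in auto)
    have ce: "continuous_on S (\<lambda>z. expand (fst z) (fst (snd z)))" if "S \<subseteq> ?S" for S
    proof -
      have "continuous_on S (\<lambda>z. expand (snd (fst (snd z), fst z)) (fst (fst (snd z), fst z)))"
        by (rule continuous_on_compose2[OF continuous_on_expand[of l d]])
          (use that in \<open>auto intro!: continuous_intros coord\<close>)
      then show ?thesis by simp
    qed
    let ?S1 = "{z \<in> ?S. snd (snd z) - (1 - fst z / 2) \<le> 0}"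
    show "continuous_on ?S1
      (\<lambda>z. c (expand (fst z) (fst (snd z)), level l (fst z) (fst (snd z)) (snd (snd z))))"
      by (intro continuous_on_compose2[OF C.cc] continuous_intros cl ce)
        (auto intro!: expand_in_wedge level_bounds)
    let ?S2 = "{z \<in> ?S. 0 \<le> snd (snd z) - (1 - fst z / 2)}"
    show "continuous_on ?S2 (\<lambda>z. c (?o, level l (fst z) (fst (snd z)) (snd (snd z))))"
      by (intro continuous_on_compose2[OF C.cc] continuous_intros cl)
        (auto intro!: level_bounds)
    show "continuous_on ?S (\<lambda>z. snd (snd z) - (1 - fst z / 2))" by (intro continuous_intros) auto
    fix z assume z: "z \<in> ?S" "snd (snd z) - (1 - fst z / 2) = 0"
    have A: "expand (fst z) (fst (snd z)) \<in> ?A" using z by (auto intro!: expand_in_wedge)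
    have "level l (fst z) (fst (snd z)) (snd (snd z)) = 1 \<or> expand (fst z) (fst (snd z)) = ?o"
      using z by (intro level_switch) auto
    then show "c (expand (fst z) (fst (snd z)), level l (fst z) (fst (snd z)) (snd (snd z))) =
        c (?o, level l (fst z) (fst (snd z)) (snd (snd z)))"
      using C.apex[OF A zero_in_wedge] by auto
  qed
  have psi_in: "psi v (s,t) \<in> Y" if "s \<in> ?A" "0 \<le> v" "v \<le> 1" "0 \<le> t" "t \<le> 1" for s v t
    using that by (auto simp: psi_def intro!: C.c_in expand_in_wedge level_bounds)
  have psi_base: "psi v (s,0) = i ?o" if "s \<in> ?A" "0 \<le> v" "v \<le> 1" for s v
    using that by (auto simp: psi_def intro!: C.base expand_in_wedge)
  have psi_apex: "psi v (s,1) = c (?o, 1 - v)" if "s \<in> ?A" "0 \<le> v" "v \<le> 1" for s v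
    using that C.apex[OF expand_in_wedge[of s l d 0] zero_in_wedge]
    by (cases "v = 0") (auto simp: psi_def level_end)
  have psi_zero: "psi v (?o,t) = c (?o, level l v ?o t)" if "0 \<le> v" for v t
    using that by (simp add: psi_def expand_zero)
  have psi_0: "psi 0 (s,t) = c (s,t)" if "s \<in> ?A" "0 \<le> t" "t \<le> 1" for s t
    using that by (simp add: psi_def level_time0 expand_0)
  have psi_1: "psi 1 (s,t) = i ?o" if "s \<in> ?A" "0 \<le> t" "t \<le> 1" "s = ?o \<or> t = 0 \<or> t = 1" for s t
    using that level_time1[OF that] by (auto simp: psi_def intro!: C.base expand_in_wedge)

  \<comment> \<open>Distinct points identified by \<open>?sig\<close> all go to the base point under
    \<open>psi 1\<close>, so \<open>psi 1\<close> descends to the wedge.\<close>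
  obtain G where G: "continuous_on ?Z G" "G ` ?Z \<subseteq> Y" and Gi: "\<And>x. x \<in> ?X \<Longrightarrow> G x = i x"
    and Gs: "\<And>b. b \<in> ?A \<times> {0..1} \<Longrightarrow> G (?sig b) = psi 1 b"
  proof (rule Z.extend[where g = i and H = "psi 1" and Z = Y])
    have "continuous_on (?A \<times> {0..1}) (\<lambda>b. psi (fst (1::real, b)) (snd (1::real, b)))"
      by (rule continuous_on_compose2[OF psi_cont]) (auto intro!: continuous_intros)
    then show "continuous_on (?A \<times> {0..1}) (psi 1)" by simp
    show "i x = psi 1 b" if "x \<in> ?X" "b \<in> ?A \<times> {0..1}" "x = ?sig b" for x b
      using X_eq[of x "fst b" "snd b"] psi_1[of "fst b" "snd b"] that by auto
    show "psi 1 b = psi 1 b'" if "b \<in> ?A \<times> {0..1}" "b' \<in> ?A \<times> {0..1}" "?sig b = ?sig b'" for b b'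
      using sig_eq[of "fst b" "fst b'" "snd b" "snd b'"] psi_1[of "fst b" "snd b"]
        psi_1[of "fst b'" "snd b'"] that by (cases b; cases b') auto
  qed (use that in \<open>auto intro!: C.ci C.i_in psi_in\<close>)

  have GF: "homotopic_on Y Y id (G \<circ> F)"
  proof (rule C.homotopy_out[where h = "\<lambda>z. i (snd z)" and K = "\<lambda>z. psi (fst z) (snd z)"])
    show "continuous_on ({0..1} \<times> ?X) (\<lambda>z. i (snd z))"
      by (intro continuous_on_compose2[OF C.ci] continuous_intros) auto
    show "continuous_on ({0..1} \<times> ?A \<times> {0..1}) (\<lambda>z. psi (fst z) (snd z))"
      by (rule continuous_on_subset[OF psi_cont]) auto
    show "(\<lambda>z. psi (fst z) (snd z)) ` ({0..1} \<times> ?A \<times> {0..1}) \<subseteq> Y"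
      by (auto intro!: psi_in)
  qed (auto simp: psi_base psi_apex psi_0 Gi Fi Fc Gs intro!: C.i_in)

  \<comment> \<open>The same deformation followed by \<open>F\<close>. At every time it sends the
    points collapsed by \<open>?sig\<close> to the wedge point, so it descends as well.\<close>
  have FG: "homotopic_on ?Z ?Z id (F \<circ> G)"
  proof (rule Z.homotopy[where h = snd and K = "\<lambda>z. F (psi (fst z) (snd z))"])
    have zero: "F (psi v (s,t)) = ?o"
      if "s \<in> ?A" "t \<in> {0..1}" "v \<in> {0..1}" "s = ?o \<or> t = 0 \<or> t = 1" for v s t
    proof -
      from that(4) consider "s = ?o" | "t = 0" | "t = 1" by auto
      then show ?thesis
      proof cases
        case 1
        have "F (c (?o, level l v ?o t)) = ?sig (?o, level l v ?o t)"
          using that level_bounds[OF zero_in_wedge, of v t l] by (intro Fc) auto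
        with 1 show ?thesis using that by (simp add: psi_zero)
      next
        case 2
        then show ?thesis using that by (simp add: psi_base Fi)
      next
        case 3
        then show ?thesis using that by (simp add: psi_apex Fc)
      qed
    qed
    show "continuous_on ({0..1::real} \<times> ?X) snd" by (intro continuous_intros)
    show "continuous_on ({0..1} \<times> ?A \<times> {0..1}) (\<lambda>z. F (psi (fst z) (snd z)))"
      by (rule continuous_on_compose2[OF F(1) continuous_on_subset[OF psi_cont]]) (auto intro!: psi_in)
    show "(\<lambda>z. F (psi (fst z) (snd z))) ` ({0..1} \<times> ?A \<times> {0..1}) \<subseteq> ?Z"
      using F(2) psi_in by auto
    show "snd (w, x) = F (psi (fst (w, b)) (snd (w, b)))"
      if "w \<in> {0..1}" "x \<in> ?X" "b \<in> ?A \<times> {0..1}" "x = ?sig b" for w x b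
      using X_eq[of x "fst b" "snd b"] zero[of "fst b" "snd b" w] that by auto
    show "F (psi (fst (w, b)) (snd (w, b))) = F (psi (fst (w, b')) (snd (w, b')))"
      if "w \<in> {0..1}" "b \<in> ?A \<times> {0..1}" "b' \<in> ?A \<times> {0..1}" "?sig b = ?sig b'" for w b b'
      using sig_eq[of "fst b" "fst b'" "snd b" "snd b'"] zero[of "fst b" "snd b" w]
        zero[of "fst b'" "snd b'" w] that by (cases b; cases b') auto
  qed (auto simp: psi_0 Gi Fi Fc Gs intro!: XZ)

  show ?thesis
    by (rule homotopy_eqvI[OF F G]) (use GF FG in \<open>auto intro: homotopic_with_symD\<close>)
qed

text \<open>In the product of both ambient spaces with a height line, the point of height
  \<open>t\<close> over \<open>a\<close> is \<open>(x0, t, t * (1 - t) * a)\<close>. The factor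
  vanishes at the apex, and also at the base, where a constant attaching map collapses
  \<open>A\<close> too.\<close>

lemma cone_attachment_model:
  fixes X :: "('x \<Rightarrow> real) set" and A :: "('a \<Rightarrow> real) set"
  assumes "compact X" "compact A" "A \<noteq> {}" "x0 \<in> X"
  obtains V :: "(('x \<Rightarrow> real) \<times> real \<times> ('a \<Rightarrow> real)) set" and i c
  where "cone_attachment X A V (\<lambda>_. x0) i c"
proof
  let ?i = "\<lambda>x :: 'x \<Rightarrow> real. (x, 0 :: real, \<lambda>_ :: 'a. 0 :: real)"
  let ?c = "\<lambda>z :: ('a \<Rightarrow> real) \<times> real. (x0, snd z, \<lambda>v. snd z * (1 - snd z) * fst z v)"
  let ?V = "?i ` X \<union> ?c ` (A \<times> {0..1})"
  show "cone_attachment X A ?V (\<lambda>_. x0) ?i ?c"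
  proof
    have "Hausdorff_space (euclidean :: (('x \<Rightarrow> real) \<times> real \<times> ('a \<Rightarrow> real)) topology)"
    proof -
      have "Hausdorff_space (prod_topology (top_of_set (UNIV :: ('x \<Rightarrow> real) set))
          (prod_topology (top_of_set (UNIV :: real set)) (top_of_set (UNIV :: ('a \<Rightarrow> real) set))))"
        unfolding Hausdorff_space_prod_topology
        by (intro disjI2 conjI Hausdorff_fun) (simp add: Hausdorff_space_subtopology)
      then show ?thesis unfolding prod_topology_subtopology_eu by simp
    qed
    then show "Hausdorff_space (top_of_set ?V)" by (rule Hausdorff_space_subtopology)
    show "continuous_on X ?i" by (intro continuous_intros)
    show "continuous_on (A \<times> {0..1}) ?c"
      by (intro continuous_intros continuous_on_product_then_coordinatewise[where f = fst])
    show "inj_on ?i X" by (auto simp: inj_on_def)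
  qed (use assms in \<open>auto simp: fun_eq_iff\<close>)
qed

text \<open>A cone map \<open>G\<close> becomes a left or right homotopy inverse of another cone map after moving
  base points along a path; so it has one-sided inverses on both sides.\<close>

lemma attach_const_homotopy_eqv:
  fixes X :: "('x \<Rightarrow> real) set" and A :: "('a \<Rightarrow> real) set"
    and X' :: "('y \<Rightarrow> real) set" and A' :: "('b \<Rightarrow> real) set"
  assumes C: "cone_attachment X A Y (\<lambda>_. x0) i c" and D: "cone_attachment X' A' Y' (\<lambda>_. x0') i' c'"
    and X: "X homotopy_eqv X'" and A: "A homotopy_eqv A'" and pc: "path_connected X'"
  shows "Y homotopy_eqv Y'"
proof -
  interpret C: cone_attachment X A Y "\<lambda>_. x0" i c by fact
  interpret D: cone_attachment X' A' Y' "\<lambda>_. x0'" i' c' by fact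
  obtain u u' where u: "continuous_on X u" "u ` X \<subseteq> X'" and u': "continuous_on X' u'" "u' ` X' \<subseteq> X"
    and hu: "homotopic_on X X (u' \<circ> u) id"
      "homotopic_on X' X' (u \<circ> u') id"
    using X unfolding homotopy_equivalent_space_def by (auto simp: id_def)
  obtain l l' where l: "continuous_on A l" "l ` A \<subseteq> A'" and l': "continuous_on A' l'" "l' ` A' \<subseteq> A"
    and hl: "homotopic_on A A (l' \<circ> l) id"
      "homotopic_on A' A' (l \<circ> l') id"
    using A unfolding homotopy_equivalent_space_def by (auto simp: id_def)
  have x0: "x0 \<in> X" "x0' \<in> X'" using C.A_ne D.A_ne C.fA D.fA by auto
  then have ux0: "u x0 \<in> X'" "u' (u x0) \<in> X" "u (u' (u x0)) \<in> X'" using u u' by auto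
  \<comment> \<open>The cones \<open>V1\<close>, \<open>V2\<close>, \<open>V3\<close> are attached
    at \<open>u x0\<close>, \<open>u' (u x0)\<close>, \<open>u (u' (u x0))\<close>, which makes
    \<open>F\<close>, \<open>G\<close>, \<open>H\<close> cone maps. Below, \<open>e\<close> and
    \<open>e'\<close> lead back from \<open>V2\<close> to \<open>Y\<close> along \<open>h\<close>
    and from \<open>V3\<close> to \<open>V1\<close> along \<open>k\<close>.\<close>
  obtain V1 :: "(('y \<Rightarrow> real) \<times> real \<times> ('b \<Rightarrow> real)) set" and i1 c1
    where V1: "cone_attachment X' A' V1 (\<lambda>_. u x0) i1 c1"
    by (rule cone_attachment_model[OF D.cX D.cA D.A_ne ux0(1)])
  obtain V2 :: "(('x \<Rightarrow> real) \<times> real \<times> ('a \<Rightarrow> real)) set" and i2 c2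
    where V2: "cone_attachment X A V2 (\<lambda>_. u' (u x0)) i2 c2"
    by (rule cone_attachment_model[OF C.cX C.cA C.A_ne ux0(2)])
  obtain V3 :: "(('y \<Rightarrow> real) \<times> real \<times> ('b \<Rightarrow> real)) set" and i3 c3
    where V3: "cone_attachment X' A' V3 (\<lambda>_. u (u' (u x0))) i3 c3"
    by (rule cone_attachment_model[OF D.cX D.cA D.A_ne ux0(3)])
  obtain F where F: "continuous_on Y F" "F ` Y \<subseteq> V1" "cone_map X A i c i1 c1 u l F"
    by (rule cone_map_exists[OF C V1 u l])
  obtain G where G: "continuous_on V1 G" "G ` V1 \<subseteq> V2" "cone_map X' A' i1 c1 i2 c2 u' l' G"
    by (rule cone_map_exists[OF V1 V2 u' l'])
  obtain H where H: "continuous_on V2 H" "H ` V2 \<subseteq> V3" "cone_map X A i2 c2 i3 c3 u l H"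
    by (rule cone_map_exists[OF V2 V3 u l])
  obtain h where h: "continuous_on ({0..1::real} \<times> X) h" "h ` ({0..1} \<times> X) \<subseteq> X"
    and h01: "\<And>x. h (0,x) = u' (u x)" "\<And>x. h (1,x) = x"
    by (rule homotopic_canonE[OF hu(1)]) (erule that; simp)
  obtain k where k: "continuous_on ({0..1::real} \<times> X') k" "k ` ({0..1} \<times> X') \<subseteq> X'"
    and k01: "\<And>x. k (0,x) = u (u' x)" "\<And>x. k (1,x) = x"
    by (rule homotopic_canonE[OF hu(2)]) (erule that; simp)
  have "continuous_on ({0..1} \<times> A) (\<lambda>z. h (fst z, x0))"
    by (rule continuous_on_compose2[OF h(1)])
      (use x0 in \<open>auto intro!: continuous_on_Pair continuous_on_fst continuous_on_id\<close>)
  moreover have "(\<lambda>z. h (fst z, x0)) ` ({0..1} \<times> A) \<subseteq> X" using h(2) x0 by auto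
  ultimately obtain e e1 where e: "continuous_on V2 e" "e ` V2 \<subseteq> Y" and e1: "continuous_on Y e1" "e1 ` Y \<subseteq> V2"
    and eN: "attach_map X A i2 c2 i c (\<lambda>z. h (fst z, x0)) e"
    and ee: "homotopic_on V2 V2 (e1 \<circ> e) id"
      "homotopic_on Y Y (e \<circ> e1) id"
    by (rule attach_homotopy_inverses[OF V2 C]) (simp_all add: h01)
  have "continuous_on ({0..1} \<times> A') (\<lambda>z. k (fst z, u x0))"
    by (rule continuous_on_compose2[OF k(1)])
      (use ux0 in \<open>auto intro!: continuous_on_Pair continuous_on_fst continuous_on_id\<close>)
  moreover have "(\<lambda>z. k (fst z, u x0)) ` ({0..1} \<times> A') \<subseteq> X'" using k(2) ux0 by auto
  ultimately obtain e' where e': "continuous_on V3 e'" "e' ` V3 \<subseteq> V1"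
    and eN': "attach_map X' A' i3 c3 i1 c1 (\<lambda>z. k (fst z, u x0)) e'"
    by (rule attach_homotopy_inverses[OF V3 V1]) (simp_all add: k01)
  have "homotopic_on Y Y (e \<circ> (G \<circ> F)) id"
    by (rule cone_map_left_inverse[where h = h and u = u and u' = u', OF C F(3) G(3) u(2) u'(2) l(2) l'(2) h h01 hl(1) eN])
  then have 1: "homotopic_on Y V2 (e1 \<circ> (e \<circ> (G \<circ> F))) (e1 \<circ> id)"
    by (rule homotopic_with_compose_continuous_left) (use e1 in auto)
  have 2: "homotopic_on Y V2 ((e1 \<circ> e) \<circ> (G \<circ> F)) (id \<circ> (G \<circ> F))"
    by (rule homotopic_with_compose_continuous_right[OF ee(1)])
      (use F(2) G(2) continuous_on_compose[OF F(1) continuous_on_subset[OF G(1) F(2)]] in \<open>auto simp: o_def\<close>)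
  \<comment> \<open>\<open>e1\<close> is inverse to \<open>e\<close>, and
    \<open>e \<circ> (G \<circ> F)\<close> is homotopic to the identity, so
    \<open>G \<circ> F\<close> is homotopic to \<open>e1\<close>. Hence \<open>F \<circ> e\<close>
    is a right inverse of \<open>G\<close>.\<close>
  have "homotopic_on Y V2 (G \<circ> F) e1"
    using homotopic_with_trans[OF homotopic_with_symD[OF 2[unfolded comp_assoc]] 1] by simp
  then have "homotopic_on V2 V2 ((G \<circ> F) \<circ> e) (e1 \<circ> e)"
    by (rule homotopic_with_compose_continuous_right) (use e in auto)
  then have right: "homotopic_on V2 V2 (G \<circ> (F \<circ> e)) id"
    using homotopic_with_trans[OF _ ee(1)] unfolding comp_assoc by blast
  have left: "homotopic_on V1 V1 ((e' \<circ> H) \<circ> G) id"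
    using cone_map_left_inverse[where h = k and u = u' and u' = u, OF V1 G(3) H(3) u'(2) u(2) l'(2) l(2) k k01 hl(2) eN']
    by (simp add: comp_assoc)
  have 3: "V1 homotopy_eqv V2"
    by (rule one_sided_inverses_homotopy_eqv[OF G(1,2) _ _ _ _ left right])
      (use e(2) e'(2) F(2) H(2) continuous_on_compose[OF H(1) continuous_on_subset[OF e'(1) H(2)]]
        continuous_on_compose[OF e(1) continuous_on_subset[OF F(1) e(2)]] in \<open>auto simp: image_subset_iff\<close>)
  have 4: "Y homotopy_eqv V2" by (rule homotopy_eqvI[OF e1 e]) (fact ee)+
  \<comment> \<open>Both attaching maps are constant, and their values are joined by a path in
    \<open>X'\<close>.\<close>
  have 5: "V1 homotopy_eqv Y'"
  proof (rule attach_homotopy_eqv[OF V1 D])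
    show "homotopic_on A' X' (\<lambda>_. u x0) (\<lambda>_. x0')"
      using pc ux0(1) x0(2) unfolding homotopic_constant_maps
      by (simp add: path_connected_component)
  qed
  show ?thesis
    by (rule homotopy_eqv_trans[OF 4 homotopy_eqv_trans[OF iffD1[OF homotopy_equivalent_space_sym 3] 5]])
qed

text \<open>First \<open>f\<close> is made constant; then \<open>X\<close> and \<open>A\<close> can
  be exchanged for standard wedges, and there the arc over the wedge point is collapsed.\<close>

lemma attach_null_wedge:
  fixes X :: "('x \<Rightarrow> real) set" and A :: "('a \<Rightarrow> real) set"
  assumes C: "cone_attachment X A Y f i c"
    and null: "homotopic_on A X f (\<lambda>_. x0)"
    and X: "X homotopy_eqv wedge_of_spheres k (Suc d)" and A: "A homotopy_eqv wedge_of_spheres l d"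
  shows "Y homotopy_eqv wedge_of_spheres (k + l) (Suc d)"
proof -
  interpret C: cone_attachment X A Y f i c by fact
  have "x0 \<in> X" using homotopic_with_imp_funspace2[OF null] C.A_ne by auto
  then obtain V :: "(('x \<Rightarrow> real) \<times> real \<times> ('a \<Rightarrow> real)) set" and j e
    where V: "cone_attachment X A V (\<lambda>_. x0) j e"
    by (rule cone_attachment_model[OF C.cX C.cA C.A_ne])
  obtain W :: "((nat \<times> nat \<Rightarrow> real) \<times> real \<times> (nat \<times> nat \<Rightarrow> real)) set" and j' e'
    where W: "cone_attachment (wedge_of_spheres k (Suc d)) (wedge_of_spheres l d) W (\<lambda>_ _. 0) j' e'"
    by (rule cone_attachment_model[OF compact_wedge[of k "Suc d"] compact_wedge[of l d] _ zero_in_wedge])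
      (use zero_in_wedge in blast)
  have "Y homotopy_eqv V" by (rule attach_homotopy_eqv[OF C V null])
  also have "V homotopy_eqv W" by (rule attach_const_homotopy_eqv[OF V W X A path_connected_wedge])
  also have "W homotopy_eqv wedge_of_spheres (k + l) (Suc d)" by (rule attach_wedge_homotopy_eqv[OF W])
  finally show ?thesis .
qed

section \<open>Order complexes\<close>

lemma realization_top: "realization Q le = top_of_set (realization_set Q le)"
  by (simp add: realization_def euclidean_product_topology)

lemma wedge_top_eq: "wedge_top k d = top_of_set (wedge_of_spheres k d)"
  by (simp add: wedge_top_def euclidean_product_topology)

text \<open>Restates the conditions on the support coordinate by coordinate, where each of them is
  visibly closed.\<close>

lemma realization_set_iff:
  assumes "finite Q"
  shows "x \<in> realization_set Q le \<longleftrightarrow> (\<forall>v. 0 \<le> x v) \<and> (\<forall>v. v \<notin> Q \<longrightarrow> x v = 0) \<and>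
    (\<forall>u v. le u v \<or> le v u \<or> x u = 0 \<or> x v = 0) \<and> sum x Q = 1"
proof (cases "\<forall>v. v \<notin> Q \<longrightarrow> x v = 0")
  case True
  then have "sum x {v. x v \<noteq> 0} = sum x Q"
    by (intro sum.mono_neutral_left) (use assms in auto)
  with True show ?thesis unfolding realization_set_def is_chain_def by auto
next
  case False
  then show ?thesis unfolding realization_set_def by auto
qed

lemma realization_set_mono: "Q \<subseteq> Q' \<Longrightarrow> realization_set Q le \<subseteq> realization_set Q' le"
  unfolding realization_set_def by auto

lemma finite_poset_subset: "finite_poset P le \<Longrightarrow> Q \<subseteq> P \<Longrightarrow> finite_poset Q le"
  unfolding finite_poset_def by (meson finite_subset subsetD)

lemma
  assumes "finite_poset P le"
  shows finite_poset_finite: "finite P"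
    and finite_poset_refl: "x \<in> P \<Longrightarrow> le x x"
    and finite_poset_antisym: "le x y \<Longrightarrow> le y x \<Longrightarrow> x \<in> P \<Longrightarrow> y \<in> P \<Longrightarrow> x = y"
    and finite_poset_trans: "le x y \<Longrightarrow> le y z \<Longrightarrow> x \<in> P \<Longrightarrow> y \<in> P \<Longrightarrow> z \<in> P \<Longrightarrow> le x z"
  using assms unfolding finite_poset_def by metis+

lemma finite_poset_maximal:
  assumes "finite_poset P le" "N \<subseteq> P" "N \<noteq> {}"
  obtains y where "y \<in> N" "\<And>z. z \<in> N \<Longrightarrow> le y z \<Longrightarrow> z = y"
proof -
  let ?f = "\<lambda>y. card {w\<in>P. le y w}"
  obtain y where y: "y \<in> N" "\<And>z. z \<in> N \<Longrightarrow> ?f y \<le> ?f z"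
    using assms(3) ex_has_least_nat[of "\<lambda>y. y \<in> N" _ ?f] by blast
  have "z = y" if z: "z \<in> N" "le y z" for z
  proof (rule ccontr)
    assume "z \<noteq> y"
    have zy: "z \<in> P" "y \<in> P" using assms(2) z(1) y(1) by auto
    have "{w\<in>P. le z w} \<subseteq> {w\<in>P. le y w}"
      using finite_poset_trans[OF assms(1) z(2)] zy by auto
    moreover have "y \<in> {w\<in>P. le y w}" "y \<notin> {w\<in>P. le z w}"
      using finite_poset_refl[OF assms(1)] finite_poset_antisym[OF assms(1) z(2)] zy \<open>z \<noteq> y\<close> by auto
    ultimately have "?f z < ?f y"
      using finite_poset_finite[OF assms(1)] by (intro psubset_card_mono) auto
    then show False using y(2)[OF z(1)] by simp
  qed
  with y(1) that show thesis by blast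
qed

lemma finite_poset_dual: "finite_poset P le \<Longrightarrow> finite_poset P (\<lambda>a b. le b a)"
  unfolding finite_poset_def by blast

lemma finite_poset_minimal:
  assumes "finite_poset P le" "N \<subseteq> P" "N \<noteq> {}"
  obtains y where "y \<in> N" "\<And>z. z \<in> N \<Longrightarrow> le z y \<Longrightarrow> z = y"
  by (rule finite_poset_maximal[OF finite_poset_dual[OF assms(1)] assms(2,3)]) (use that in blast)

lemma compact_realization_set:
  assumes "finite Q"
  shows "compact (realization_set Q le)"
proof -
  have "realization_set Q le = {x. \<forall>v. x v \<in> {0..1}} \<inter> {x. (\<forall>v. v \<notin> Q \<longrightarrow> x v = 0) \<and>
    (\<forall>u v. le u v \<or> le v u \<or> x u = 0 \<or> x v = 0) \<and> sum x Q = 1}" (is "_ = _ \<inter> ?C")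
  proof -
    have "x v \<le> 1" if "\<forall>v. 0 \<le> x v" "sum x Q = 1" "\<forall>v. v \<notin> Q \<longrightarrow> x v = 0" for x :: "'a \<Rightarrow> real" and v
      using that member_le_sum[of v Q x] assms by (cases "v \<in> Q") auto
    then show ?thesis using realization_set_iff[OF assms] by fastforce
  qed
  moreover have "closed ?C"
    by (intro closed_Collect_conj closed_Collect_all closed_Collect_imp closed_Collect_disj
        closed_Collect_eq continuous_intros) auto
  moreover have "compact {x :: 'a \<Rightarrow> real. \<forall>v. x v \<in> {0..1}}" by (rule compact_box_fun) simp
  ultimately show ?thesis by (simp only: compact_Int_closed)
qed

section \<open>Straight-line homotopies\<close>

definition vertex :: "'a \<Rightarrow> 'a \<Rightarrow> real" where
  "vertex v = (\<lambda>w. if w = v then 1 else 0)"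

lemma vertex_in:
  assumes "v \<in> Q" "le v v"
  shows "vertex v \<in> realization_set Q le"
proof -
  have "{w. vertex v w \<noteq> 0} = {v}" by (auto simp: vertex_def)
  then show ?thesis using assms by (simp add: realization_set_def is_chain_def vertex_def)
qed

lemma realization_set_empty_iff:
  assumes "\<And>v. v \<in> Q \<Longrightarrow> le v v"
  shows "realization_set Q le = {} \<longleftrightarrow> Q = {}"
proof
  show "Q = {}" if "realization_set Q le = {}" using that vertex_in[of _ Q le] assms by blast
  show "realization_set Q le = {}" if "Q = {}" using that by (auto simp: realization_set_iff)
qed

lemma realization_segment:
  assumes "finite Q" "x \<in> realization_set Q le" "y \<in> realization_set Q le" "0 \<le> w" "w \<le> 1"
    and chain: "\<And>u v. x u \<noteq> 0 \<Longrightarrow> y v \<noteq> 0 \<Longrightarrow> le u v \<or> le v u"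
  shows "(\<lambda>v. (1 - w) * x v + w * y v) \<in> realization_set Q le"
  unfolding realization_set_iff[OF assms(1)]
proof (intro conjI allI impI)
  note x = assms(2)[unfolded realization_set_iff[OF assms(1)]]
  note y = assms(3)[unfolded realization_set_iff[OF assms(1)]]
  show "0 \<le> (1 - w) * x v + w * y v" for v using x y assms(4,5) by simp
  show "(1 - w) * x v + w * y v = 0" if "v \<notin> Q" for v using x y that by simp
  show "(\<Sum>v\<in>Q. (1 - w) * x v + w * y v) = 1"
    using x y by (simp add: sum.distrib flip: sum_distrib_left)
  show "le u v \<or> le v u \<or> (1 - w) * x u + w * y u = 0 \<or> (1 - w) * x v + w * y v = 0" for u v
  proof (rule ccontr)
    assume *: "\<not> ?thesis"
    then have "x u \<noteq> 0 \<or> y u \<noteq> 0" "x v \<noteq> 0 \<or> y v \<noteq> 0" by auto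
    then show False using * x y chain[of u v] chain[of v u] by auto
  qed
qed

text \<open>The segment from \<open>f s\<close> to \<open>g s\<close> stays in the complex because
  the two supports together form a chain.\<close>

lemma realization_homotopic:
  assumes "finite Q" and f: "continuous_on S f" "f ` S \<subseteq> realization_set Q le"
    and g: "continuous_on S g" "g ` S \<subseteq> realization_set Q le"
    and chain: "\<And>s u v. s \<in> S \<Longrightarrow> f s u \<noteq> 0 \<Longrightarrow> g s v \<noteq> 0 \<Longrightarrow> le u v \<or> le v u"
  shows "homotopic_on S (realization_set Q le) f g"
proof (rule homotopic_canonI[where h = "\<lambda>z v. (1 - fst z) * f (snd z) v + fst z * g (snd z) v"])
  have "continuous_on ({0..1::real} \<times> S) (\<lambda>z. f (snd z) v)" "continuous_on ({0..1::real} \<times> S) (\<lambda>z. g (snd z) v)"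
    for v
    by (rule continuous_on_product_then_coordinatewise,
        rule continuous_on_compose2[OF f(1)] continuous_on_compose2[OF g(1)];
        auto intro: continuous_on_snd continuous_on_id)+
  then show "continuous_on ({0..1} \<times> S) (\<lambda>z v. (1 - fst z) * f (snd z) v + fst z * g (snd z) v)"
    by (intro continuous_on_coordinatewise_then_product continuous_intros)
  show "(\<lambda>z v. (1 - fst z) * f (snd z) v + fst z * g (snd z) v) ` ({0..1} \<times> S) \<subseteq> realization_set Q le"
  proof clarify
    fix w :: real and s
    assume ws: "w \<in> {0..1}" "s \<in> S"
    have "(\<lambda>v. (1 - w) * f s v + w * g s v) \<in> realization_set Q le"
      using ws f(2) g(2) chain[OF ws(2)] by (intro realization_segment[OF assms(1)]) auto
    then show "(\<lambda>v. (1 - fst (w, s)) * f (snd (w, s)) v + fst (w, s) * g (snd (w, s)) v)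
      \<in> realization_set Q le" by simp
  qed
qed auto

lemma conical_contractible:
  assumes "finite L" "m \<in> L" "\<And>y. y \<in> L \<Longrightarrow> le m y \<or> le y m"
  shows "contractible (realization_set L le)"
  unfolding contractible_def
proof
  have "homotopic_on (realization_set L le) (realization_set L le) (\<lambda>x. x) (\<lambda>_. vertex m)"
  proof (rule realization_homotopic[OF assms(1)])
    show "(\<lambda>_. vertex m) ` realization_set L le \<subseteq> realization_set L le"
      using vertex_in[of m L le] assms(2) assms(3)[OF assms(2)] by auto
    show "le u v \<or> le v u" if "s \<in> realization_set L le" "s u \<noteq> 0" "vertex m v \<noteq> 0" for s u v
    proof -
      have "u \<in> L" using that realization_set_iff[OF assms(1), of s le] by blast
      moreover have "v = m" using that(3) by (simp add: vertex_def split: if_splits)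
      ultimately show ?thesis using assms(3)[of u] by blast
    qed
  qed auto
  then show "homotopic_on (realization_set L le) (realization_set L le) id (\<lambda>_. vertex m)"
    by (simp add: id_def)
qed

section \<open>Links as bases of attached cones\<close>

definition link_in :: "'a set \<Rightarrow> ('a \<Rightarrow> 'a \<Rightarrow> bool) \<Rightarrow> 'a \<Rightarrow> 'a set" where
  "link_in Q le x = {y\<in>Q. y \<noteq> x \<and> (le x y \<or> le y x)}"

text \<open>The barycentric coordinate at \<open>x\<close> is the cone coordinate. If it is strictly
  between 0 and 1, the other coordinates, rescaled to sum 1, are supported on elements comparable to
  \<open>x\<close>, hence in the link.\<close>

lemma link_cone_attachment:
  assumes fin: "finite Q" and x: "x \<in> Q" "le x x" and ne: "realization_set (link_in Q le x) le \<noteq> {}"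
  shows "cone_attachment (realization_set (Q - {x}) le) (realization_set (link_in Q le x) le)
    (realization_set Q le) (\<lambda>a. a) (\<lambda>a. a) (\<lambda>z v. if v = x then snd z else (1 - snd z) * fst z v)"
    (is "cone_attachment ?X ?A ?Y _ _ ?c")
proof
  let ?L = "link_in Q le x"
  have L: "?L \<subseteq> Q - {x}" "finite ?L" "finite (Q - {x})" using fin by (auto simp: link_in_def)
  note iffL = realization_set_iff[OF L(2)] and iffQ = realization_set_iff[OF fin]
    and iffX = realization_set_iff[OF L(3)]
  have ax: "a x = 0" if "a \<in> ?A" for a using that unfolding iffL by (simp add: link_in_def)
  have qx: "q x = 0" if "q \<in> ?X" for q using that unfolding iffX by simp
  have sumQ: "sum q Q = q x + sum q (Q - {x})" for q :: "'a \<Rightarrow> real"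
    using fin x by (simp add: sum.remove)
  show "compact ?X" "compact ?A" using L by (simp_all add: compact_realization_set)
  show "?A \<noteq> {}" by (rule ne)
  show "Hausdorff_space (top_of_set ?Y)" by (rule Hausdorff_fun)
  show "continuous_on ?X (\<lambda>a. a)" "continuous_on ?A (\<lambda>a. a)" by (rule continuous_on_id)+
  show "inj_on (\<lambda>a. a) ?X" by simp
  show "(\<lambda>a. a) ` ?A \<subseteq> ?X" using realization_set_mono[OF L(1)] by auto
  show "continuous_on (?A \<times> {0..1}) ?c"
  proof (rule continuous_on_coordinatewise_then_product)
    fix v
    have "continuous_on (?A \<times> {0..1::real}) (\<lambda>z. fst z v)"
      by (rule continuous_on_product_then_coordinatewise) (intro continuous_intros)
    then show "continuous_on (?A \<times> {0..1}) (\<lambda>z. ?c z v)"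
      by (cases "v = x") (auto intro!: continuous_intros)
  qed
  show "?Y = (\<lambda>a. a) ` ?X \<union> ?c ` (?A \<times> {0..1})"
  proof
    show "(\<lambda>a. a) ` ?X \<union> ?c ` (?A \<times> {0..1}) \<subseteq> ?Y"
    proof -
      have "?c (a,t) \<in> ?Y" if a: "a \<in> ?A" and t: "0 \<le> t" "t \<le> 1" for a t
      proof -
        have "a \<in> ?Y" "vertex x \<in> ?Y"
          using a realization_set_mono[of ?L Q le] L x by (auto intro: vertex_in)
        then have "(\<lambda>v. (1 - t) * a v + t * vertex x v) \<in> ?Y"
          using a t unfolding iffL
          by (intro realization_segment[OF fin]) (auto simp: vertex_def link_in_def split: if_splits)
        moreover have "(\<lambda>v. (1 - t) * a v + t * vertex x v) = ?c (a,t)"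
          using ax[OF a] by (auto simp: vertex_def fun_eq_iff)
        ultimately show ?thesis by simp
      qed
      then show ?thesis using realization_set_mono[of "Q - {x}" Q le] by auto
    qed
    show "?Y \<subseteq> (\<lambda>a. a) ` ?X \<union> ?c ` (?A \<times> {0..1})"
    proof
      fix y assume y: "y \<in> ?Y"
      note y' = y[unfolded iffQ]
      let ?t = "y x"
      have t: "0 \<le> ?t" "?t \<le> 1"
        using y' member_le_sum[of x Q y] fin x by auto
      have s: "sum y (Q - {x}) = 1 - ?t" using y' sumQ[of y] by simp
      consider "?t = 0" | "?t = 1" | "0 < ?t" "?t < 1" using t by linarith
      then show "y \<in> (\<lambda>a. a) ` ?X \<union> ?c ` (?A \<times> {0..1})"
      proof cases
        case 1
        then have "y \<in> ?X" unfolding iffX using y' s by auto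
        then show ?thesis by simp
      next
        case 2
        then have "sum y (Q - {x}) = 0" using s by simp
        then have "\<forall>v\<in>Q - {x}. y v = 0"
          using y' fin by (subst (asm) sum_nonneg_eq_0_iff) auto
        then have z: "y v = 0" if "v \<noteq> x" for v using y' that by blast
        \<comment> \<open>At the apex any point of the link represents \<open>y\<close>; this is
          where the link must be nonempty.\<close>
        obtain a where "a \<in> ?A" using ne by blast
        moreover have "y = ?c (a,1)" using z 2 by (auto simp: fun_eq_iff)
        ultimately show ?thesis by (intro UnI2 image_eqI[where x = "(a,1)"]) auto
      next
        case 3
        define a where "a v = (if v = x then 0 else y v / (1 - ?t))" for v
        have "sum a Q = sum a (Q - {x})" using sumQ[of a] by (simp add: a_def)
        moreover have "sum a (Q - {x}) = sum y (Q - {x}) / (1 - ?t)"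
          by (simp add: a_def sum_divide_distrib)
        ultimately have "sum a Q = 1" using s 3 by simp
        moreover have aL: "a v = 0" if "v \<notin> ?L" for v
        proof -
          have "v = x \<or> v \<notin> Q \<or> y v = 0" using that y' 3 unfolding link_in_def by fastforce
          then show ?thesis using y' by (auto simp: a_def)
        qed
        moreover have "sum a ?L = sum a Q"
          using L fin aL by (intro sum.mono_neutral_left) auto
        ultimately have "a \<in> ?A" unfolding iffL using y' 3 by (auto simp: a_def)
        moreover have "y = ?c (a, ?t)" using 3 by (auto simp: a_def fun_eq_iff)
        ultimately show ?thesis using t by (intro UnI2 image_eqI[where x = "(a, ?t)"]) auto
      qed
    qed
  qed
  show "?c (a,0) = a" if "a \<in> ?A" for a using ax[OF that] by (auto simp: fun_eq_iff)
  show "?c (a,1) = ?c (a',1)" for a a' by auto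
  show "t = 0" if "q \<in> ?X" "a \<in> ?A" "t \<in> {0..1}" "q = ?c (a,t)" for q a t
    using qx[OF that(1)] that(4) by simp
  show "t = t' \<and> (t = 0 \<or> t = 1 \<or> a = a')"
    if "a \<in> ?A" "t \<in> {0..1}" "a' \<in> ?A" "t' \<in> {0..1}" "?c (a,t) = ?c (a',t')" for a t a' t'
  proof -
    have e: "?c (a,t) v = ?c (a',t') v" for v using fun_cong[OF that(5), of v] .
    have tt: "t = t'" using e[of x] by simp
    have "a v = a' v" if "t \<noteq> 1" for v
      using e[of v] that tt ax[OF \<open>a \<in> ?A\<close>] ax[OF \<open>a' \<in> ?A\<close>] by (cases "v = x") auto
    then show ?thesis using tt by auto
  qed
qed

text \<open>The homotopy may move points of \<open>A\<close>; this weak form is transitive and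
  yields a homotopy equivalence.\<close>

definition def_retract :: "'x::topological_space set \<Rightarrow> 'x set \<Rightarrow> bool" where
  "def_retract A B \<longleftrightarrow> A \<subseteq> B \<and> (\<exists>r. continuous_on B r \<and> r ` B \<subseteq> A \<and> (\<forall>x\<in>A. r x = x) \<and>
     homotopic_on B B r id)"

lemma def_retract_refl: "def_retract A A"
  unfolding def_retract_def by (auto intro!: exI[of _ id])

lemma def_retract_trans:
  assumes AB: "def_retract A B" and BC: "def_retract B C"
  shows "def_retract A C"
proof -
  obtain r where r: "A \<subseteq> B" "continuous_on B r" "r ` B \<subseteq> A" "\<forall>x\<in>A. r x = x"
    "homotopic_on B B r id" using AB unfolding def_retract_def by auto
  obtain s where s: "B \<subseteq> C" "continuous_on C s" "s ` C \<subseteq> B" "\<forall>x\<in>B. s x = x"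
    "homotopic_on C C s id" using BC unfolding def_retract_def by auto
  have "homotopic_on C B (r \<circ> s) (id \<circ> s)"
    by (rule homotopic_with_compose_continuous_right[OF r(5)]) (use s in auto)
  then have "homotopic_on C C (r \<circ> s) s"
    using s(1) homotopic_with_subset_right by fastforce
  then have "homotopic_on C C (r \<circ> s) id"
    using s(5) homotopic_with_trans by blast
  moreover have "continuous_on C (r \<circ> s)"
    by (rule continuous_on_compose[OF s(2) continuous_on_subset[OF r(2) s(3)]])
  ultimately show ?thesis
    unfolding def_retract_def using r s
    by (intro conjI exI[of _ "r \<circ> s"]) (auto simp: image_subset_iff)
qed

lemma def_retract_homotopy_eqv:
  assumes "def_retract A B" shows "A homotopy_eqv B"
proof -
  obtain r where r: "A \<subseteq> B" "continuous_on B r" "r ` B \<subseteq> A" "\<forall>x\<in>A. r x = x"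
    "homotopic_on B B r id" using assms unfolding def_retract_def by auto
  have "homotopic_on A A (r \<circ> id) id"
    by (rule homotopic_with_equal)
      (use r in \<open>auto intro: continuous_on_subset\<close>)
  then show ?thesis
    by (intro homotopy_eqvI[of A id B r]) (use r in auto)
qed

text \<open>With \<open>r\<close> the given retraction, \<open>f\<close> is homotopic to
  \<open>f \<circ> r = r\<close>, hence to the identity. It is applied to the folding retraction,
  which is constructed independently of the deformation.\<close>

lemma def_retract_retraction_homotopic:
  assumes "def_retract A B" "continuous_on B f" "f ` B \<subseteq> A" "\<And>x. x \<in> A \<Longrightarrow> f x = x"
  shows "homotopic_on B B id f"
proof -
  obtain r where r: "A \<subseteq> B" "continuous_on B r" "r ` B \<subseteq> A" "\<forall>x\<in>A. r x = x"
    "homotopic_on B B r id" using assms unfolding def_retract_def by auto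
  have fB: "f ` B \<subseteq> B" using assms r by auto
  have "homotopic_on B B (f \<circ> r) (f \<circ> id)"
    by (rule homotopic_with_compose_continuous_left[OF r(5)]) (use assms fB in auto)
  moreover have "homotopic_on B B (f \<circ> r) r"
    by (rule homotopic_with_equal)
      (use r assms fB in \<open>auto simp: image_subset_iff intro!: continuous_on_compose2[OF assms(2) r(2)]\<close>)
  ultimately show ?thesis
    using r(5) by (metis comp_id homotopic_with_sym homotopic_with_trans)
qed

lemma contractible_link_def_retract:
  assumes "finite Q" "x \<in> Q" "le x x" "contractible (realization_set (link_in Q le x) le)"
    "realization_set (link_in Q le x) le \<noteq> {}"
  shows "def_retract (realization_set (Q - {x}) le) (realization_set Q le)"
proof -
  obtain r where "continuous_on (realization_set Q le) r"
    "r ` realization_set Q le \<subseteq> realization_set (Q - {x}) le"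
    "\<And>y. y \<in> realization_set (Q - {x}) le \<Longrightarrow> r y = y"
    "homotopic_on (realization_set Q le) (realization_set Q le) ((\<lambda>a. a) \<circ> r) id"
    using attach_contractible[OF link_cone_attachment[OF assms(1,2,3,5)] assms(4)] by blast
  moreover have "(\<lambda>a. a) \<circ> r = r" by auto
  ultimately show ?thesis
    unfolding def_retract_def using realization_set_mono[of "Q - {x}" Q le] by auto
qed

text \<open>Elements not above \<open>c\<close> are removed one by one from the top; the link of such an element \<open>y\<close>
  is then a cone with apex \<open>y \<squnion> c\<close>.\<close>

lemma joins_contractible:
  assumes "finite_poset Q le" "c \<in> Q"
    and "\<And>y. y \<in> Q \<Longrightarrow> \<exists>j\<in>Q. le y j \<and> le c j \<and> (\<forall>z\<in>Q. le y z \<and> le c z \<longrightarrow> le j z)"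
  shows "contractible (realization_set Q le) \<and> realization_set Q le \<noteq> {}"
  using assms
proof (induction "card {y\<in>Q. \<not> le c y}" arbitrary: Q rule: less_induct)
  case less
  note refl = finite_poset_refl[OF less.prems(1)] and trans = finite_poset_trans[OF less.prems(1)]
  have fin: "finite Q" by (rule finite_poset_finite[OF less.prems(1)])
  have ne: "realization_set Q le \<noteq> {}"
    using vertex_in[of c Q le] less.prems(2) refl by blast
  show ?case
  proof (cases "{y\<in>Q. \<not> le c y} = {}")
    case True
    then show ?thesis using conical_contractible[OF fin less.prems(2)] ne by blast
  next
    case False
    let ?N = "{y\<in>Q. \<not> le c y}"
    have "finite ?N" using fin by auto
    obtain y where "y \<in> ?N" and "\<And>z. z \<in> ?N \<Longrightarrow> le y z \<Longrightarrow> z = y"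
      by (rule finite_poset_maximal[OF less.prems(1) _ False]) auto
    then have y: "y \<in> Q" "\<not> le c y" and max: "\<And>z. z \<in> Q \<Longrightarrow> \<not> le c z \<Longrightarrow> le y z \<Longrightarrow> z = y"
      by auto
    obtain j where j: "j \<in> Q" "le y j" "le c j" "\<And>z. z \<in> Q \<Longrightarrow> le y z \<Longrightarrow> le c z \<Longrightarrow> le j z"
      using less.prems(3)[OF y(1)] by blast
    have jy: "j \<noteq> y" using j(3) y(2) by auto
    let ?L = "link_in Q le y"
    have jL: "j \<in> ?L" using j jy by (auto simp: link_in_def)
    have "contractible (realization_set ?L le)"
    proof (rule conical_contractible[where m = j])
      show "finite ?L" using fin by (auto simp: link_in_def)
      fix z assume z: "z \<in> ?L"
      show "le j z \<or> le z j"
      proof (cases "le y z")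
        case True
        \<comment> \<open>By maximality of \<open>y\<close>, only elements above \<open>c\<close>
          lie strictly above \<open>y\<close>.\<close>
        then have "le c z" using max[of z] z by (auto simp: link_in_def)
        then show ?thesis using j(4)[of z] True z by (auto simp: link_in_def)
      next
        case False
        then have "le z y" "z \<in> Q" using z by (auto simp: link_in_def)
        then show ?thesis using trans[of z y j] j(1,2) y(1) by blast
      qed
    qed (rule jL)
    moreover have "realization_set ?L le \<noteq> {}"
      using vertex_in[of j ?L le] jL refl[OF j(1)] by blast
    ultimately have D: "def_retract (realization_set (Q - {y}) le) (realization_set Q le)"
      using y(1) refl[OF y(1)] by (intro contractible_link_def_retract[OF fin])
    have "contractible (realization_set (Q - {y}) le) \<and> realization_set (Q - {y}) le \<noteq> {}"
    proof (rule less.hyps)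
      show "card {z \<in> Q - {y}. \<not> le c z} < card ?N"
        using y \<open>finite ?N\<close> by (intro psubset_card_mono) auto
      show "finite_poset (Q - {y}) le" by (rule finite_poset_subset[OF less.prems(1)]) auto
      show "c \<in> Q - {y}" using less.prems(2) y refl by auto
      fix z assume "z \<in> Q - {y}"
      then obtain k where "k \<in> Q" "le z k" "le c k" "\<forall>w\<in>Q. le z w \<and> le c w \<longrightarrow> le k w"
        using less.prems(3)[of z] by blast
      \<comment> \<open>The join \<open>k\<close> lies above \<open>c\<close>, so it is not the
        removed \<open>y\<close>.\<close>
      then show "\<exists>k\<in>Q - {y}. le z k \<and> le c k \<and> (\<forall>w\<in>Q - {y}. le z w \<and> le c w \<longrightarrow> le k w)"
        using y(2) by (intro bexI[of _ k]) auto
    qed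
    moreover have "top_of_set (realization_set (Q - {y}) le) homotopy_equivalent_space
        top_of_set (realization_set Q le)"
      by (rule def_retract_homotopy_eqv[OF D])
    ultimately show ?thesis
      using ne homotopy_equivalent_space_contractibility contractible_space_top_of_set by blast
  qed
qed

section \<open>Order complexes that are wedges of spheres\<close>

text \<open>The simplicial map induced by a map of posets: coefficients of elements with the same
  image are added.\<close>

definition push :: "('a \<Rightarrow> 'c) \<Rightarrow> 'a set \<Rightarrow> ('a \<Rightarrow> real) \<Rightarrow> 'c \<Rightarrow> real" where
  "push g Q p = (\<lambda>w. \<Sum>u\<in>Q. if g u = w then p u else 0)"

lemma push_nonzeroD: "push g Q p w \<noteq> 0 \<Longrightarrow> \<exists>u\<in>Q. g u = w \<and> p u \<noteq> 0"
  unfolding push_def by (erule sum.not_neutral_contains_not_neutral) (auto split: if_splits)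

lemma continuous_on_push: "continuous_on S (push g Q)"
  unfolding push_def
proof (intro continuous_on_coordinatewise_then_product continuous_on_sum)
  fix w u
  have "continuous_on S (\<lambda>p :: 'a \<Rightarrow> real. p u)"
    by (rule continuous_on_product_then_coordinatewise[OF continuous_on_id])
  then show "continuous_on S (\<lambda>p. if g u = w then p u else 0 :: real)" by (cases "g u = w") simp_all
qed

lemma push_in_realization:
  assumes fin: "finite Q" "finite R" and g: "g ` Q \<subseteq> R"
    and mono: "\<And>u v. u \<in> Q \<Longrightarrow> v \<in> Q \<Longrightarrow> le u v \<Longrightarrow> le' (g u) (g v)"
    and p: "p \<in> realization_set Q le"
  shows "push g Q p \<in> realization_set R le'"
  unfolding realization_set_iff[OF fin(2)]
proof (intro conjI allI impI)
  note p' = p[unfolded realization_set_iff[OF fin(1)]]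
  show "0 \<le> push g Q p v" for v using p' by (auto simp: push_def intro!: sum_nonneg)
  show "push g Q p v = 0" if "v \<notin> R" for v using push_nonzeroD[of g Q p v] g that by blast
  have "sum (push g Q p) R = (\<Sum>u\<in>Q. \<Sum>w\<in>R. if g u = w then p u else 0)"
    unfolding push_def by (rule sum.swap)
  also have "\<dots> = sum p Q" using g fin(2) by (intro sum.cong) (auto simp: sum.delta')
  finally show "sum (push g Q p) R = 1" using p' by simp
  show "le' u v \<or> le' v u \<or> push g Q p u = 0 \<or> push g Q p v = 0" for u v
    using push_nonzeroD[of g Q p u] push_nonzeroD[of g Q p v] p' mono by blast
qed

lemma push_id:
  assumes "finite Q" "\<And>u. u \<notin> Q \<Longrightarrow> p u = 0" "\<And>u. p u \<noteq> 0 \<Longrightarrow> g u = u"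
  shows "push g Q p = p"
proof
  fix w
  have "push g Q p w = (\<Sum>u\<in>Q. if u = w then p u else 0)"
    unfolding push_def
  proof (rule sum.cong)
    show "(if g u = w then p u else 0) = (if u = w then p u else 0)" for u
      using assms(3)[of u] by (cases "p u = 0") auto
  qed simp
  then show "push g Q p w = p w" using assms(1,2) by (simp add: sum.delta)
qed

lemma realization_iso_homotopy_eqv:
  assumes f: "bij_betw f Q R" and le: "\<And>u v. u \<in> Q \<Longrightarrow> v \<in> Q \<Longrightarrow> le u v \<longleftrightarrow> le' (f u) (f v)"
    and fin: "finite Q"
  shows "realization_set Q le homotopy_eqv realization_set R le'"
proof -
  have finR: "finite R" using bij_betw_finite[OF f] fin by simp
  define g where "g = inv_into Q f"
  have gf: "g (f u) = u" if "u \<in> Q" for u using f that by (simp add: g_def bij_betw_inv_into_left)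
  have fg: "f (g r) = r" and gQ: "g r \<in> Q" if "r \<in> R" for r
    using f that by (simp_all add: g_def bij_betw_inv_into_right bij_betw_def inv_into_into)
  have fR: "f u \<in> R" if "u \<in> Q" for u using f that by (auto simp: bij_betw_def)
  have F: "push f Q p \<in> realization_set R le'" if "p \<in> realization_set Q le" for p
    by (rule push_in_realization[OF fin finR _ _ that]) (use le fR in auto)
  have G: "push g R p \<in> realization_set Q le" if "p \<in> realization_set R le'" for p
    by (rule push_in_realization[OF finR fin _ _ that]) (use le[of "g _" "g _"] gQ fg in auto)
  have pf: "push f Q p r = p (g r)" if "r \<in> R" for p r
  proof -
    have "push f Q p r = (\<Sum>u\<in>Q. if u = g r then p u else 0)"
      unfolding push_def using gf fg that by (intro sum.cong) auto
    then show ?thesis using fin gQ[OF that] by simp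
  qed
  have pg: "push g R p u = p (f u)" if "u \<in> Q" for p u
  proof -
    have "push g R p u = (\<Sum>r\<in>R. if r = f u then p r else 0)"
      unfolding push_def using gf fg that by (intro sum.cong) auto
    then show ?thesis using finR fR[OF that] by simp
  qed
  have GF: "push g R (push f Q p) = p" if "p \<in> realization_set Q le" for p
  proof
    fix u show "push g R (push f Q p) u = p u"
    proof (cases "u \<in> Q")
      case True then show ?thesis by (simp add: pf pg fR gf)
    next
      case False then show ?thesis
        using G[OF F[OF that]] that unfolding realization_set_iff[OF fin] by simp
    qed
  qed
  have FG: "push f Q (push g R p) = p" if "p \<in> realization_set R le'" for p
  proof
    fix u show "push f Q (push g R p) u = p u"
    proof (cases "u \<in> R")
      case True then show ?thesis by (simp add: pf pg gQ fg)
    next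
      case False then show ?thesis
        using F[OF G[OF that]] that unfolding realization_set_iff[OF finR] by simp
    qed
  qed
  show ?thesis
  proof (rule homotopy_eqvI[where F = "push f Q" and G = "push g R"])
    show "homotopic_on (realization_set Q le) (realization_set Q le) (push g R \<circ> push f Q) id"
      by (rule homotopic_with_equal) (use F G GF in \<open>auto intro!: continuous_on_compose continuous_on_push\<close>)
    show "homotopic_on (realization_set R le') (realization_set R le') (push f Q \<circ> push g R) id"
      by (rule homotopic_with_equal) (use F G FG in \<open>auto intro!: continuous_on_compose continuous_on_push\<close>)
  qed (use F G in \<open>auto intro: continuous_on_push\<close>)
qed

section \<open>Finite realizations and wedges of 0-spheres\<close>

lemma continuous_on_finite_fun:
  fixes f :: "('a \<Rightarrow> real) \<Rightarrow> 'y::topological_space"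
  assumes "finite S" shows "continuous_on S f"
  unfolding continuous_on_closed_invariant
proof (intro allI impI)
  fix C :: "'y set"
  have "compactin (top_of_set UNIV) (S \<inter> f -` C)"
    using assms by (simp add: finite_imp_compact)
  then have "closedin (top_of_set UNIV) (S \<inter> f -` C)"
    using compactin_imp_closedin[OF Hausdorff_fun[of UNIV]] by blast
  then show "\<exists>A. closed A \<and> A \<inter> S = f -` C \<inter> S" by (intro exI[of _ "S \<inter> f -` C"]) auto
qed

lemma finite_homotopy_eqv:
  fixes S :: "('a \<Rightarrow> real) set" and T :: "('b \<Rightarrow> real) set"
  assumes "finite S" "finite T" "card S = card T"
  shows "S homotopy_eqv T"
proof -
  obtain f where f: "bij_betw f S T" using finite_same_card_bij[OF assms] by blast
  let ?g = "inv_into S f"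
  have "homeomorphism S T f ?g"
    unfolding homeomorphism_def using f assms
    by (auto simp: bij_betw_def continuous_on_finite_fun)
  then show ?thesis using homeomorphic_imp_homotopy_eqv homeomorphic_def by blast
qed

text \<open>A 0-sphere is given by \<open>t\<^sup>2 = 2 * t\<close>, so it consists of the origin
  and one point at height 2.\<close>

lemma wedge_dim_0: "finite (wedge_of_spheres k 0)" "card (wedge_of_spheres k 0) = Suc k"
proof -
  define e :: "nat \<Rightarrow> nat \<times> nat \<Rightarrow> real" where "e i = (\<lambda>v. if v = (i,0) then 2 else 0)" for i
  have 0: "x (i,0) = 0 \<or> x (i,0) = 2" if "on_sphere 0 i x" for x i
    using that by (auto simp: on_sphere_def power2_eq_square)
  have 1: "x = (\<lambda>_. 0) \<or> x = e i" if on: "on_sphere 0 i x" for x i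
  proof (cases "x (i,0) = 0")
    case True
    then show ?thesis using on_sphere_zero[OF on] by simp
  next
    case False
    have "x (a,b) = e i (a,b)" for a b
      using on 0[OF on] False
      by (cases "a = i"; cases "b = 0") (simp_all add: on_sphere_def e_def)
    then show ?thesis by auto
  qed
  have 2: "on_sphere 0 i (e i)" for i by (simp add: on_sphere_def e_def)
  have eq: "wedge_of_spheres k 0 = insert (\<lambda>_. 0) (e ` {..<k})"
  proof
    show "wedge_of_spheres k 0 \<subseteq> insert (\<lambda>_. 0) (e ` {..<k})"
    proof
      fix x assume "x \<in> wedge_of_spheres k 0"
      then consider "x = (\<lambda>_. 0)" | i where "i < k" "on_sphere 0 i x" unfolding wedge_iff by blast
      then show "x \<in> insert (\<lambda>_. 0) (e ` {..<k})"
        by cases (use 1 in blast)+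
    qed
    show "insert (\<lambda>_. 0) (e ` {..<k}) \<subseteq> wedge_of_spheres k 0"
    proof
      fix x assume "x \<in> insert (\<lambda>_. 0) (e ` {..<k})"
      then consider "x = (\<lambda>_. 0)" | i where "i < k" "x = e i" by blast
      then show "x \<in> wedge_of_spheres k 0"
        by cases (use 2 wedge_iff in blast)+
    qed
  qed
  show "finite (wedge_of_spheres k 0)" by (simp add: eq)
  have "inj_on e {..<k}" by (rule inj_onI) (metis e_def prod.inject zero_neq_numeral)
  moreover have "(\<lambda>_. 0) \<notin> e ` {..<k}" 
  proof
    assume "(\<lambda>_. 0) \<in> e ` {..<k}"
    then obtain i where "e i = (\<lambda>_. 0)" by auto
    then have "e i (i,0) = 0" by simp
    then show False by (simp add: e_def)
  qed
  ultimately show "card (wedge_of_spheres k 0) = Suc k" by (simp add: eq card_image)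
qed

lemma htpy_wedge_nonneg:
  "htpy_wedge_of_spheres (realization Q le) (int d) \<longleftrightarrow>
     (\<exists>k. realization_set Q le homotopy_eqv wedge_of_spheres k d)"
  by (simp add: htpy_wedge_of_spheres_def realization_top wedge_top_eq)

lemma htpy_wedge_neg:
  assumes "e < 0" "\<And>v. v \<in> Q \<Longrightarrow> le v v"
  shows "htpy_wedge_of_spheres (realization Q le) e \<longleftrightarrow> Q = {}"
  using assms realization_set_empty_iff[of Q le] by (simp add: htpy_wedge_of_spheres_def realization_top)

lemma homotopy_eqv_nonempty:
  assumes "S homotopy_eqv T" "T \<noteq> {}" shows "S \<noteq> {}"
proof -
  obtain g where "continuous_map (top_of_set T) (top_of_set S) g"
    using assms(1) unfolding homotopy_equivalent_space_def by blast
  then show ?thesis using assms(2) by (auto simp: continuous_map_def)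
qed

lemma htpy_wedge_nonempty:
  assumes "htpy_wedge_of_spheres (realization Q le) e" "0 \<le> e"
  shows "realization_set Q le \<noteq> {}" "Q \<noteq> {}"
proof -
  obtain k where "realization_set Q le homotopy_eqv wedge_of_spheres k (nat e)"
    using assms htpy_wedge_nonneg[of Q le "nat e"] by auto
  then show *: "realization_set Q le \<noteq> {}"
    using homotopy_eqv_nonempty zero_in_wedge by blast
  show "Q \<noteq> {}" using * realization_set_iff[of Q] by auto
qed

text \<open>Nonempty chains are single elements, so the realization is a finite set, and q points
  form a wedge of q - 1 spheres of dimension 0.\<close>

lemma antichain_htpy_wedge:
  assumes "finite Q" "Q \<noteq> {}" "\<And>u. u \<in> Q \<Longrightarrow> le u u"
    and anti: "\<And>u v. u \<in> Q \<Longrightarrow> v \<in> Q \<Longrightarrow> le u v \<Longrightarrow> u = v"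
  shows "htpy_wedge_of_spheres (realization Q le) 0"
proof -
  have "realization_set Q le = vertex ` Q"
  proof
    show "vertex ` Q \<subseteq> realization_set Q le" using vertex_in[of _ Q le] assms(3) by blast
    show "realization_set Q le \<subseteq> vertex ` Q"
    proof
      fix p assume "p \<in> realization_set Q le"
      note p = this[unfolded realization_set_iff[OF assms(1)]]
      then have "sum p Q \<noteq> 0" by simp
      then obtain u where u: "u \<in> Q" "p u \<noteq> 0" by (rule sum.not_neutral_contains_not_neutral)
      have z: "p v = 0" if "v \<noteq> u" for v using p u anti[of u v] anti[of v u] that by blast
      have "sum p Q = sum p {u}" using u assms(1) z by (intro sum.mono_neutral_right) auto
      then have "p u = 1" using p by simp
      then have "p = vertex u" using z by (auto simp: vertex_def)
      then show "p \<in> vertex ` Q" using u by simp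
    qed
  qed
  moreover have "inj_on vertex Q" by (rule inj_onI) (metis vertex_def zero_neq_one)
  ultimately have "finite (realization_set Q le)" "card (realization_set Q le) = card Q"
    using assms(1) by (auto simp: card_image)
  moreover have "card Q = Suc (card Q - 1)" using assms(1,2) by (simp add: card_gt_0_iff)
  ultimately have "realization_set Q le homotopy_eqv wedge_of_spheres (card Q - 1) 0"
    by (intro finite_homotopy_eqv) (simp_all add: wedge_dim_0)
  then show ?thesis using htpy_wedge_nonneg[of Q le 0] by auto
qed

text \<open>The realization of \<open>Q\<close> is a cone attached along the link of
  \<open>x\<close>, so the spheres of the link are added, suspended once.\<close>

lemma attach_vertex:
  assumes "finite Q" "x \<in> Q" "le x x"
    and Q: "htpy_wedge_of_spheres (realization (Q - {x}) le) (int (Suc d))"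
    and L: "htpy_wedge_of_spheres (realization (link_in Q le x) le) (int d)"
    and null: "homotopic_on (realization_set (link_in Q le x) le)
        (realization_set (Q - {x}) le) (\<lambda>a. a) (\<lambda>_. p)"
  shows "htpy_wedge_of_spheres (realization Q le) (int (Suc d))"
proof -
  obtain k l where "realization_set (Q - {x}) le homotopy_eqv wedge_of_spheres k (Suc d)"
    "realization_set (link_in Q le x) le homotopy_eqv wedge_of_spheres l d"
    using Q L htpy_wedge_nonneg by blast
  then have "realization_set Q le homotopy_eqv wedge_of_spheres (k + l) (Suc d)"
    using htpy_wedge_nonempty[OF L]
    by (intro attach_null_wedge[OF link_cone_attachment[where Q = Q and x = x and le = le, OF assms(1-3)] null]) auto
  then show ?thesis using htpy_wedge_nonneg by blast
qed

text \<open>In every dimension a point is the wedge of zero spheres.\<close>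

lemma contractible_htpy_wedge:
  assumes "contractible (realization_set Q le)" "realization_set Q le \<noteq> {}"
  shows "htpy_wedge_of_spheres (realization Q le) (int d)"
proof -
  let ?S = "realization_set Q le" and ?W = "wedge_of_spheres 0 d"
  have W: "?W = {\<lambda>_. 0}" by (auto simp: wedge_iff)
  obtain a where a: "homotopic_on ?S ?S id (\<lambda>_. a)"
    using assms(1) unfolding contractible_def by blast
  then have aS: "a \<in> ?S" using homotopic_with_imp_funspace2[OF a] assms(2) by auto
  have "?S homotopy_eqv ?W"
  proof (rule homotopy_eqvI[where F = "\<lambda>_ _. 0" and G = "\<lambda>_. a"])
    show "homotopic_on ?S ?S ((\<lambda>_. a) \<circ> (\<lambda>_ _. 0)) id"
      using homotopic_with_symD[OF a] by (simp add: o_def)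
    show "homotopic_on ?W ?W ((\<lambda>_ _. 0) \<circ> (\<lambda>_. a)) id"
      by (rule homotopic_with_equal) (auto simp: W)
  qed (auto simp: W aS)
  then show ?thesis using htpy_wedge_nonneg by blast
qed

text \<open>\<open>Q\<close> is the join of \<open>U\<close> with the face poset \<open>B\<close> of the boundary of a simplex. The induction adds
  a facet of the simplex to the (contractible) rest.\<close>

lemma join_boundary:
  assumes "finite T" "T \<noteq> {}" "finite_poset Q le" "Q = B \<union> U" "B \<inter> U = {}"
    and "\<And>b u. b \<in> B \<Longrightarrow> u \<in> U \<Longrightarrow> le b u"
    and "bij_betw f B {S. S \<noteq> {} \<and> S \<subset> T}"
    and "\<And>a b. a \<in> B \<Longrightarrow> b \<in> B \<Longrightarrow> le a b \<longleftrightarrow> f a \<subseteq> f b"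
    and "htpy_wedge_of_spheres (realization U le) e" "-1 \<le> e"
  shows "htpy_wedge_of_spheres (realization Q le) (e + int (card T) - 1)"
  using assms
proof (induction "card T" arbitrary: T Q B rule: less_induct)
  case less
  note T = less.prems(1,2) and P = less.prems(3) and Q = less.prems(4) and dis = less.prems(5)
    and BU = less.prems(6) and f = less.prems(7) and fle = less.prems(8) and U = less.prems(9)
  note refl = finite_poset_refl[OF P] and trans = finite_poset_trans[OF P]
    and antisym = finite_poset_antisym[OF P] and fin = finite_poset_finite[OF P]
  have fB: "f b \<noteq> {}" "f b \<subset> T" if "b \<in> B" for b using f that by (auto simp: bij_betw_def)
  have f_ex: "\<exists>b\<in>B. f b = S" if "S \<noteq> {}" "S \<subset> T" for S
    using f that unfolding bij_betw_def by (metis (mono_tags, lifting) imageE mem_Collect_eq)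
  have f_inj: "a = b" if "a \<in> B" "b \<in> B" "f a = f b" for a b
    using f that by (auto simp: bij_betw_def inj_on_def)
  have notUB: "\<not> le u b" if "b \<in> B" "u \<in> U" for b u
    using antisym[of u b] BU[of b u] that dis Q by blast
  show ?case
  proof (cases "card T = 1")
    case True
    \<comment> \<open>The boundary of a point is empty, so \<open>Q = U\<close> and the dimension is
      \<open>e\<close>.\<close>
    then obtain t where "T = {t}" using card_1_singletonE by blast
    then have "B = {}" using fB by blast
    then show ?thesis using U Q True by simp
  next
    case False
    obtain t where t: "t \<in> T" using T by blast
    define F where "F = T - {t}"
    have cardF: "card T = Suc (card F)" unfolding F_def by (rule card.remove[OF T(1) t])
    then have F0: "F \<noteq> {}" using False by auto
    have FT: "F \<subset> T" using t by (auto simp: F_def)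
    \<comment> \<open>\<open>x\<close> is the facet opposite to \<open>t\<close>, and
      \<open>c\<close> below is the vertex \<open>t\<close>. The link of \<open>x\<close> is the
      join of the boundary of the facet with \<open>U\<close>; in the absence of \<open>x\<close>
      every element has a join with \<open>c\<close>.\<close>
    obtain x where x: "x \<in> B" "f x = F" using f_ex[OF F0 FT] by blast
    have tT: "{t} \<subset> T" using F0 t by (auto simp: F_def)
    obtain c where c: "c \<in> B" "f c = {t}" using f_ex[OF _ tT] by blast
    have cx: "c \<noteq> x" using c x by (auto simp: F_def)
    let ?B = "{b\<in>B. f b \<subset> F}"
    have link: "link_in Q le x = ?B \<union> U"
    proof
      show "link_in Q le x \<subseteq> ?B \<union> U"
      proof
        fix y assume "y \<in> link_in Q le x"
        then have y: "y \<in> Q" "y \<noteq> x" "le x y \<or> le y x" by (auto simp: link_in_def)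
        show "y \<in> ?B \<union> U"
        proof (cases "y \<in> U")
          case False
          then have yB: "y \<in> B" using y Q by blast
          then have ne: "f y \<noteq> F" using f_inj[OF yB x(1)] y(2) x(2) by auto
          have "f y \<subseteq> F \<or> F \<subseteq> f y" using y(3) fle x yB by auto
          moreover have "\<not> F \<subset> f y" using fB(2)[OF yB] unfolding F_def by blast
          ultimately show ?thesis using ne yB by blast
        qed simp
      qed
      show "?B \<union> U \<subseteq> link_in Q le x"
        using x fle[of _ x] BU[of x] dis Q by (auto simp: link_in_def)
    qed
    have IH: "htpy_wedge_of_spheres (realization (link_in Q le x) le) (e + int (card F) - 1)"
      unfolding link
    proof (rule less.hyps[of F "?B \<union> U" ?B])
      show "card F < card T" by (simp add: cardF)
      show "finite F" "F \<noteq> {}" using T F0 by (auto simp: F_def)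
      show "finite_poset (?B \<union> U) le" using Q by (intro finite_poset_subset[OF P]) auto
      show "bij_betw f ?B {S. S \<noteq> {} \<and> S \<subset> F}"
        unfolding bij_betw_def
      proof
        show "inj_on f ?B" using f by (auto simp: bij_betw_def inj_on_def)
        show "f ` ?B = {S. S \<noteq> {} \<and> S \<subset> F}"
        proof
          show "f ` ?B \<subseteq> {S. S \<noteq> {} \<and> S \<subset> F}" using fB by auto
          show "{S. S \<noteq> {} \<and> S \<subset> F} \<subseteq> f ` ?B"
          proof
            fix S assume S: "S \<in> {S. S \<noteq> {} \<and> S \<subset> F}"
            then have "S \<noteq> {}" "S \<subset> T" using FT by auto
            then obtain b where "b \<in> B" "f b = S" using f_ex by blast
            then show "S \<in> f ` ?B" using S by blast
          qed
        qed
      qed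
    qed (use dis BU fle U less.prems(10) in auto)
    show ?thesis
    proof (cases "e + int (card F) - 1 < 0")
      case True
      \<comment> \<open>Dimension 0: \<open>-1 \<le> e\<close> forces \<open>e = -1\<close>, so that
        \<open>U\<close> is empty, and \<open>T\<close> has two elements. Then \<open>Q\<close> is a
        pair of incomparable points.\<close>
      have "0 < card F" using F0 T by (simp add: card_gt_0_iff F_def)
      with True less.prems(10) have e: "e = -1" "card F = 1" by auto
      have "U = {}" using U htpy_wedge_neg[of e U le] e refl Q by auto
      then have QB: "Q = B" using Q by simp
      obtain s where s: "F = {s}" using e(2) card_1_singletonE by blast
      then have Ts: "T = {s,t}" "s \<noteq> t" using t by (auto simp: F_def)
      have "htpy_wedge_of_spheres (realization Q le) 0"
      proof (rule antichain_htpy_wedge[OF fin])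
        show "Q \<noteq> {}" using x QB by auto
        fix u v assume uv: "u \<in> Q" "v \<in> Q" "le u v"
        then have "f u \<subseteq> f v" "f u \<noteq> {}" "f v \<subset> T" using fle fB QB by auto
        then have "f u = f v" unfolding Ts by blast
        then show "u = v" using f_inj uv QB by blast
      qed (rule refl)
      then show ?thesis using e cardF by simp
    next
      case False
      define d where "d = nat (e + int (card F) - 1)"
      have d: "e + int (card F) - 1 = int d" "e + int (card T) - 1 = int (Suc d)"
        using False cardF by (auto simp: d_def)
      have con: "contractible (realization_set (Q - {x}) le) \<and> realization_set (Q - {x}) le \<noteq> {}"
      proof (rule joins_contractible[where c = c])
        show "finite_poset (Q - {x}) le" by (rule finite_poset_subset[OF P]) auto
        show "c \<in> Q - {x}" using c cx Q by auto
        fix y assume y: "y \<in> Q - {x}"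
        show "\<exists>j\<in>Q - {x}. le y j \<and> le c j \<and> (\<forall>z\<in>Q - {x}. le y z \<and> le c z \<longrightarrow> le j z)"
        proof (cases "y \<in> U")
          case True
          then show ?thesis using y refl[of y] BU[OF c(1) True] by (intro bexI[of _ y]) auto
        next
          case False
          then have yB: "y \<in> B" using y Q by blast
          have "f y \<noteq> F" using f_inj[OF yB x(1)] y x(2) by auto
          \<comment> \<open>For a proper subset, adding \<open>t\<close> gives all of
            \<open>T\<close> only in the case of \<open>F\<close>, which belongs to the excluded
            \<open>x\<close>.\<close>
          then have "insert t (f y) \<subset> T" using fB(2)[OF yB] t unfolding F_def by blast
          then obtain j where j: "j \<in> B" "f j = insert t (f y)" using f_ex[of "insert t (f y)"] by blast
          have "j \<noteq> x" using j x by (auto simp: F_def)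
          moreover have "le y j" "le c j" using fle j yB c by auto
          moreover have "le j z" if "z \<in> Q - {x}" "le y z" "le c z" for z
          proof (cases "z \<in> U")
            case True
            then show ?thesis using BU j by blast
          next
            case False
            then have "z \<in> B" using that Q by blast
            then show ?thesis using that fle j yB c by auto
          qed
          ultimately show ?thesis using j Q by (intro bexI[of _ j]) auto
        qed
      qed
      obtain p where "homotopic_on (realization_set (Q - {x}) le)
          (realization_set (Q - {x}) le) id (\<lambda>_. p)"
        using con unfolding contractible_def by blast
      then have "homotopic_on (realization_set (link_in Q le x) le)
          (realization_set (Q - {x}) le) id (\<lambda>_. p)"
        by (rule homotopic_with_subset_left)
          (rule realization_set_mono, auto simp: link_in_def)
      then have null: "homotopic_on (realization_set (link_in Q le x) le)
          (realization_set (Q - {x}) le) (\<lambda>a. a) (\<lambda>_. p)" by (simp add: id_def)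
      have xQ: "x \<in> Q" using x Q by blast
      have "htpy_wedge_of_spheres (realization (Q - {x}) le) (int (Suc d))"
        using con contractible_htpy_wedge[of "Q - {x}" le "Suc d"] by blast
      moreover have "htpy_wedge_of_spheres (realization (link_in Q le x) le) (int d)"
        using IH unfolding d(1) .
      ultimately show ?thesis
        unfolding d(2) using attach_vertex[of Q x le d p] fin xQ refl[OF xQ] null by blast
    qed
  qed
qed

section \<open>Simplicial posets and flabby diagrams\<close>

text \<open>\<open>rk\<close> is the dimension plus one. It is a parameter, and \<open>T\<close> is
  an arbitrary finite set, because both change in the link of \<open>I\<close>: ranks drop by
  \<open>rk I\<close>, and \<open>T\<close> loses the set belonging to \<open>I\<close>.\<close>

definition bool_cones :: "'a set \<Rightarrow> ('a \<Rightarrow> 'a \<Rightarrow> bool) \<Rightarrow> ('a \<Rightarrow> nat) \<Rightarrow> bool" where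
  "bool_cones P le rk \<longleftrightarrow> finite_poset P le \<and>
     (\<forall>J\<in>P. \<exists>f (T :: nat set). finite T \<and> T \<noteq> {} \<and> card T = rk J \<and>
        bij_betw f (lower_cone P le J) {S. S \<noteq> {} \<and> S \<subseteq> T} \<and>
        (\<forall>x\<in>lower_cone P le J. \<forall>y\<in>lower_cone P le J. le x y \<longleftrightarrow> f x \<subseteq> f y))"

lemma bool_conesE:
  assumes "bool_cones P le rk" "J \<in> P"
  obtains f :: "'a \<Rightarrow> nat set" and T where "finite T" "T \<noteq> {}" "card T = rk J"
    "\<And>x. x \<in> P \<Longrightarrow> le x J \<Longrightarrow> f x \<noteq> {} \<and> f x \<subseteq> T"
    "\<And>S. S \<noteq> {} \<Longrightarrow> S \<subseteq> T \<Longrightarrow> \<exists>x\<in>P. le x J \<and> f x = S"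
    "\<And>x y. x \<in> P \<Longrightarrow> le x J \<Longrightarrow> y \<in> P \<Longrightarrow> le y J \<Longrightarrow> le x y \<longleftrightarrow> f x \<subseteq> f y"
    "\<And>x y. x \<in> P \<Longrightarrow> le x J \<Longrightarrow> y \<in> P \<Longrightarrow> le y J \<Longrightarrow> f x = f y \<Longrightarrow> x = y" "f J = T"
proof -
  obtain f and T :: "nat set" where T: "finite T" "T \<noteq> {}" "card T = rk J"
    and f: "bij_betw f (lower_cone P le J) {S. S \<noteq> {} \<and> S \<subseteq> T}"
    and fle: "\<forall>x\<in>lower_cone P le J. \<forall>y\<in>lower_cone P le J. le x y \<longleftrightarrow> f x \<subseteq> f y"
    using assms unfolding bool_cones_def by blast
  have P: "finite_poset P le" using assms(1) by (simp add: bool_cones_def)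
  have 1: "f x \<noteq> {} \<and> f x \<subseteq> T" if "x \<in> P" "le x J" for x
    using f that by (auto simp: bij_betw_def lower_cone_def)
  have 2: "\<exists>x\<in>P. le x J \<and> f x = S" if "S \<noteq> {}" "S \<subseteq> T" for S
  proof -
    have "S \<in> f ` lower_cone P le J" using f that by (simp add: bij_betw_def)
    then show ?thesis by (auto simp: lower_cone_def)
  qed
  have 3: "le x y \<longleftrightarrow> f x \<subseteq> f y" if "x \<in> P" "le x J" "y \<in> P" "le y J" for x y
    using fle that by (simp add: lower_cone_def)
  have 4: "x = y" if "x \<in> P" "le x J" "y \<in> P" "le y J" "f x = f y" for x y
    using f that by (auto simp: bij_betw_def inj_on_def lower_cone_def)
  have JJ: "le J J" by (rule finite_poset_refl[OF P assms(2)])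
  obtain t where t: "t \<in> P" "le t J" "f t = T" using 2[OF T(2)] by blast
  have "f J = T" using 3[OF t(1,2) assms(2) JJ] 1[OF assms(2) JJ] t by auto
  with T 1 2 3 4 show thesis by (intro that[of T f])
qed

lemma bool_cones_finite_poset: "bool_cones P le rk \<Longrightarrow> finite_poset P le"
  by (simp add: bool_cones_def)

lemma bool_cones_rank_pos: "bool_cones P le rk \<Longrightarrow> J \<in> P \<Longrightarrow> 0 < rk J"
  unfolding bool_cones_def by (metis card_gt_0_iff)

lemma card_lower_cone:
  assumes "bool_cones P le rk" "J \<in> P"
  shows "card (lower_cone P le J) = 2 ^ rk J - 1"
proof -
  obtain f and T :: "nat set" where T: "finite T" "T \<noteq> {}" "card T = rk J"
    and f: "bij_betw f (lower_cone P le J) {S. S \<noteq> {} \<and> S \<subseteq> T}"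
    using assms unfolding bool_cones_def by blast
  have "{S. S \<noteq> {} \<and> S \<subseteq> T} = Pow T - {{}}" by auto
  then have "card {S. S \<noteq> {} \<and> S \<subseteq> T} = 2 ^ rk J - 1" using T by (simp add: card_Pow)
  then show ?thesis using bij_betw_same_card[OF f] by simp
qed

text \<open>The cone of \<open>I\<close> has \<open>2 ^ card (f I) - 1\<close> elements when counted
  inside the cone of \<open>J\<close>, and \<open>2 ^ rk I - 1\<close> by its own Boolean
  structure.\<close>

lemma bool_cones_rank_face:
  assumes bc: "bool_cones P le rk" and J: "J \<in> P" and I: "I \<in> P" "le I J"
    and T: "finite T" and f: "\<And>x. x \<in> P \<Longrightarrow> le x J \<Longrightarrow> f x \<noteq> {} \<and> f x \<subseteq> T"
    "\<And>S. S \<noteq> {} \<Longrightarrow> S \<subseteq> T \<Longrightarrow> \<exists>x\<in>P. le x J \<and> f x = S"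
    "\<And>x y. x \<in> P \<Longrightarrow> le x J \<Longrightarrow> y \<in> P \<Longrightarrow> le y J \<Longrightarrow> le x y \<longleftrightarrow> f x \<subseteq> f y"
    "\<And>x y. x \<in> P \<Longrightarrow> le x J \<Longrightarrow> y \<in> P \<Longrightarrow> le y J \<Longrightarrow> f x = f y \<Longrightarrow> x = y"
  shows "card (f I) = rk I"
proof -
  note trans = finite_poset_trans[OF bool_cones_finite_poset[OF bc]]
  have fin: "finite (f I)" using f(1)[OF I] T finite_subset by blast
  have "bij_betw f (lower_cone P le I) {S. S \<noteq> {} \<and> S \<subseteq> f I}"
    unfolding bij_betw_def
  proof
    show "inj_on f (lower_cone P le I)"
      using f(4) trans[OF _ I(2)] I J by (auto simp: inj_on_def lower_cone_def)
    show "f ` lower_cone P le I = {S. S \<noteq> {} \<and> S \<subseteq> f I}"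
    proof
      show "f ` lower_cone P le I \<subseteq> {S. S \<noteq> {} \<and> S \<subseteq> f I}"
      proof clarify
        fix x assume "x \<in> lower_cone P le I"
        then have x: "x \<in> P" "le x I" by (auto simp: lower_cone_def)
        have xJ: "le x J" by (rule trans[OF x(2) I(2) x(1) I(1) J])
        show "f x \<noteq> {} \<and> f x \<subseteq> f I" using f(1)[OF x(1) xJ] f(3)[OF x(1) xJ I] x(2) by blast
      qed
      show "{S. S \<noteq> {} \<and> S \<subseteq> f I} \<subseteq> f ` lower_cone P le I"
      proof
        fix S assume S: "S \<in> {S. S \<noteq> {} \<and> S \<subseteq> f I}"
        then have "S \<noteq> {}" "S \<subseteq> T" using f(1)[OF I] by auto
        then obtain x where x: "x \<in> P" "le x J" "f x = S" using f(2) by blast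
        then have "le x I" using f(3)[OF x(1,2) I] S by simp
        then show "S \<in> f ` lower_cone P le I" using x by (auto simp: lower_cone_def)
      qed
    qed
  qed
  then have "card (lower_cone P le I) = card {S. S \<noteq> {} \<and> S \<subseteq> f I}" by (rule bij_betw_same_card)
  moreover have "{S. S \<noteq> {} \<and> S \<subseteq> f I} = Pow (f I) - {{}}" by auto
  ultimately have "2 ^ rk I - 1 = (2 ^ card (f I) - 1 :: nat)"
    using card_lower_cone[OF bc I(1)] fin by (simp add: card_Pow)
  moreover have "(1::nat) \<le> 2 ^ rk I" "(1::nat) \<le> 2 ^ card (f I)" by simp_all
  ultimately have "(2::nat) ^ rk I = 2 ^ card (f I)" by linarith
  then show ?thesis by simp
qed

text \<open>Inside the cone of \<open>J\<close>, subtracting \<open>f I\<close> identifies the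
  elements strictly above \<open>I\<close> with the nonempty subsets of
  \<open>T - f I\<close>.\<close>

lemma bool_cones_upper_link:
  assumes bc: "bool_cones P le rk" and I: "I \<in> P"
  shows "bool_cones (upper_link P le I) le (\<lambda>J. rk J - rk I)"
    and "\<And>J. J \<in> upper_link P le I \<Longrightarrow> rk I < rk J"
proof -
  note P = bool_cones_finite_poset[OF bc]
  note trans = finite_poset_trans[OF P]
  have *: "rk I < rk J \<and> (\<exists>f (T :: nat set). finite T \<and> T \<noteq> {} \<and> card T = rk J - rk I \<and>
        bij_betw f (lower_cone (upper_link P le I) le J) {S. S \<noteq> {} \<and> S \<subseteq> T} \<and>
        (\<forall>x\<in>lower_cone (upper_link P le I) le J. \<forall>y\<in>lower_cone (upper_link P le I) le J.
           le x y \<longleftrightarrow> f x \<subseteq> f y))"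
    if J: "J \<in> upper_link P le I" for J
  proof -
    have JP: "J \<in> P" and IJ: "le I J" "J \<noteq> I" using J by (auto simp: upper_link_def)
    have JJ: "le J J" by (rule finite_poset_refl[OF P JP])
  obtain f :: "'a \<Rightarrow> nat set" and T where T: "finite T" "T \<noteq> {}" "card T = rk J"
    and f1: "\<And>x. x \<in> P \<Longrightarrow> le x J \<Longrightarrow> f x \<noteq> {} \<and> f x \<subseteq> T"
    and f2: "\<And>S. S \<noteq> {} \<Longrightarrow> S \<subseteq> T \<Longrightarrow> \<exists>x\<in>P. le x J \<and> f x = S"
    and f3: "\<And>x y. x \<in> P \<Longrightarrow> le x J \<Longrightarrow> y \<in> P \<Longrightarrow> le y J \<Longrightarrow> le x y \<longleftrightarrow> f x \<subseteq> f y"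
    and f4: "\<And>x y. x \<in> P \<Longrightarrow> le x J \<Longrightarrow> y \<in> P \<Longrightarrow> le y J \<Longrightarrow> f x = f y \<Longrightarrow> x = y"
    and fJ: "f J = T"
    by (rule bool_conesE[OF bc JP]) (rule that; assumption)
    have cI: "card (f I) = rk I"
      by (rule bool_cones_rank_face[OF bc JP I IJ(1) T(1) f1 f2 f3 f4])
    have fIT: "f I \<subseteq> T" "f I \<noteq> T" using f1[OF I IJ(1)] f4[OF I IJ(1) JP JJ] fJ IJ(2) by auto
    then have lt: "rk I < rk J" using psubset_card_mono[OF T(1), of "f I"] cI T(3) by auto
    let ?f = "\<lambda>x. f x - f I" let ?T = "T - f I" let ?C = "lower_cone (upper_link P le I) le J"
    have C: "x \<in> ?C \<longleftrightarrow> x \<in> P \<and> le I x \<and> x \<noteq> I \<and> le x J" for x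
      by (auto simp: lower_cone_def upper_link_def)
    have CI: "f I \<subset> f x" if "x \<in> ?C" for x
      using f3[OF I IJ(1), of x] f4[OF I IJ(1), of x] that unfolding C by blast
    have fC: "le x y \<longleftrightarrow> ?f x \<subseteq> ?f y" if "x \<in> ?C" "y \<in> ?C" for x y
    proof -
      have "le x y \<longleftrightarrow> f x \<subseteq> f y" using f3 that unfolding C by blast
      then show ?thesis using CI[OF that(1)] CI[OF that(2)] by blast
    qed
    have "bij_betw ?f ?C {S. S \<noteq> {} \<and> S \<subseteq> ?T}"
      unfolding bij_betw_def
    proof
      show "inj_on ?f ?C"
      proof (rule inj_onI)
        fix x y assume xy: "x \<in> ?C" "y \<in> ?C" "?f x = ?f y"
        then have "f x = f y" using CI[of x] CI[of y] by blast
        then show "x = y" using f4 xy(1,2) unfolding C by blast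
      qed
      show "?f ` ?C = {S. S \<noteq> {} \<and> S \<subseteq> ?T}"
      proof
        show "?f ` ?C \<subseteq> {S. S \<noteq> {} \<and> S \<subseteq> ?T}"
        proof clarify
          fix x assume x: "x \<in> ?C"
          then have "f x \<subseteq> T" using f1 unfolding C by blast
          then show "?f x \<noteq> {} \<and> ?f x \<subseteq> ?T" using CI[OF x] by blast
        qed
        show "{S. S \<noteq> {} \<and> S \<subseteq> ?T} \<subseteq> ?f ` ?C"
        proof
          fix S assume S: "S \<in> {S. S \<noteq> {} \<and> S \<subseteq> ?T}"
          then have "S \<union> f I \<noteq> {}" "S \<union> f I \<subseteq> T" using fIT by auto
          then obtain x where x: "x \<in> P" "le x J" "f x = S \<union> f I" using f2[of "S \<union> f I"] by blast
          then have "le I x" using f3[OF I IJ(1) x(1,2)] by auto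
          moreover have "x \<noteq> I" using x(3) S by auto
          ultimately have "x \<in> ?C" using x C by blast
          moreover have "?f x = S" using x(3) S by auto
          ultimately show "S \<in> ?f ` ?C" by blast
        qed
      qed
    qed
    moreover have "card ?T = rk J - rk I"
      using card_Diff_subset[OF finite_subset[OF fIT(1) T(1)] fIT(1)] cI T(3) by simp
    moreover have "?T \<noteq> {}" using fIT by auto
    ultimately show ?thesis using lt T(1) fC by (intro conjI exI[of _ ?f] exI[of _ ?T]) auto
  qed
  have "finite_poset (upper_link P le I) le"
    by (rule finite_poset_subset[OF P]) (auto simp: upper_link_def)
  with * show "bool_cones (upper_link P le I) le (\<lambda>J. rk J - rk I)"
    unfolding bool_cones_def by blast
  show "\<And>J. J \<in> upper_link P le I \<Longrightarrow> rk I < rk J" using * by blast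
qed

text \<open>Take the union of the two sets in the cone of \<open>J\<close>. The join is relative to
  \<open>J\<close>: in a simplicial poset two elements may have several minimal upper
  bounds.\<close>

lemma bool_cones_join:
  assumes bc: "bool_cones P le rk" and J: "J \<in> P" and "x \<in> P" "le x J" "y \<in> P" "le y J"
  shows "\<exists>j\<in>P. le j J \<and> le x j \<and> le y j \<and> (\<forall>w\<in>P. le w J \<longrightarrow> le x w \<longrightarrow> le y w \<longrightarrow> le j w)"
proof -
  obtain f :: "'a \<Rightarrow> nat set" and T where T: "finite T" "T \<noteq> {}" "card T = rk J"
    and f1: "\<And>x. x \<in> P \<Longrightarrow> le x J \<Longrightarrow> f x \<noteq> {} \<and> f x \<subseteq> T"
    and f2: "\<And>S. S \<noteq> {} \<Longrightarrow> S \<subseteq> T \<Longrightarrow> \<exists>x\<in>P. le x J \<and> f x = S"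
    and f3: "\<And>x y. x \<in> P \<Longrightarrow> le x J \<Longrightarrow> y \<in> P \<Longrightarrow> le y J \<Longrightarrow> le x y \<longleftrightarrow> f x \<subseteq> f y"
    and f4: "\<And>x y. x \<in> P \<Longrightarrow> le x J \<Longrightarrow> y \<in> P \<Longrightarrow> le y J \<Longrightarrow> f x = f y \<Longrightarrow> x = y"
    and fJ: "f J = T"
    by (rule bool_conesE[OF bc J]) (rule that; assumption)
  have "f x \<union> f y \<noteq> {}" "f x \<union> f y \<subseteq> T" using f1 assms by auto
  then obtain j where j: "j \<in> P" "le j J" "f j = f x \<union> f y" using f2[of "f x \<union> f y"] by blast
  have "le j w" if "w \<in> P" "le w J" "le x w" "le y w" for w
    using f3[OF j(1,2) that(1,2)] f3[of x w] f3[of y w] that assms j(3) by auto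
  moreover have "le x j" "le y j" using f3[of x j] f3[of y j] assms j by auto
  ultimately show ?thesis using j by blast
qed

text \<open>\<open>c\<close> is the face complementary to \<open>x\<close> in the simplex
  \<open>z\<close>. Adding the complement of \<open>f x\<close> to a set that does not contain
  \<open>f x\<close> never completes \<open>f x\<close>, so joins with \<open>c\<close> stay among
  the elements not above \<open>x\<close>.\<close>

lemma bool_cones_complement:
  assumes bc: "bool_cones P le rk" and z: "z \<in> P" and x: "x \<in> P" "le x z" "x \<noteq> z"
  shows "\<exists>c\<in>P. le c z \<and> \<not> le x c \<and> (\<forall>y\<in>P. le y z \<longrightarrow> \<not> le x y \<longrightarrow>
    (\<exists>j\<in>P. le j z \<and> \<not> le x j \<and> le y j \<and> le c j \<and> (\<forall>w\<in>P. le w z \<longrightarrow> le y w \<longrightarrow> le c w \<longrightarrow> le j w)))"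
proof -
  have zz: "le z z" by (rule finite_poset_refl[OF bool_cones_finite_poset[OF bc] z])
  obtain f :: "'a \<Rightarrow> nat set" and T where T: "finite T" "T \<noteq> {}" "card T = rk z"
    and f1: "\<And>x. x \<in> P \<Longrightarrow> le x z \<Longrightarrow> f x \<noteq> {} \<and> f x \<subseteq> T"
    and f2: "\<And>S. S \<noteq> {} \<Longrightarrow> S \<subseteq> T \<Longrightarrow> \<exists>x\<in>P. le x z \<and> f x = S"
    and f3: "\<And>x y. x \<in> P \<Longrightarrow> le x z \<Longrightarrow> y \<in> P \<Longrightarrow> le y z \<Longrightarrow> le x y \<longleftrightarrow> f x \<subseteq> f y"
    and f4: "\<And>x y. x \<in> P \<Longrightarrow> le x z \<Longrightarrow> y \<in> P \<Longrightarrow> le y z \<Longrightarrow> f x = f y \<Longrightarrow> x = y"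
    and fJ: "f z = T"
    by (rule bool_conesE[OF bc z]) (rule that; assumption)
  have "T - f x \<noteq> {}" using f1[OF x(1,2)] f4[OF x(1,2) z zz] fJ x(3) by blast
  then obtain c where c: "c \<in> P" "le c z" "f c = T - f x" using f2[of "T - f x"] by blast
  have "\<not> le x c" using f3[OF x(1,2) c(1,2)] c(3) f1[OF x(1,2)] by blast
  moreover have "\<exists>j\<in>P. le j z \<and> \<not> le x j \<and> le y j \<and> le c j \<and>
      (\<forall>w\<in>P. le w z \<longrightarrow> le y w \<longrightarrow> le c w \<longrightarrow> le j w)"
    if y: "y \<in> P" "le y z" "\<not> le x y" for y
  proof -
    obtain j where j: "j \<in> P" "le j z" "f j = f y \<union> f c"
      using f2[of "f y \<union> f c"] f1[OF y(1,2)] f1[OF c(1,2)] by blast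
    have "\<not> le x j" using f3[OF x(1,2) j(1,2)] f3[OF x(1,2) y(1,2)] y(3) j(3) c(3) by blast
    moreover have "le j w" if "w \<in> P" "le w z" "le y w" "le c w" for w
      using f3[OF j(1,2) that(1,2)] f3[OF y(1,2) that(1,2)] f3[OF c(1,2) that(1,2)] that j(3) by auto
    moreover have "le y j" "le c j" using f3[OF y(1,2) j(1,2)] f3[OF c(1,2) j(1,2)] j(3) by auto
    ultimately show ?thesis using j by blast
  qed
  ultimately show ?thesis using c by blast
qed

text \<open>The elements of \<open>S\<close> are added from the top. By the existence of complements of \<open>x\<close> the elements
  below \<open>z\<close> that are not above \<open>x\<close> form a contractible poset.\<close>

lemma upper_part_def_retract:
  assumes bc: "bool_cones Q le rk" and x: "x \<in> Q"
    and "S \<subseteq> {z\<in>Q. le x z \<and> z \<noteq> x}" and "\<And>z w. z \<in> S \<Longrightarrow> w \<in> Q \<Longrightarrow> le z w \<Longrightarrow> w \<in> S"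
  shows "def_retract (realization_set {y\<in>Q. \<not> le x y} le) (realization_set ({y\<in>Q. \<not> le x y} \<union> S) le)"
  using assms(3,4)
proof (induction "card S" arbitrary: S rule: less_induct)
  case less
  note P = bool_cones_finite_poset[OF bc]
  note trans = finite_poset_trans[OF P] and refl = finite_poset_refl[OF P]
    and antisym = finite_poset_antisym[OF P]
  let ?R = "{y\<in>Q. \<not> le x y}"
  have finS: "finite S" using less.prems(1) finite_poset_finite[OF P] finite_subset by fastforce
  show ?case
  proof (cases "S = {}")
    case True
    then show ?thesis by (simp add: def_retract_refl)
  next
    case False
    have SQ: "S \<subseteq> Q" using less.prems(1) by auto
    \<comment> \<open>For \<open>z\<close> minimal in \<open>S\<close> the link consists of the
      faces of \<open>z\<close> not above \<open>x\<close> and of everything strictly above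
      \<open>z\<close>.\<close>
    obtain z where zS: "z \<in> S" and zmin: "\<And>w. w \<in> S \<Longrightarrow> le w z \<Longrightarrow> w = z"
      by (rule finite_poset_minimal[OF P SQ False]) blast
    have z: "z \<in> Q" "le x z" "x \<noteq> z" using zS less.prems(1) by auto
    let ?Q1 = "?R \<union> S" let ?L = "link_in ?Q1 le z"
    have fin1: "finite ?Q1" using finS finite_poset_finite[OF P] by auto
    have P1: "finite_poset ?Q1 le" by (rule finite_poset_subset[OF P]) (use SQ in auto)
    have LQ: "?L \<subseteq> ?Q1" by (auto simp: link_in_def)
    have PL: "finite_poset ?L le" by (rule finite_poset_subset[OF P1 LQ])
    have L: "y \<in> ?L \<longleftrightarrow> (y \<in> Q \<and> \<not> le x y \<and> le y z) \<or> (y \<in> Q \<and> le z y \<and> y \<noteq> z)" for y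
    proof
      assume y: "y \<in> ?L"
      then have y': "y \<in> ?Q1" "y \<noteq> z" "le z y \<or> le y z" by (auto simp: link_in_def)
      show "(y \<in> Q \<and> \<not> le x y \<and> le y z) \<or> (y \<in> Q \<and> le z y \<and> y \<noteq> z)"
      proof (cases "y \<in> S")
        case True
        then show ?thesis using zmin[of y] y' SQ by blast
      next
        case False
        then have "y \<in> Q" "\<not> le x y" using y' by auto
        then show ?thesis using trans[OF z(2), of y] x z y' by blast
      qed
    next
      assume "(y \<in> Q \<and> \<not> le x y \<and> le y z) \<or> (y \<in> Q \<and> le z y \<and> y \<noteq> z)"
      then show "y \<in> ?L" using less.prems(2)[OF zS, of y] z by (auto simp: link_in_def)
    qed
    obtain c where c: "c \<in> Q" "le c z" "\<not> le x c"
      and cj: "\<And>y. y \<in> Q \<Longrightarrow> le y z \<Longrightarrow> \<not> le x y \<Longrightarrow> \<exists>j\<in>Q. le j z \<and> \<not> le x j \<and> le y j \<and> le c j \<and>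
        (\<forall>w\<in>Q. le w z \<longrightarrow> le y w \<longrightarrow> le c w \<longrightarrow> le j w)"
      using bool_cones_complement[OF bc z(1) x z(2,3)] by blast
    have "contractible (realization_set ?L le) \<and> realization_set ?L le \<noteq> {}"
    proof (rule joins_contractible[OF PL, where c = c])
      show "c \<in> ?L" using L c by blast
      fix y assume y: "y \<in> ?L"
      show "\<exists>j\<in>?L. le y j \<and> le c j \<and> (\<forall>w\<in>?L. le y w \<and> le c w \<longrightarrow> le j w)"
      proof (cases "le z y")
        case True
        have yQ: "y \<in> Q" using y L by blast
        \<comment> \<open>Here \<open>c\<close> is below \<open>z\<close> and \<open>z\<close> below
          \<open>y\<close>, so \<open>y\<close> is its own join with \<open>c\<close>.\<close>
        have "le c y" using trans[OF c(2) True] c(1) z(1) yQ by blast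
        then show ?thesis using y refl[OF yQ] by blast
      next
        case False
        then have y': "y \<in> Q" "le y z" "\<not> le x y" using y L by auto
        obtain j where j: "j \<in> Q" "le j z" "\<not> le x j" "le y j" "le c j"
          and jmin: "\<And>w. w \<in> Q \<Longrightarrow> le w z \<Longrightarrow> le y w \<Longrightarrow> le c w \<Longrightarrow> le j w"
          using cj[OF y'] by blast
        have "le j w" if w: "w \<in> ?L" "le y w" "le c w" for w
        proof (cases "le z w")
          case True
          then show ?thesis using trans[OF j(2) True] j(1) z(1) w(1) L by blast
        next
          case False
          then show ?thesis using jmin[of w] w L by blast
        qed
        then show ?thesis using j L by blast
      qed
    qed
    then have d1: "def_retract (realization_set (?Q1 - {z}) le) (realization_set ?Q1 le)"
      using contractible_link_def_retract[of ?Q1 z le] fin1 zS refl[OF z(1)] by blast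
    have eq: "?Q1 - {z} = ?R \<union> (S - {z})" using z by auto
    have d2: "def_retract (realization_set ?R le) (realization_set (?R \<union> (S - {z})) le)"
    proof (rule less.hyps)
      show "card (S - {z}) < card S" using finS zS by (rule card_Diff1_less)
      show "S - {z} \<subseteq> {z\<in>Q. le x z \<and> z \<noteq> x}" using less.prems(1) by auto
      fix u w assume u: "u \<in> S - {z}" "w \<in> Q" "le u w"
      have "w \<noteq> z" using zmin[of u] u by auto
      then show "w \<in> S - {z}" using less.prems(2)[of u w] u by auto
    qed
    show ?thesis by (rule def_retract_trans[OF d2 d1[unfolded eq]])
  qed
qed

text \<open>The conditions of \<open>sections\<close> with arbitrary values outside
  \<open>V\<close>, so that restricting to a smaller ideal leaves the function itself
  unchanged.\<close>

definition compatible :: "('a \<Rightarrow> 'a \<Rightarrow> bool) \<Rightarrow> ('a \<Rightarrow> 'b set) \<Rightarrow> ('a \<Rightarrow> 'a \<Rightarrow> 'b \<Rightarrow> 'b) \<Rightarrow> 'a set \<Rightarrow> ('a \<Rightarrow> 'b) \<Rightarrow> bool" where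
  "compatible le D Dm V v \<longleftrightarrow>
     (\<forall>K\<in>V. v K \<in> D K) \<and> (\<forall>K\<in>V. \<forall>L\<in>V. le K L \<longrightarrow> Dm L K (v L) = v K)"

text \<open>\<open>V\<close> may be empty, so this includes \<open>D J \<noteq> {}\<close>.\<close>

definition loc_flabby :: "'a set \<Rightarrow> ('a \<Rightarrow> 'a \<Rightarrow> bool) \<Rightarrow> ('a \<Rightarrow> 'b set) \<Rightarrow> ('a \<Rightarrow> 'a \<Rightarrow> 'b \<Rightarrow> 'b) \<Rightarrow> bool" where
  "loc_flabby P le D Dm \<longleftrightarrow> (\<forall>J\<in>P. \<forall>V v. lower_ideal P le V \<longrightarrow> (\<forall>K\<in>V. le K J \<and> K \<noteq> J) \<longrightarrow>
     compatible le D Dm V v \<longrightarrow> (\<exists>d\<in>D J. \<forall>K\<in>V. Dm J K d = v K))"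

lemma loc_flabbyD:
  assumes "loc_flabby P le D Dm" "J \<in> P" "lower_ideal P le V" "\<And>K. K \<in> V \<Longrightarrow> le K J \<and> K \<noteq> J"
    "compatible le D Dm V v"
  shows "\<exists>d\<in>D J. \<forall>K\<in>V. Dm J K d = v K"
  using assms unfolding loc_flabby_def by blast

lemma compatibleI:
  assumes "\<And>K. K \<in> V \<Longrightarrow> v K \<in> D K"
    and "\<And>K L. K \<in> V \<Longrightarrow> L \<in> V \<Longrightarrow> le K L \<Longrightarrow> Dm L K (v L) = v K"
  shows "compatible le D Dm V v"
  using assms by (simp add: compatible_def)

lemma compatible_subset: "compatible le D Dm U v \<Longrightarrow> V \<subseteq> U \<Longrightarrow> compatible le D Dm V v"
  by (auto simp: compatible_def)

text \<open>Extend from \<open>V\<close> to the lower cone of \<open>J\<close> and evaluate at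
  \<open>J\<close>. Flabbiness covers nonempty \<open>V\<close>; for empty \<open>V\<close> the
  section comes from inhabitedness.\<close>

lemma flabby_imp_loc_flabby:
  assumes P: "finite_poset P le" and "diagram P le D Dm"
    and inh: "sheaf_inhabited P le D Dm" and fl: "sheaf_flabby P le D Dm"
  shows "loc_flabby P le D Dm"
  unfolding loc_flabby_def
proof (intro ballI allI impI)
  fix J V v
  assume J: "J \<in> P" and V: "lower_ideal P le V" and VJ: "\<forall>K\<in>V. le K J \<and> K \<noteq> J"
    and v: "compatible le D Dm V v"
  let ?U = "lower_cone P le J"
  note trans = finite_poset_trans[OF P]
  have JU: "J \<in> ?U" using J finite_poset_refl[OF P J] by (simp add: lower_cone_def)
  have U: "lower_ideal P le ?U"
    using trans[OF _ _ _ _ J] by (auto simp: lower_ideal_def lower_cone_def)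
  have VU: "V \<subseteq> ?U" using V VJ by (auto simp: lower_ideal_def lower_cone_def)
  have "\<exists>w\<in>sections le D Dm ?U. \<forall>K\<in>V. w K = v K"
  proof (cases "V = {}")
    case True
    have "sections le D Dm ?U \<noteq> {}"
      using inh U JU unfolding sheaf_inhabited_def by blast
    with True show ?thesis by blast
  next
    case False
    have "restrict v V \<in> sections le D Dm V"
      using v by (simp add: sections_def compatible_def)
    also have "sections le D Dm V = (\<lambda>v. restrict v V) ` sections le D Dm ?U"
      using fl U V VU False unfolding sheaf_flabby_def by blast
    finally obtain w where w: "w \<in> sections le D Dm ?U" "restrict v V = restrict w V" by blast
    have "w K = v K" if "K \<in> V" for K using fun_cong[OF w(2), of K] that by simp
    then show ?thesis using w(1) by blast
  qed
  then obtain w where w: "w \<in> sections le D Dm ?U" and wv: "\<And>K. K \<in> V \<Longrightarrow> w K = v K" by blast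
  have "w J \<in> D J" using w JU by (auto simp: sections_def)
  moreover have "Dm J K (w J) = v K" if "K \<in> V" for K
    using w wv[OF that] JU VJ VU that by (auto simp: sections_def)
  ultimately show "\<exists>d\<in>D J. \<forall>K\<in>V. Dm J K d = v K" by blast
qed

text \<open>A minimal element of the complement has all its boundary values prescribed already, so
  it can be added by the local property.\<close>

lemma section_extends:
  assumes P: "finite_poset P le" and fl: "loc_flabby P le D Dm"
    and idn: "\<And>J d. J \<in> P \<Longrightarrow> d \<in> D J \<Longrightarrow> Dm J J d = d"
    and "lower_ideal P le U" "compatible le D Dm U v"
  shows "\<exists>w. compatible le D Dm P w \<and> (\<forall>K\<in>U. w K = v K)"
  using assms(4,5)
proof (induction "card (P - U)" arbitrary: U v rule: less_induct)
  case less
  note U = less.prems(1) and v = less.prems(2)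
  note trans = finite_poset_trans[OF P] and fin = finite_poset_finite[OF P]
  have UP: "U \<subseteq> P" and down: "\<And>I J. I \<in> P \<Longrightarrow> J \<in> U \<Longrightarrow> le I J \<Longrightarrow> I \<in> U"
    using U by (auto simp: lower_ideal_def)
  show ?case
  proof (cases "P - U = {}")
    case True
    then have "U = P" using UP by auto
    then show ?thesis using v by blast
  next
    case False
    obtain J where J: "J \<in> P - U" and Jmin: "\<And>K. K \<in> P - U \<Longrightarrow> le K J \<Longrightarrow> K = J"
      by (rule finite_poset_minimal[OF P _ False]) blast+
    let ?V = "{K\<in>P. le K J \<and> K \<noteq> J}"
    have VU: "?V \<subseteq> U" using Jmin by blast
    have "lower_ideal P le ?V"
      unfolding lower_ideal_def
      using trans[of _ _ J] finite_poset_antisym[OF P] J by blast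
    then have "\<exists>d\<in>D J. \<forall>K\<in>?V. Dm J K d = v K"
      using J by (intro loc_flabbyD[OF fl]) (auto intro: compatible_subset[OF v VU])
    then obtain d where d: "d \<in> D J" "\<And>K. K \<in> ?V \<Longrightarrow> Dm J K d = v K" by blast
    let ?v = "v(J := d)"
    have U': "lower_ideal P le (insert J U)"
      unfolding lower_ideal_def using UP J Jmin down by blast
    have v': "compatible le D Dm (insert J U) ?v"
      unfolding compatible_def
    proof (intro conjI ballI impI)
      show "?v K \<in> D K" if "K \<in> insert J U" for K using that v d by (auto simp: compatible_def)
      fix K L assume KL: "K \<in> insert J U" "L \<in> insert J U" "le K L"
      show "Dm L K (?v L) = ?v K"
      proof (cases "L = J")
        case True
        show ?thesis
        proof (cases "K = J")
          case True
          with \<open>L = J\<close> show ?thesis using idn[of J d] d J by simp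
        next
          case False
          then have "K \<in> ?V" using KL True UP by auto
          then show ?thesis using d(2) True False by simp
        qed
      next
        case False
        then have "K \<noteq> J" using down[of J L] KL J by auto
        then show ?thesis using False KL v by (auto simp: compatible_def)
      qed
    qed
    have "card (P - insert J U) < card (P - U)" using J fin by (intro psubset_card_mono) auto
    from less.hyps[OF this U' v'] obtain w where w: "compatible le D Dm P w"
      "\<forall>K\<in>insert J U. w K = ?v K" by blast
    then have "\<forall>K\<in>U. w K = v K" using J by auto
    then show ?thesis using w(1) by blast
  qed
qed

lemma diagramD:
  assumes "diagram P le D Dm"
  shows "I \<in> P \<Longrightarrow> finite (D I)"
    and "I \<in> P \<Longrightarrow> J \<in> P \<Longrightarrow> le I J \<Longrightarrow> e \<in> D J \<Longrightarrow> Dm J I e \<in> D I"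
    and "I \<in> P \<Longrightarrow> e \<in> D I \<Longrightarrow> Dm I I e = e"
    and "I \<in> P \<Longrightarrow> J \<in> P \<Longrightarrow> K \<in> P \<Longrightarrow> le I J \<Longrightarrow> le J K \<Longrightarrow> e \<in> D K \<Longrightarrow> Dm J I (Dm K J e) = Dm K I e"
  using assms unfolding diagram_def by blast+

lemma diagramI:
  assumes "\<And>I. I \<in> P \<Longrightarrow> finite (D I)"
    and "\<And>I J e. I \<in> P \<Longrightarrow> J \<in> P \<Longrightarrow> le I J \<Longrightarrow> e \<in> D J \<Longrightarrow> Dm J I e \<in> D I"
    and "\<And>I e. I \<in> P \<Longrightarrow> e \<in> D I \<Longrightarrow> Dm I I e = e"
    and "\<And>I J K e. I \<in> P \<Longrightarrow> J \<in> P \<Longrightarrow> K \<in> P \<Longrightarrow> le I J \<Longrightarrow> le J K \<Longrightarrow> e \<in> D K \<Longrightarrow>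
      Dm J I (Dm K J e) = Dm K I e"
  shows "diagram P le D Dm"
  using assms unfolding diagram_def by blast

section \<open>Inflations\<close>

lemma mem_inflation [simp]: "x \<in> inflation P D \<longleftrightarrow> fst x \<in> P \<and> snd x \<in> D (fst x)"
  by (cases x) (simp add: inflation_def)

lemma inflation_finite_poset:
  assumes P: "finite_poset P le" and D: "diagram P le D Dm"
  shows "finite_poset (inflation P D) (inflation_le le Dm)"
  unfolding finite_poset_def
proof (intro conjI ballI impI)
  have "inflation P D = Sigma P D" by auto
  then show "finite (inflation P D)"
    using finite_poset_finite[OF P] diagramD(1)[OF D] by auto
  show "inflation_le le Dm x x" if "x \<in> inflation P D" for x
    using that finite_poset_refl[OF P] diagramD(3)[OF D] by (simp add: inflation_le_def)
  show "x = y" if "x \<in> inflation P D" "y \<in> inflation P D"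
    "inflation_le le Dm x y \<and> inflation_le le Dm y x" for x y
  proof -
    have 1: "fst x = fst y"
      using that finite_poset_antisym[OF P, of "fst x" "fst y"] by (simp add: inflation_le_def)
    have "Dm (fst y) (fst x) (snd y) = snd x" using that(3) unfolding inflation_le_def by blast
    moreover have "Dm (fst y) (fst y) (snd y) = snd y"
      using that(2) by (intro diagramD(3)[OF D]) simp_all
    ultimately show ?thesis using 1 by (metis prod_eqI)
  qed
  show "inflation_le le Dm x z" if "x \<in> inflation P D" "y \<in> inflation P D" "z \<in> inflation P D"
    "inflation_le le Dm x y \<and> inflation_le le Dm y z" for x y z
  proof -
    have le: "le (fst x) (fst y)" "le (fst y) (fst z)" using that(4) by (simp_all add: inflation_le_def)
    have "Dm (fst y) (fst x) (Dm (fst z) (fst y) (snd z)) = Dm (fst z) (fst x) (snd z)"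
      using that le by (intro diagramD(4)[OF D]) simp_all
    moreover have "le (fst x) (fst z)"
      using that by (intro finite_poset_trans[OF P le]) simp_all
    ultimately show ?thesis using that(4) by (simp add: inflation_le_def)
  qed
qed

text \<open>Below \<open>(J,e)\<close> the second component is determined by the first, as the image
  of \<open>e\<close>.\<close>

lemma inflation_le_below:
  assumes D: "diagram P le D Dm" and J: "J \<in> P" "e \<in> D J"
    and x: "x \<in> inflation P D" "inflation_le le Dm x (J,e)"
    and y: "y \<in> inflation P D" "inflation_le le Dm y (J,e)"
  shows "inflation_le le Dm x y \<longleftrightarrow> le (fst x) (fst y)"
  using x y diagramD(4)[OF D, of "fst x" "fst y" J e] J by (auto simp: inflation_le_def)

lemma inflation_lower_cone_bij:
  assumes P: "finite_poset P le" and D: "diagram P le D Dm" and J: "J \<in> P" "e \<in> D J"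
  shows "bij_betw fst (lower_cone (inflation P D) (inflation_le le Dm) (J,e)) (lower_cone P le J)"
  unfolding bij_betw_def
proof
  show "inj_on fst (lower_cone (inflation P D) (inflation_le le Dm) (J,e))"
    by (auto simp: inj_on_def lower_cone_def inflation_le_def prod_eq_iff)
  show "fst ` lower_cone (inflation P D) (inflation_le le Dm) (J,e) = lower_cone P le J"
  proof
    show "fst ` lower_cone (inflation P D) (inflation_le le Dm) (J,e) \<subseteq> lower_cone P le J"
      by (auto simp: lower_cone_def inflation_le_def)
    show "lower_cone P le J \<subseteq> fst ` lower_cone (inflation P D) (inflation_le le Dm) (J,e)"
    proof
      fix K assume "K \<in> lower_cone P le J"
      then have "(K, Dm J K e) \<in> lower_cone (inflation P D) (inflation_le le Dm) (J,e)"
        using diagramD(2)[OF D] J by (simp add: lower_cone_def inflation_le_def)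
      then show "K \<in> fst ` lower_cone (inflation P D) (inflation_le le Dm) (J,e)" by force
    qed
  qed
qed

lemma inflation_lower_cone_iso:
  assumes P: "finite_poset P le" and D: "diagram P le D Dm" and J: "J \<in> P" "e \<in> D J"
    and f: "bij_betw f (lower_cone P le J) X"
    and fle: "\<forall>x\<in>lower_cone P le J. \<forall>y\<in>lower_cone P le J. le x y \<longleftrightarrow> f x \<subseteq> f y"
  shows "bij_betw (f \<circ> fst) (lower_cone (inflation P D) (inflation_le le Dm) (J,e)) X"
    and "\<forall>x\<in>lower_cone (inflation P D) (inflation_le le Dm) (J,e).
      \<forall>y\<in>lower_cone (inflation P D) (inflation_le le Dm) (J,e).
        inflation_le le Dm x y \<longleftrightarrow> (f \<circ> fst) x \<subseteq> (f \<circ> fst) y"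
proof -
  let ?C = "lower_cone (inflation P D) (inflation_le le Dm) (J,e)"
  note b = inflation_lower_cone_bij[OF P D J]
  show "bij_betw (f \<circ> fst) ?C X" by (rule bij_betw_trans[OF b f])
  show "\<forall>x\<in>?C. \<forall>y\<in>?C. inflation_le le Dm x y \<longleftrightarrow> (f \<circ> fst) x \<subseteq> (f \<circ> fst) y"
  proof (intro ballI)
    fix x y assume xy: "x \<in> ?C" "y \<in> ?C"
    then have "fst x \<in> lower_cone P le J" "fst y \<in> lower_cone P le J"
      using b by (auto simp: bij_betw_def)
    then have "le (fst x) (fst y) \<longleftrightarrow> f (fst x) \<subseteq> f (fst y)" using fle by blast
    moreover have "inflation_le le Dm x y \<longleftrightarrow> le (fst x) (fst y)"
      using xy by (intro inflation_le_below[OF D J]) (simp_all add: lower_cone_def)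
    ultimately show "inflation_le le Dm x y \<longleftrightarrow> (f \<circ> fst) x \<subseteq> (f \<circ> fst) y" by simp
  qed
qed

lemma bool_cones_inflation:
  assumes bc: "bool_cones P le rk" and D: "diagram P le D Dm"
  shows "bool_cones (inflation P D) (inflation_le le Dm) (\<lambda>x. rk (fst x))"
  unfolding bool_cones_def
proof (intro conjI ballI)
  note P = bool_cones_finite_poset[OF bc]
  show "finite_poset (inflation P D) (inflation_le le Dm)" by (rule inflation_finite_poset[OF P D])
  fix x assume "x \<in> inflation P D"
  then obtain J e where x: "x = (J,e)" and J: "J \<in> P" "e \<in> D J" by (cases x) auto
  obtain f and T :: "nat set" where T: "finite T" "T \<noteq> {}" "card T = rk J"
    and f: "bij_betw f (lower_cone P le J) {S. S \<noteq> {} \<and> S \<subseteq> T}"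
    and fle: "\<forall>x\<in>lower_cone P le J. \<forall>y\<in>lower_cone P le J. le x y \<longleftrightarrow> f x \<subseteq> f y"
    using bc J unfolding bool_cones_def by blast
  show "\<exists>f (T :: nat set). finite T \<and> T \<noteq> {} \<and> card T = rk (fst x) \<and>
      bij_betw f (lower_cone (inflation P D) (inflation_le le Dm) x) {S. S \<noteq> {} \<and> S \<subseteq> T} \<and>
      (\<forall>y\<in>lower_cone (inflation P D) (inflation_le le Dm) x.
        \<forall>z\<in>lower_cone (inflation P D) (inflation_le le Dm) x. inflation_le le Dm y z \<longleftrightarrow> f y \<subseteq> f z)"
    unfolding x using T inflation_lower_cone_iso[OF P D J f fle]
    by (intro exI[of _ "f \<circ> fst"] exI[of _ T]) simp
qed

definition link_diagram :: "('a \<Rightarrow> 'b set) \<Rightarrow> ('a \<Rightarrow> 'a \<Rightarrow> 'b \<Rightarrow> 'b) \<Rightarrow> 'a \<Rightarrow> 'b \<Rightarrow> 'a \<Rightarrow> 'b set" where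
  "link_diagram D Dm I x J = {e \<in> D J. Dm J I e = x}"

lemma upper_link_inflation:
  assumes D: "diagram P le D Dm" and I: "I \<in> P" "x \<in> D I"
  shows "upper_link (inflation P D) (inflation_le le Dm) (I,x) =
    inflation (upper_link P le I) (link_diagram D Dm I x)"
  using diagramD(3)[OF D I(1)]
  by (auto simp: upper_link_def link_diagram_def inflation_le_def)

lemma diagram_link:
  assumes P: "finite_poset P le" and D: "diagram P le D Dm" and I: "I \<in> P"
  shows "diagram (upper_link P le I) le (link_diagram D Dm I x) Dm"
proof (rule diagramI)
  fix J K e assume J: "J \<in> upper_link P le I" "K \<in> upper_link P le I" "le J K"
    "e \<in> link_diagram D Dm I x K"
  then have "Dm J I (Dm K J e) = Dm K I e"
    using diagramD(4)[OF D I, of J K e] by (simp add: upper_link_def link_diagram_def)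
  then show "Dm K J e \<in> link_diagram D Dm I x J"
    using J diagramD(2)[OF D] by (simp add: upper_link_def link_diagram_def)
qed (use diagramD[OF D] in \<open>auto simp: upper_link_def link_diagram_def\<close>)

text \<open>A section below \<open>J\<close> in the link is extended to the ideal of \<open>P\<close> which it generates: the
  value at \<open>K\<close> is read off from the value at the join of \<open>K\<close> and \<open>I\<close> in the lower cone of \<open>J\<close>.\<close>

lemma loc_flabby_link:
  assumes bc: "bool_cones P le rk" and D: "diagram P le D Dm" and fl: "loc_flabby P le D Dm"
    and I: "I \<in> P" "x \<in> D I"
  shows "loc_flabby (upper_link P le I) le (link_diagram D Dm I x) Dm"
  unfolding loc_flabby_def
proof (intro ballI allI impI)
  fix J V v
  assume J: "J \<in> upper_link P le I" and V: "lower_ideal (upper_link P le I) le V"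
    and VJ: "\<forall>K\<in>V. le K J \<and> K \<noteq> J" and v: "compatible le (link_diagram D Dm I x) Dm V v"
  note P = bool_cones_finite_poset[OF bc]
  note trans = finite_poset_trans[OF P] and refl = finite_poset_refl[OF P]
    and antisym = finite_poset_antisym[OF P]
  have JP: "J \<in> P" and IJ: "le I J" "J \<noteq> I" using J by (auto simp: upper_link_def)
  have VL: "K \<in> P" "le I K" "K \<noteq> I" if "K \<in> V" for K
    using V that by (auto simp: lower_ideal_def upper_link_def)
  have vD: "v K \<in> D K" "Dm K I (v K) = x" if "K \<in> V" for K
    using v that by (auto simp: compatible_def link_diagram_def)
  have vv: "Dm L K (v L) = v K" if "K \<in> V" "L \<in> V" "le K L" for K L
    using v that by (auto simp: compatible_def)
  have Vdown: "K \<in> V" if "K \<in> P" "le I K" "K \<noteq> I" "L \<in> V" "le K L" for K L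
    using V that by (auto simp: lower_ideal_def upper_link_def)
  \<comment> \<open>Adjoining \<open>I\<close> with the value \<open>x\<close> forces the extension
    into the fibre over \<open>x\<close>, even when \<open>V\<close> is empty.\<close>
  define W where "W = insert I V"
  have W: "K \<in> P" "le I K" "le K J" "K \<noteq> J" if "K \<in> W" for K
    using that VL[of K] VJ I refl[OF I(1)] IJ by (auto simp: W_def)
  have Wdown: "K \<in> W" if "K \<in> P" "le I K" "L \<in> W" "le K L" for K L
    using that Vdown[of K L] antisym[of K I] I by (auto simp: W_def)
  define u where "u K = (if K = I then x else v K)" for K
  have uD: "u K \<in> D K" if "K \<in> W" for K using that vD I by (auto simp: u_def W_def)
  have uu: "Dm L K (u L) = u K" if "K \<in> W" "L \<in> W" "le K L" for K L
  proof (cases "L = I")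
    case True
    then have "K = I" using antisym[of K I] W[OF that(1)] that I by blast
    then show ?thesis using True diagramD(3)[OF D I] by (simp add: u_def)
  next
    case False
    then show ?thesis using that vD(2)[of L] vv[of K L] by (auto simp: u_def W_def)
  qed
  define M where "M K = (SOME j. j \<in> P \<and> le j J \<and> le K j \<and> le I j \<and>
    (\<forall>w\<in>P. le w J \<longrightarrow> le K w \<longrightarrow> le I w \<longrightarrow> le j w))" for K
  have M: "M K \<in> P" "le (M K) J" "le K (M K)" "le I (M K)"
    "\<And>w. w \<in> P \<Longrightarrow> le w J \<Longrightarrow> le K w \<Longrightarrow> le I w \<Longrightarrow> le (M K) w" if "K \<in> P" "le K J" for K
  proof -
    have "\<exists>j. j \<in> P \<and> le j J \<and> le K j \<and> le I j \<and>
        (\<forall>w\<in>P. le w J \<longrightarrow> le K w \<longrightarrow> le I w \<longrightarrow> le j w)"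
      using bool_cones_join[OF bc JP that I(1) IJ(1)] by blast
    from someI_ex[OF this, folded M_def]
    show "M K \<in> P" "le (M K) J" "le K (M K)" "le I (M K)"
      "\<And>w. w \<in> P \<Longrightarrow> le w J \<Longrightarrow> le K w \<Longrightarrow> le I w \<Longrightarrow> le (M K) w" by blast+
  qed
  define V' where "V' = {K\<in>P. \<exists>L\<in>W. le K L}"
  have V'J: "K \<in> P" "le K J" "K \<noteq> J" if K: "K \<in> V'" for K
  proof -
    obtain L where L: "K \<in> P" "L \<in> W" "le K L" using K by (auto simp: V'_def)
    show "K \<in> P" by fact
    show "le K J" by (rule trans[OF L(3) W(3)[OF L(2)] L(1) W(1)[OF L(2)] JP])
    show "K \<noteq> J" using antisym[of L J] W[OF L(2)] L JP by blast
  qed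
  have MW: "M K \<in> W" if KV: "K \<in> V'" for K
  proof -
    obtain L where L: "K \<in> P" "L \<in> W" "le K L" using KV by (auto simp: V'_def)
    note K = V'J[OF KV]
    have "le (M K) L" using M(5)[OF K(1,2)] L W[OF L(2)] by blast
    then show ?thesis using Wdown[of "M K" L] M[OF K(1,2)] L by blast
  qed
  have MWid: "M K = K" if "K \<in> W" for K
  proof -
    note K = W[OF that]
    have "le (M K) K" using M(5)[OF K(1,3) K(1,3) refl[OF K(1)] K(2)] .
    then show ?thesis using antisym M(1,3)[OF K(1,3)] K(1) by blast
  qed
  define v' where "v' K = Dm (M K) K (u (M K))" for K
  have v'W: "v' K = u K" if "K \<in> W" for K
    using uu[OF that that refl[OF W(1)[OF that]]] by (simp add: v'_def MWid that)
  have WV': "K \<in> V'" if "K \<in> W" for K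
    using that W(1)[OF that] refl by (auto simp: V'_def)
  have "lower_ideal P le V'"
    unfolding lower_ideal_def
  proof (intro conjI ballI impI)
    show "V' \<subseteq> P" by (auto simp: V'_def)
    fix K L assume K: "K \<in> P" "L \<in> V'" "le K L"
    then obtain L' where L': "L \<in> P" "L' \<in> W" "le L L'" by (auto simp: V'_def)
    have "le K L'" by (rule trans[OF K(3) L'(3) K(1) L'(1) W(1)[OF L'(2)]])
    then show "K \<in> V'" using K L' by (auto simp: V'_def)
  qed
  moreover have "compatible le D Dm V' v'"
  proof (rule compatibleI)
    fix K assume K: "K \<in> V'"
    note KJ = V'J[OF K]
    show "v' K \<in> D K"
      unfolding v'_def
      using diagramD(2)[OF D KJ(1) M(1)[OF KJ(1,2)] M(3)[OF KJ(1,2)] uD[OF MW[OF K]]] .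
    fix L assume L: "L \<in> V'" "le K L"
    note LJ = V'J[OF L(1)]
    note mK = M[OF KJ(1,2)] and mL = M[OF LJ(1,2)]
    have KmL: "le K (M L)" by (rule trans[OF L(2) mL(3) KJ(1) LJ(1) mL(1)])
    have MM: "le (M K) (M L)" using mK(5)[OF mL(1,2) KmL mL(4)] .
    note uL = uD[OF MW[OF L(1)]]
    \<comment> \<open>Both values are images of the value at \<open>M L\<close>, because
      \<open>M K\<close> is below \<open>M L\<close>.\<close>
    have "Dm L K (v' L) = Dm (M L) K (u (M L))"
      unfolding v'_def by (rule diagramD(4)[OF D KJ(1) LJ(1) mL(1) L(2) mL(3) uL])
    also have "\<dots> = Dm (M K) K (Dm (M L) (M K) (u (M L)))"
      by (rule diagramD(4)[OF D KJ(1) mK(1) mL(1) mK(3) MM uL, symmetric])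
    also have "\<dots> = v' K" unfolding v'_def uu[OF MW[OF K] MW[OF L(1)] MM] ..
    finally show "Dm L K (v' L) = v' K" .
  qed
  ultimately obtain d where d: "d \<in> D J" "\<And>K. K \<in> V' \<Longrightarrow> Dm J K d = v' K"
    using loc_flabbyD[OF fl JP, of V' v'] V'J by blast
  have IW: "I \<in> W" by (simp add: W_def)
  have "Dm J I d = x" using d(2)[OF WV'[OF IW]] v'W[OF IW] by (simp add: u_def)
  moreover have "Dm J K d = v K" if "K \<in> V" for K
  proof -
    have "K \<in> W" using that by (simp add: W_def)
    then show ?thesis using d(2)[OF WV'] v'W VL[OF that] by (simp add: u_def)
  qed
  ultimately show "\<exists>d\<in>link_diagram D Dm I x J. \<forall>K\<in>V. Dm J K d = v K"
    using d(1) by (auto simp: link_diagram_def)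
qed

section \<open>Thinning out a diagram and folding back\<close>

definition remove_diagram ::
  "('a \<Rightarrow> 'a \<Rightarrow> bool) \<Rightarrow> ('a \<Rightarrow> 'b set) \<Rightarrow> ('a \<Rightarrow> 'a \<Rightarrow> 'b \<Rightarrow> 'b) \<Rightarrow> 'a \<Rightarrow> 'b \<Rightarrow> 'a \<Rightarrow> 'b set" where
  "remove_diagram le D Dm I x J = {e \<in> D J. \<not> (le I J \<and> Dm J I e = x)}"

lemma inflation_remove:
  assumes "I \<in> P"
  shows "inflation P (remove_diagram le D Dm I x) =
    {y \<in> inflation P D. \<not> inflation_le le Dm (I,x) y}"
  by (auto simp: remove_diagram_def inflation_le_def)

lemma diagram_remove:
  assumes P: "finite_poset P le" and D: "diagram P le D Dm" and I: "I \<in> P"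
  shows "diagram P le (remove_diagram le D Dm I x) Dm"
proof (rule diagramI)
  fix J K e assume J: "J \<in> P" "K \<in> P" "le J K" "e \<in> remove_diagram le D Dm I x K"
  have "\<not> (le I J \<and> Dm J I (Dm K J e) = x)"
    using finite_poset_trans[OF P, of I J K] diagramD(4)[OF D, of I J K e] I J
    by (auto simp: remove_diagram_def)
  then show "Dm K J e \<in> remove_diagram le D Dm I x J"
    using J diagramD(2)[OF D] by (simp add: remove_diagram_def)
qed (use diagramD[OF D] in \<open>auto simp: remove_diagram_def\<close>)

text \<open>An extension avoids \<open>x'\<close> by itself if \<open>I\<close> lies in
  \<open>V\<close>, where the value is not \<open>x'\<close>, or if \<open>I\<close> is not below
  \<open>J\<close>. Otherwise the value at \<open>I\<close> is still free and is prescribed to be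
  \<open>x\<close>; this agrees with the data below \<open>I\<close>, where values are
  unique.\<close>

lemma loc_flabby_remove:
  assumes P: "finite_poset P le" and D: "diagram P le D Dm" and fl: "loc_flabby P le D Dm"
    and I: "I \<in> P" and x: "x \<in> D I" "x' \<in> D I" "x \<noteq> x'"
    and sing: "\<And>K a b. K \<in> P \<Longrightarrow> le K I \<Longrightarrow> K \<noteq> I \<Longrightarrow> a \<in> D K \<Longrightarrow> b \<in> D K \<Longrightarrow> a = b"
  shows "loc_flabby P le (remove_diagram le D Dm I x') Dm"
  unfolding loc_flabby_def
proof (intro ballI allI impI)
  let ?D = "remove_diagram le D Dm I x'"
  fix J V v
  assume J: "J \<in> P" and V: "lower_ideal P le V" and VJ: "\<forall>K\<in>V. le K J \<and> K \<noteq> J"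
    and v: "compatible le ?D Dm V v"
  note trans = finite_poset_trans[OF P] and refl = finite_poset_refl[OF P]
    and antisym = finite_poset_antisym[OF P]
  have VP: "K \<in> P" if "K \<in> V" for K using V that by (auto simp: lower_ideal_def)
  have Vdown: "K \<in> V" if "K \<in> P" "L \<in> V" "le K L" for K L using V that by (auto simp: lower_ideal_def)
  have vD: "v K \<in> ?D K" "v K \<in> D K" if "K \<in> V" for K
    using v that by (auto simp: compatible_def remove_diagram_def)
  have vv: "Dm L K (v L) = v K" if "K \<in> V" "L \<in> V" "le K L" for K L
    using v that by (auto simp: compatible_def)
  have cv: "compatible le D Dm V v" by (rule compatibleI) (use vD vv in auto)
  have ext: "\<exists>d\<in>D J. \<forall>K\<in>V. Dm J K d = v K"
    using VJ by (intro loc_flabbyD[OF fl J V _ cv]) auto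
  have vI: "v I \<noteq> x'" if "I \<in> V"
    using vD[OF that] refl[OF I] diagramD(3)[OF D I] by (auto simp: remove_diagram_def)
  show "\<exists>d\<in>?D J. \<forall>K\<in>V. Dm J K d = v K"
  proof (cases "I \<in> V \<or> \<not> le I J")
    case True
    obtain d where "d \<in> D J" "\<forall>K\<in>V. Dm J K d = v K" using ext by blast
    then show ?thesis using True vI by (intro bexI[of _ d]) (auto simp: remove_diagram_def)
  next
    case False
    then have IV: "I \<notin> V" and IJ: "le I J" by auto
    have vI': "Dm I K x = v K" if "K \<in> V" "le K I" for K
      using sing[OF VP[OF that(1)] that(2)] diagramD(2)[OF D VP[OF that(1)] I that(2) x(1)]
        vD(2)[OF that(1)] IV that(1) by blast
    show ?thesis
    proof (cases "J = I")
      case True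
      then have "x \<in> ?D J" using x diagramD(3)[OF D I x(1)] by (simp add: remove_diagram_def)
      then show ?thesis using True VJ vI' by blast
    next
      case False
      define V2 where "V2 = V \<union> {K\<in>P. le K I}"
      define v2 where "v2 K = (if le K I then Dm I K x else v K)" for K
      have "lower_ideal P le V2"
        unfolding lower_ideal_def V2_def using VP Vdown trans[of _ _ I] I by blast
      moreover have "le K J \<and> K \<noteq> J" if "K \<in> V2" for K
        using that VJ trans[of K I J] antisym[of I J] I J IJ False unfolding V2_def by blast
      moreover have "compatible le D Dm V2 v2"
      proof (rule compatibleI)
        show "v2 K \<in> D K" if "K \<in> V2" for K
          using that vD(2)[of K] VP[of K] diagramD(2)[OF D _ I _ x(1), of K] by (auto simp: V2_def v2_def)
        fix K L assume KL: "K \<in> V2" "L \<in> V2" "le K L"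
        have KP: "K \<in> P" and LP: "L \<in> P" using KL VP by (auto simp: V2_def)
        show "Dm L K (v2 L) = v2 K"
        proof (cases "le L I")
          case True
          then have "le K I" using trans[OF KL(3) True KP LP I] by blast
          then show ?thesis
            using diagramD(4)[OF D KP LP I KL(3) True x(1)] True by (simp add: v2_def)
        next
          case False
          then have "L \<in> V" using KL by (auto simp: V2_def)
          moreover have "K \<in> V" by (rule Vdown[OF KP \<open>L \<in> V\<close> KL(3)])
          ultimately show ?thesis using False vv[of K L] vI'[of K] KL(3) by (auto simp: v2_def)
        qed
      qed
      ultimately obtain d where d: "d \<in> D J" "\<And>K. K \<in> V2 \<Longrightarrow> Dm J K d = v2 K"
        using loc_flabbyD[OF fl J, of V2 v2] by blast
      have "Dm J I d = x" using d(2)[of I] I refl[OF I] diagramD(3)[OF D I x(1)] by (simp add: V2_def v2_def)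
      then have "d \<in> ?D J" using d(1) x(3) by (simp add: remove_diagram_def)
      moreover have "Dm J K d = v K" if "K \<in> V" for K
        using d(2)[of K] vI'[OF that] that by (auto simp: V2_def v2_def)
      ultimately show ?thesis by blast
    qed
  qed
qed

text \<open>The retraction in \<open>fold_exists\<close> below is a section of such a pulled back diagram.\<close>

lemma loc_flabby_pullback:
  assumes P: "finite_poset P le" and D: "diagram P le D Dm"
    and E: "diagram P le E Dm" and fl: "loc_flabby P le E Dm"
  shows "loc_flabby (inflation P D) (inflation_le le Dm) (\<lambda>y. E (fst y)) (\<lambda>z y. Dm (fst z) (fst y))"
  unfolding loc_flabby_def
proof (intro ballI allI impI)
  let ?Q = "inflation P D" and ?le = "inflation_le le Dm"
  fix z V v
  assume z: "z \<in> ?Q" and V: "lower_ideal ?Q ?le V" and Vz: "\<forall>y\<in>V. ?le y z \<and> y \<noteq> z"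
    and v: "compatible ?le (\<lambda>y. E (fst y)) (\<lambda>z y. Dm (fst z) (fst y)) V v"
  define J e where "J = fst z" and "e = snd z"
  have J: "J \<in> P" "e \<in> D J" and zJ: "z = (J,e)" using z by (auto simp: J_def e_def)
  have VQ: "y \<in> ?Q" "?le y z" "y \<noteq> z" if "y \<in> V" for y using V Vz that by (auto simp: lower_ideal_def)
  have Vdown: "y \<in> V" if "y \<in> ?Q" "w \<in> V" "?le y w" for y w using V that by (auto simp: lower_ideal_def)
  have y_eq: "y = (fst y, Dm J (fst y) e)" if "y \<in> V" for y
    using VQ(2)[OF that] by (simp add: inflation_le_def zJ prod_eq_iff)
  \<comment> \<open>All of \<open>V\<close> lies below \<open>z\<close>, so \<open>V\<close>
    projects bijectively to an ideal of \<open>P\<close>, and the problem becomes the extension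
    problem for \<open>E\<close> at \<open>J\<close>.\<close>
  define U where "U = fst ` V"
  define u where "u K = v (K, Dm J K e)" for K
  have uv: "u (fst y) = v y" if "y \<in> V" for y using y_eq[OF that] by (simp add: u_def)
  have U: "lower_ideal P le U"
    unfolding lower_ideal_def
  proof (intro conjI ballI impI)
    show "U \<subseteq> P" using VQ(1) by (auto simp: U_def)
    fix K L assume K: "K \<in> P" "L \<in> U" "le K L"
    then obtain y where y: "y \<in> V" "L = fst y" by (auto simp: U_def)
    have "(K, Dm L K (snd y)) \<in> ?Q" "?le (K, Dm L K (snd y)) y"
      using K y VQ(1)[OF y(1)] diagramD(2)[OF D] by (simp_all add: inflation_le_def)
    then have "(K, Dm L K (snd y)) \<in> V" using Vdown y(1) by blast
    then show "K \<in> U" unfolding U_def by force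
  qed
  have UJ: "le K J \<and> K \<noteq> J" if K: "K \<in> U" for K
  proof -
    obtain y where y: "y \<in> V" "K = fst y" using K by (auto simp: U_def)
    have "le K J" using VQ(2)[OF y(1)] y(2) by (simp add: inflation_le_def zJ)
    moreover have "K \<noteq> J"
    proof
      assume "K = J"
      then have "y = z" using y_eq[OF y(1)] y(2) diagramD(3)[OF D J] zJ by simp
      then show False using VQ(3)[OF y(1)] by simp
    qed
    ultimately show ?thesis ..
  qed
  have "compatible le E Dm U u"
  proof (rule compatibleI)
    show "u K \<in> E K" if "K \<in> U" for K using that v uv by (auto simp: U_def compatible_def)
    fix K L assume KL: "K \<in> U" "L \<in> U" "le K L"
    obtain y where y: "y \<in> V" "K = fst y" using KL by (auto simp: U_def)
    obtain w where w: "w \<in> V" "L = fst w" using KL by (auto simp: U_def)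
    have "?le y w"
      using inflation_le_below[OF D J, of y w] VQ[OF y(1)] VQ[OF w(1)] KL(3) y w by (simp add: zJ)
    then show "Dm L K (u L) = u K"
      using v y w uv[OF y(1)] uv[OF w(1)] by (auto simp: compatible_def)
  qed
  then obtain d where d: "d \<in> E J" "\<forall>K\<in>U. Dm J K d = u K"
    using loc_flabbyD[OF fl J(1) U UJ] by blast
  have "Dm J (fst y) d = v y" if "y \<in> V" for y using d(2) uv[OF that] that by (auto simp: U_def)
  then show "\<exists>d\<in>E (fst z). \<forall>y\<in>V. Dm (fst z) (fst y) d = v y"
    unfolding zJ fst_conv using d(1) by blast
qed

text \<open>Prescribe the identity on the elements not above \<open>(I,x')\<close> and the value
  \<open>x\<close> at \<open>(I,x')\<close>, then extend by flabbiness to the rest. Compatibility of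
  the section \<open>w\<close> is what makes \<open>y \<mapsto> (fst y, w y)\<close>
  monotone.\<close>

lemma fold_exists:
  assumes P: "finite_poset P le" and D: "diagram P le D Dm"
    and fl: "loc_flabby P le (remove_diagram le D Dm I x') Dm"
    and I: "I \<in> P" and x: "x \<in> D I" "x' \<in> D I" "x \<noteq> x'"
    and same: "\<And>K. K \<in> P \<Longrightarrow> le K I \<Longrightarrow> K \<noteq> I \<Longrightarrow> Dm I K x = Dm I K x'"
  obtains g where
    "\<And>y. y \<in> inflation P D \<Longrightarrow> g y \<in> inflation P (remove_diagram le D Dm I x')"
    "\<And>y z. y \<in> inflation P D \<Longrightarrow> z \<in> inflation P D \<Longrightarrow> inflation_le le Dm y z \<Longrightarrow>
       inflation_le le Dm (g y) (g z)"
    "\<And>y. y \<in> inflation P (remove_diagram le D Dm I x') \<Longrightarrow> g y = y"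
    "g (I,x') = (I,x)"
proof -
  let ?Q = "inflation P D" and ?le = "inflation_le le Dm" and ?D = "remove_diagram le D Dm I x'"
  let ?E = "\<lambda>y :: 'a \<times> 'b. ?D (fst y)" and ?Em = "\<lambda>z y :: 'a \<times> 'b. Dm (fst z) (fst y)"
  note Q = inflation_finite_poset[OF P D] and D' = diagram_remove[OF P D I, of x']
  note R = inflation_remove[OF I, of le D Dm x']
  let ?U = "insert (I,x') {y\<in>?Q. \<not> ?le (I,x') y}"
  let ?v = "\<lambda>y. if y = (I,x') then x else snd y"
  have x'Q: "(I,x') \<in> ?Q" using I x by simp
  have ideal: "lower_ideal ?Q ?le ?U"
    unfolding lower_ideal_def
  proof (intro conjI ballI impI)
    show "?U \<subseteq> ?Q" using x'Q by blast
    fix y z assume y: "y \<in> ?Q" "z \<in> ?U" "?le y z"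
    show "y \<in> ?U"
    proof (cases "?le (I,x') y")
      case True
      have zQ: "z \<in> ?Q" using y(2) x'Q by blast
      have "?le (I,x') z" by (rule finite_poset_trans[OF Q True y(3) x'Q y(1) zQ])
      then have "z = (I,x')" using y(2) by blast
      then have "y = (I,x')" using finite_poset_antisym[OF Q _ True y(1) x'Q] y(3) by blast
      then show ?thesis by blast
    next
      case False
      then show ?thesis using y(1) by blast
    qed
  qed
  have comp: "compatible ?le ?E ?Em ?U ?v"
  proof (rule compatibleI)
    fix y assume y: "y \<in> ?U"
    show "?v y \<in> ?E y"
    proof (cases "y = (I,x')")
      case True
      then show ?thesis using x diagramD(3)[OF D I x(1)] by (simp add: remove_diagram_def)
    next
      case False
      then have "y \<in> inflation P ?D" using y unfolding R by blast
      then show ?thesis using False by simp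
    qed
    fix z assume z: "z \<in> ?U" "?le y z"
    have yQ: "y \<in> ?Q" using y x'Q by blast
    show "?Em z y (?v z) = ?v y"
    proof (cases "z = (I,x')")
      case True
      show ?thesis
      proof (cases "y = (I,x')")
        case y': True
        then show ?thesis using True diagramD(3)[OF D I x(1)] by simp
      next
        case False
        have le: "le (fst y) I" "Dm I (fst y) x' = snd y" using z(2) True by (simp_all add: inflation_le_def)
        have "fst y \<noteq> I"
          using le(2) diagramD(3)[OF D I x(2)] False by (metis prod.collapse)
        then have "Dm I (fst y) x = snd y" using same[of "fst y"] le yQ by simp
        then show ?thesis using True False by simp
      qed
    next
      case False
      then have "y \<noteq> (I,x')" using z by blast
      then show ?thesis using False z(2) by (simp add: inflation_le_def)
    qed
  qed
  have idn: "?Em y y d = d" if "y \<in> ?Q" "d \<in> ?E y" for y d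
    using diagramD(3)[OF D', of "fst y" d] that by simp
  obtain w where w: "compatible ?le ?E ?Em ?Q w" and wU: "\<forall>y\<in>?U. w y = ?v y"
    using section_extends[OF Q loc_flabby_pullback[OF P D D' fl] idn ideal comp] by blast
  show thesis
  proof (rule that[of "\<lambda>y. (fst y, w y)"])
    show "(fst y, w y) \<in> inflation P ?D" if "y \<in> ?Q" for y
      using w that by (simp add: compatible_def)
    show "?le (fst y, w y) (fst z, w z)" if "y \<in> ?Q" "z \<in> ?Q" "?le y z" for y z
    proof -
      have "Dm (fst z) (fst y) (w z) = w y" using w that unfolding compatible_def by blast
      then show ?thesis using that(3) by (simp add: inflation_le_def)
    qed
    show "(fst y, w y) = y" if "y \<in> inflation P ?D" for y
    proof -
      have y: "y \<in> ?Q" "\<not> ?le (I,x') y" using that unfolding R by blast+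
      then have "y \<noteq> (I,x')" using finite_poset_refl[OF Q x'Q] by blast
      moreover have "w y = ?v y" using wU y by blast
      ultimately have "w y = snd y" by (simp only: if_False)
      then show ?thesis by (simp add: prod_eq_iff)
    qed
    show "(fst (I,x'), w (I,x')) = (I,x)" using wU by simp
  qed
qed

section \<open>Homotopy type of an inflation\<close>

text \<open>The homotopical conditions of \<open>htpy_CM\<close> in terms of ranks, with
  \<open>m\<close> the dimension plus one. The rank bound makes natural-number differences exact,
  and \<open>m = 0\<close> covers empty links.\<close>

definition spherical :: "'a set \<Rightarrow> ('a \<Rightarrow> 'a \<Rightarrow> bool) \<Rightarrow> ('a \<Rightarrow> nat) \<Rightarrow> nat \<Rightarrow> bool" where
  "spherical P le rk m \<longleftrightarrow> (\<forall>I\<in>P. rk I \<le> m) \<and>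
     htpy_wedge_of_spheres (realization P le) (int m - 1) \<and>
     (\<forall>I\<in>P. htpy_wedge_of_spheres (realization (upper_link P le I) le) (int m - 1 - int (rk I)))"

lemma sphericalD:
  assumes "spherical P le rk m"
  shows "I \<in> P \<Longrightarrow> rk I \<le> m"
    and "htpy_wedge_of_spheres (realization P le) (int m - 1)"
    and "I \<in> P \<Longrightarrow> htpy_wedge_of_spheres (realization (upper_link P le I) le) (int m - 1 - int (rk I))"
  using assms unfolding spherical_def by blast+

lemma spherical_link:
  assumes bc: "bool_cones P le rk" and sp: "spherical P le rk m" and I: "I \<in> P"
  shows "spherical (upper_link P le I) le (\<lambda>J. rk J - rk I) (m - rk I)"
  unfolding spherical_def
proof (intro conjI ballI)
  have m: "rk I \<le> m" by (rule sphericalD(1)[OF sp I])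
  show "htpy_wedge_of_spheres (realization (upper_link P le I) le) (int (m - rk I) - 1)"
    using sphericalD(3)[OF sp I] m by (simp add: of_nat_diff algebra_simps)
  fix J assume J: "J \<in> upper_link P le I"
  then have JP: "J \<in> P" "le I J" "J \<noteq> I" by (auto simp: upper_link_def)
  show "rk J - rk I \<le> m - rk I" using sphericalD(1)[OF sp JP(1)] by simp
  note P = bool_cones_finite_poset[OF bc]
  have 1: "upper_link (upper_link P le I) le J = upper_link P le J"
    using finite_poset_trans[OF P JP(2) _ I JP(1)] finite_poset_antisym[OF P JP(2) _ I JP(1)]
    by (auto simp: upper_link_def)
  have 2: "int (m - rk I) - 1 - int (rk J - rk I) = int m - 1 - int (rk J)"
    using bool_cones_upper_link(2)[OF bc I J] m by (simp add: of_nat_diff)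
  show "htpy_wedge_of_spheres (realization (upper_link (upper_link P le I) le J) le)
      (int (m - rk I) - 1 - int (rk J - rk I))"
    unfolding 1 2 by (rule sphericalD(3)[OF sp JP(1)])
qed

lemma htpy_wedge_transfer:
  assumes "realization_set A le homotopy_eqv realization_set B le'"
    and "htpy_wedge_of_spheres (realization A le) (int d)"
  shows "htpy_wedge_of_spheres (realization B le') (int d)"
proof -
  obtain k where "realization_set A le homotopy_eqv wedge_of_spheres k d"
    using assms(2) htpy_wedge_nonneg by blast
  then have "realization_set B le' homotopy_eqv wedge_of_spheres k d"
    by (rule homotopy_eqv_trans[OF assms(1)[unfolded homotopy_equivalent_space_sym[of "top_of_set (realization_set A le)"]]])
  then show ?thesis using htpy_wedge_nonneg by blast
qed

lemma loc_flabby_nonempty: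
  assumes "loc_flabby P le D Dm" "J \<in> P"
  shows "D J \<noteq> {}"
  using loc_flabbyD[OF assms, of "{}" "\<lambda>_. undefined"] by (auto simp: lower_ideal_def compatible_def)

text \<open>The link of \<open>z\<close> is the join of the boundary of a simplex with the upper link.\<close>

lemma link_htpy_wedge:
  assumes bc: "bool_cones Q le rk" and z: "z \<in> Q"
    and U: "htpy_wedge_of_spheres (realization (upper_link Q le z) le) e" "-1 \<le> e"
  shows "htpy_wedge_of_spheres (realization (link_in Q le z) le) (e + int (rk z) - 1)"
proof -
  note P = bool_cones_finite_poset[OF bc]
  note antisym = finite_poset_antisym[OF P] and trans = finite_poset_trans[OF P]
  have zz: "le z z" by (rule finite_poset_refl[OF P z])
  let ?B = "{b\<in>Q. le b z \<and> b \<noteq> z}" and ?U = "upper_link Q le z"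
  obtain f :: "'a \<Rightarrow> nat set" and T where T: "finite T" "T \<noteq> {}" "card T = rk z"
    and f1: "\<And>x. x \<in> Q \<Longrightarrow> le x z \<Longrightarrow> f x \<noteq> {} \<and> f x \<subseteq> T"
    and f2: "\<And>S. S \<noteq> {} \<Longrightarrow> S \<subseteq> T \<Longrightarrow> \<exists>x\<in>Q. le x z \<and> f x = S"
    and f3: "\<And>x y. x \<in> Q \<Longrightarrow> le x z \<Longrightarrow> y \<in> Q \<Longrightarrow> le y z \<Longrightarrow> le x y \<longleftrightarrow> f x \<subseteq> f y"
    and f4: "\<And>x y. x \<in> Q \<Longrightarrow> le x z \<Longrightarrow> y \<in> Q \<Longrightarrow> le y z \<Longrightarrow> f x = f y \<Longrightarrow> x = y"
    and fz: "f z = T"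
    by (rule bool_conesE[OF bc z]) (rule that; assumption)
  have bij: "bij_betw f ?B {S. S \<noteq> {} \<and> S \<subset> T}"
    unfolding bij_betw_def
  proof
    show "inj_on f ?B" by (rule inj_onI) (use f4 in blast)
    show "f ` ?B = {S. S \<noteq> {} \<and> S \<subset> T}"
    proof
      show "f ` ?B \<subseteq> {S. S \<noteq> {} \<and> S \<subset> T}"
      proof clarify
        fix b assume b: "b \<in> Q" "le b z" "b \<noteq> z"
        then have "f b \<noteq> T" using f4[OF b(1,2) z zz] fz by blast
        then show "f b \<noteq> {} \<and> f b \<subset> T" using f1[OF b(1,2)] by blast
      qed
      show "{S. S \<noteq> {} \<and> S \<subset> T} \<subseteq> f ` ?B"
      proof
        fix S assume S: "S \<in> {S. S \<noteq> {} \<and> S \<subset> T}"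
        then obtain b where b: "b \<in> Q" "le b z" "f b = S" using f2[of S] by blast
        then have "b \<noteq> z" using S fz by blast
        then show "S \<in> f ` ?B" using b by blast
      qed
    qed
  qed
  have split: "link_in Q le z = ?B \<union> ?U"
    by (auto simp: link_in_def upper_link_def)
  have pos: "finite_poset (link_in Q le z) le"
    by (rule finite_poset_subset[OF P]) (auto simp: link_in_def)
  have dis: "?B \<inter> ?U = {}" using antisym[of _ z] z by (auto simp: upper_link_def)
  have BU: "le b u" if "b \<in> ?B" "u \<in> ?U" for b u
    using that trans[of b z u] z by (auto simp: upper_link_def)
  have fB: "le a b \<longleftrightarrow> f a \<subseteq> f b" if "a \<in> ?B" "b \<in> ?B" for a b using f3 that by blast
  show ?thesis
    unfolding T(3)[symmetric] by (rule join_boundary[OF T(1,2) pos split dis BU bij fB U])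
qed

text \<open>The diagram is thinned out by removing everything above an element \<open>(I,x')\<close> with a twin \<open>(I,x)\<close>.
  Adding the removed elements back only changes the homotopy type in the last step, where \<open>(I,x')\<close>
  itself is added: a retraction folding \<open>(I,x')\<close> onto \<open>(I,x)\<close> shows that its link is null-homotopic.\<close>

lemma inflation_htpy_wedge:
  fixes D :: "'a \<Rightarrow> 'b set"
  assumes "bool_cones P le rk" "spherical P le rk m" "diagram P le D Dm" "loc_flabby P le D Dm"
  shows "htpy_wedge_of_spheres (realization (inflation P D) (inflation_le le Dm)) (int m - 1)"
  using assms
proof (induction m arbitrary: P D rk rule: less_induct)
  case (less m)
  note outer = less.IH
  from less.prems show ?case
  proof (induction "card (inflation P D)" arbitrary: D rule: less_induct)
    case (less D)
    note bc = less.prems(1) and sp = less.prems(2) and D = less.prems(3) and fl = less.prems(4)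
    note P = bool_cones_finite_poset[OF bc]
    let ?Q = "inflation P D" and ?le = "inflation_le le Dm"
    note bcQ = bool_cones_inflation[OF bc D] and PQ = inflation_finite_poset[OF P D]
    note finQ = finite_poset_finite[OF PQ] and reflQ = finite_poset_refl[OF PQ]
    note Dne = loc_flabby_nonempty[OF fl]
    \<comment> \<open>\<open>attach_vertex\<close> produces spheres of dimension at least 1, so the
      empty poset and the antichains are treated separately.\<close>
    consider "m = 0" | "m = 1" | d where "m = Suc (Suc d)"
      by (metis One_nat_def not0_implies_Suc)
    then show ?case
    proof cases
      case 1
      have "P = {}" using sphericalD(1)[OF sp] bool_cones_rank_pos[OF bc] 1 by fastforce
      then have "?Q = {}" by auto
      then show ?thesis using 1 htpy_wedge_neg[of "-1" ?Q ?le] by simp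
    next
      case 2
      have "P \<noteq> {}" using htpy_wedge_nonempty(2)[OF sphericalD(2)[OF sp]] 2 by simp
      then obtain J e where "J \<in> P" "e \<in> D J" using Dne by blast
      then have "(J,e) \<in> ?Q" by simp
      then have ne: "?Q \<noteq> {}" by blast
      have anti: "u = v" if uv: "u \<in> ?Q" "v \<in> ?Q" "?le u v" for u v
      proof (rule ccontr)
        assume "u \<noteq> v"
        then have v: "v \<in> upper_link ?Q ?le u" using uv by (auto simp: upper_link_def)
        have "rk (fst u) < rk (fst v)" by (rule bool_cones_upper_link(2)[OF bcQ uv(1) v])
        moreover have "rk (fst v) \<le> 1" using sphericalD(1)[OF sp, of "fst v"] uv 2 by simp
        moreover have "0 < rk (fst u)" using bool_cones_rank_pos[OF bc, of "fst u"] uv by simp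
        ultimately show False by simp
      qed
      have "htpy_wedge_of_spheres (realization ?Q ?le) 0"
        by (rule antichain_htpy_wedge[OF finQ ne]) (use reflQ anti in blast)+
      then show ?thesis using 2 by simp
    next
      case (3 d)
      have m: "int m - 1 = int (Suc d)" using 3 by simp
      show ?thesis
      proof (cases "\<forall>J\<in>P. \<forall>a\<in>D J. \<forall>b\<in>D J. a = b")
        case True
        define f where "f J = (J, SOME e. e \<in> D J)" for J
        have fD: "snd (f J) \<in> D J" if "J \<in> P" for J
          using someI_ex[of "\<lambda>e. e \<in> D J"] Dne[OF that] by (auto simp: f_def)
        have "bij_betw f P ?Q"
          unfolding bij_betw_def
        proof
          show "inj_on f P" by (auto simp: inj_on_def f_def)
          show "f ` P = ?Q"
          proof
            show "f ` P \<subseteq> ?Q" using fD by (auto simp: f_def)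
            show "?Q \<subseteq> f ` P"
            proof
              fix y assume y: "y \<in> ?Q"
              then have "fst y \<in> P" "snd y \<in> D (fst y)" by simp_all
              then have "snd y = snd (f (fst y))" using True fD[of "fst y"] by blast
              then have "y = f (fst y)" by (simp add: f_def prod_eq_iff)
              then show "y \<in> f ` P" using y by auto
            qed
          qed
        qed
        moreover have "le u v \<longleftrightarrow> ?le (f u) (f v)" if uv: "u \<in> P" "v \<in> P" for u v
        proof -
          have "Dm v u (snd (f v)) = snd (f u)" if "le u v"
            using True uv diagramD(2)[OF D uv that fD[OF uv(2)]] fD[OF uv(1)] by blast
          then show ?thesis by (auto simp: inflation_le_def f_def)
        qed
        ultimately have "realization_set P le homotopy_eqv realization_set ?Q ?le"
          by (rule realization_iso_homotopy_eqv) (auto intro: finite_poset_finite[OF P])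
        then show ?thesis using htpy_wedge_transfer sphericalD(2)[OF sp] unfolding m by blast
      next
        case False
        let ?N = "{J\<in>P. \<exists>a\<in>D J. \<exists>b\<in>D J. a \<noteq> b}"
        have N: "?N \<subseteq> P" "?N \<noteq> {}" using False by auto
        obtain I where IN: "I \<in> ?N" and Imin: "\<And>K. K \<in> ?N \<Longrightarrow> le K I \<Longrightarrow> K = I"
          by (rule finite_poset_minimal[OF P N]) (rule that; assumption)
        obtain x x' where I: "I \<in> P" and x: "x \<in> D I" "x' \<in> D I" "x \<noteq> x'" using IN by blast
        have sing: "a = b" if "K \<in> P" "le K I" "K \<noteq> I" "a \<in> D K" "b \<in> D K" for K a b
          using Imin[of K] that by blast
        have same: "Dm I K x = Dm I K x'" if "K \<in> P" "le K I" "K \<noteq> I" for K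
          using sing[OF that diagramD(2)[OF D that(1) I that(2) x(1)] diagramD(2)[OF D that(1) I that(2) x(2)]] .
        let ?D = "remove_diagram le D Dm I x'" and ?z = "(I,x')"
        let ?R = "inflation P ?D" and ?Q' = "?Q - {?z}" and ?L = "link_in ?Q ?le ?z"
        note D' = diagram_remove[OF P D I, of x']
        have fl': "loc_flabby P le ?D Dm"
          by (rule loc_flabby_remove[OF P D fl I x]) (rule sing; assumption)
        note R = inflation_remove[OF I, of le D Dm x']
        have zQ: "?z \<in> ?Q" using I x by simp
        have zz: "?le ?z ?z" by (rule reflQ[OF zQ])
        have zR: "?z \<notin> ?R" unfolding R using zz by blast
        have RQ: "?R \<subseteq> ?Q" unfolding R by blast
        have RQ': "?R \<subseteq> ?Q'" using RQ zR by blast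
        have LQ': "?L \<subseteq> ?Q'" by (auto simp: link_in_def)
        have finQ': "finite ?Q'" and finR: "finite ?R" using finQ RQ finite_subset by auto
        have "card ?R < card ?Q"
          by (rule psubset_card_mono[OF finQ]) (use RQ zR zQ in blast)
        then have hR: "htpy_wedge_of_spheres (realization ?R ?le) (int (Suc d))"
          using less.hyps[OF _ bc sp D' fl'] unfolding m by blast
        let ?S = "{y\<in>?Q. ?le ?z y \<and> y \<noteq> ?z}"
        have "def_retract (realization_set {y\<in>?Q. \<not> ?le ?z y} ?le)
            (realization_set ({y\<in>?Q. \<not> ?le ?z y} \<union> ?S) ?le)"
        proof (rule upper_part_def_retract[OF bcQ zQ])
          fix u w assume u: "u \<in> ?S" "w \<in> ?Q" "?le u w"
          then have uQ: "u \<in> ?Q" "?le ?z u" "u \<noteq> ?z" by blast+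
          have "?le ?z w" by (rule finite_poset_trans[OF PQ uQ(2) u(3) zQ uQ(1) u(2)])
          moreover have "w \<noteq> ?z" using finite_poset_antisym[OF PQ uQ(2) _ zQ uQ(1)] uQ(3) u(3) by blast
          ultimately show "w \<in> ?S" using u(2) by blast
        qed blast
        moreover have "{y\<in>?Q. \<not> ?le ?z y} \<union> ?S = ?Q'" using zz by blast
        ultimately have dr: "def_retract (realization_set ?R ?le) (realization_set ?Q' ?le)"
          unfolding R by simp
        have hQ': "htpy_wedge_of_spheres (realization ?Q' ?le) (int (Suc d))"
          by (rule htpy_wedge_transfer[OF def_retract_homotopy_eqv[OF dr] hR])

        have rkI: "0 < rk I" "rk I \<le> m" using bool_cones_rank_pos[OF bc I] sphericalD(1)[OF sp I] .
        \<comment> \<open>The part above \<open>?z\<close> is an inflation over a link of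
          \<open>P\<close>. Its parameter \<open>m - rk I\<close> is smaller because
          \<open>rk I\<close> is positive, so the outer induction applies.\<close>
        have "htpy_wedge_of_spheres (realization (inflation (upper_link P le I) (link_diagram D Dm I x')) ?le)
            (int (m - rk I) - 1)"
          by (rule outer[OF _ bool_cones_upper_link(1)[OF bc I] spherical_link[OF bc sp I]
                diagram_link[OF P D I] loc_flabby_link[OF bc D fl I x(2)]]) (use rkI in simp)
        then have hU: "htpy_wedge_of_spheres (realization (upper_link ?Q ?le ?z) ?le) (int (m - rk I) - 1)"
          using upper_link_inflation[OF D I x(2)] by simp
        \<comment> \<open>The join with the boundary of a simplex raises the dimension by
          \<open>rk I\<close>, the boundary itself having dimension \<open>rk I - 2\<close>; the
          total is \<open>m - 2\<close> for every \<open>I\<close>.\<close>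
        have "int (m - rk I) - 1 + int (rk I) - 1 = int d" using rkI 3 by simp
        then have hL: "htpy_wedge_of_spheres (realization ?L ?le) (int d)"
          using link_htpy_wedge[OF bcQ zQ hU] by simp

        obtain g where gR: "\<And>y. y \<in> ?Q \<Longrightarrow> g y \<in> ?R"
          and gmono: "\<And>y z. y \<in> ?Q \<Longrightarrow> z \<in> ?Q \<Longrightarrow> ?le y z \<Longrightarrow> ?le (g y) (g z)"
          and gid: "\<And>y. y \<in> ?R \<Longrightarrow> g y = y" and gz: "g ?z = (I,x)"
          by (rule fold_exists[OF P D fl' I x]) ((rule same; assumption) | (rule that; assumption))+
        have xR: "(I,x) \<in> ?R" using gR[OF zQ] gz by simp
        have push_R: "push g ?Q' p \<in> realization_set ?R ?le" if "p \<in> realization_set ?Q' ?le" for p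
          by (rule push_in_realization[OF finQ' finR _ _ that]) (use gR gmono in auto)
        have push_fix: "push g ?Q' p = p" if p: "p \<in> realization_set ?R ?le" for p
        proof (rule push_id[OF finQ'])
          note p' = p[unfolded realization_set_iff[OF finR]]
          show "p u = 0" if "u \<notin> ?Q'" for u using p' that RQ' by blast
          show "g u = u" if "p u \<noteq> 0" for u using p' that gid by blast
        qed
        have sub: "realization_set ?L ?le \<subseteq> realization_set ?Q' ?le"
          "realization_set ?R ?le \<subseteq> realization_set ?Q' ?le"
          using realization_set_mono LQ' RQ' by blast+
        \<comment> \<open>\<open>push g ?Q'\<close> retracts the realization of \<open>?Q'\<close>
          to that of \<open>?R\<close>, a deformation retract, so it is homotopic to the
          identity.\<close>
        have "homotopic_on (realization_set ?Q' ?le) (realization_set ?Q' ?le) id (push g ?Q')"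
          by (rule def_retract_retraction_homotopic[OF dr continuous_on_push]) (use push_R push_fix in auto)
        then have h1: "homotopic_on (realization_set ?L ?le) (realization_set ?Q' ?le)
            id (push g ?Q')"
          by (rule homotopic_with_subset_left[OF _ sub(1)])
        \<comment> \<open>\<open>g\<close> sends elements comparable to \<open>?z\<close> to
          elements comparable to \<open>g ?z = (I,x)\<close>, so the image of the link can be moved
          in straight lines to the vertex \<open>(I,x)\<close>.\<close>
        have h2: "homotopic_on (realization_set ?L ?le) (realization_set ?Q' ?le)
            (push g ?Q') (\<lambda>_. vertex (I,x))"
        proof (rule realization_homotopic[OF finQ' continuous_on_push])
          show "push g ?Q' ` realization_set ?L ?le \<subseteq> realization_set ?Q' ?le" using push_R sub by blast
          have xQ: "(I,x) \<in> ?Q" using xR RQ by blast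
          have "vertex (I,x) \<in> realization_set ?R ?le"
            by (rule vertex_in[of "(I,x)" ?R ?le, OF xR reflQ[OF xQ]])
          then show "(\<lambda>_. vertex (I,x)) ` realization_set ?L ?le \<subseteq> realization_set ?Q' ?le" using sub by blast
          fix p u v assume p: "p \<in> realization_set ?L ?le" "push g ?Q' p u \<noteq> 0" "vertex (I,x) v \<noteq> 0"
          have v: "v = g ?z" using p(3) gz by (simp add: vertex_def split: if_splits)
          obtain w where w: "w \<in> ?Q'" "g w = u" "p w \<noteq> 0" using push_nonzeroD[OF p(2)] by blast
          have finL: "finite ?L" using finQ' LQ' finite_subset by blast
          have wL: "w \<in> ?L" using p(1)[unfolded realization_set_iff[OF finL]] w(3) by blast
          then have wz: "?le ?z w \<or> ?le w ?z" by (simp add: link_in_def)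
          have wQ: "w \<in> ?Q" using w(1) by blast
          show "?le u v \<or> ?le v u"
            unfolding v w(2)[symmetric] using wz gmono[OF zQ wQ] gmono[OF wQ zQ] by blast
        qed simp
        have null: "homotopic_on (realization_set ?L ?le) (realization_set ?Q' ?le)
            (\<lambda>a. a) (\<lambda>_. vertex (I,x))"
          using homotopic_with_trans[OF h1 h2] by (simp add: id_def)
        show ?thesis
          unfolding m using attach_vertex[of ?Q ?z ?le d "vertex (I,x)"] finQ zQ zz hQ' hL null by blast
      qed
    qed
  qed
qed

section \<open>Dimensions, purity and conclusion\<close>

lemma iso_to_simplex_card:
  assumes "iso_to_simplex Q le r"
  shows "finite Q" "card Q = 2 ^ r - 1"
proof -
  obtain f where f: "bij_betw f Q {S. S \<noteq> {} \<and> S \<subseteq> {..<r}}"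
    using assms unfolding iso_to_simplex_def by blast
  have eq: "{S. S \<noteq> {} \<and> S \<subseteq> {..<r}} = Pow {..<r} - {{}}" by auto
  show "finite Q" using bij_betw_finite[OF f] by (simp add: eq)
  show "card Q = 2 ^ r - 1" using bij_betw_same_card[OF f] by (simp add: eq card_Pow)
qed

text \<open>The cone has \<open>2 ^ r - 1\<close> elements, so \<open>r\<close> is unique and the
  definite description in \<open>elem_dim\<close> denotes it.\<close>

lemma elem_dim_eq:
  assumes "iso_to_simplex (lower_cone P le I) le r" "1 \<le> r"
  shows "elem_dim P le I = int r - 1"
proof -
  have sr: "s = r" if "iso_to_simplex (lower_cone P le I) le s" for s
  proof -
    have "(2::nat) ^ s - 1 = 2 ^ r - 1"
      using iso_to_simplex_card(2)[OF that] iso_to_simplex_card(2)[OF assms(1)] by simp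
    moreover have "(1::nat) \<le> 2 ^ s" "(1::nat) \<le> 2 ^ r" by simp_all
    ultimately have "(2::nat) ^ s = 2 ^ r" by linarith
    then show ?thesis by simp
  qed
  have "(THE r. r \<ge> 1 \<and> iso_to_simplex (lower_cone P le I) le r) = r"
    by (rule the_equality) (use assms sr in blast)+
  then show ?thesis by (simp add: elem_dim_def)
qed

lemma geometric_bool_cones:
  assumes "geometric_simplicial_poset P le"
  shows "bool_cones P le (\<lambda>I. nat (elem_dim P le I + 1))"
    and "I \<in> P \<Longrightarrow> 0 \<le> elem_dim P le I"
proof -
  have *: "\<exists>r\<ge>1. iso_to_simplex (lower_cone P le I) le r \<and> elem_dim P le I = int r - 1" if I: "I \<in> P" for I
  proof -
    obtain r where "r \<ge> 1" "iso_to_simplex (lower_cone P le I) le r"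
      using assms I unfolding geometric_simplicial_poset_def by blast
    then show ?thesis using elem_dim_eq[of P le I r] by blast
  qed
  show "I \<in> P \<Longrightarrow> 0 \<le> elem_dim P le I" using * by fastforce
  show "bool_cones P le (\<lambda>I. nat (elem_dim P le I + 1))"
    unfolding bool_cones_def
  proof (intro conjI ballI)
    show "finite_poset P le" using assms by (simp add: geometric_simplicial_poset_def)
    fix J assume "J \<in> P"
    then obtain r f where r: "r \<ge> 1" "elem_dim P le J = int r - 1"
      and f: "bij_betw f (lower_cone P le J) {S. S \<noteq> {} \<and> S \<subseteq> {..<r}}"
        "\<forall>x\<in>lower_cone P le J. \<forall>y\<in>lower_cone P le J. le x y \<longleftrightarrow> f x \<subseteq> f y"
      using *[of J] unfolding iso_to_simplex_def by blast
    show "\<exists>f (T :: nat set). finite T \<and> T \<noteq> {} \<and> card T = nat (elem_dim P le J + 1) \<and>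
        bij_betw f (lower_cone P le J) {S. S \<noteq> {} \<and> S \<subseteq> T} \<and>
        (\<forall>x\<in>lower_cone P le J. \<forall>y\<in>lower_cone P le J. le x y \<longleftrightarrow> f x \<subseteq> f y)"
      using r f by (intro exI[of _ f] exI[of _ "{..<r}"] conjI) (auto simp: lessThan_empty_iff)
  qed
qed

lemma inflation_iso_to_simplex:
  assumes P: "finite_poset P le" and D: "diagram P le D Dm" and J: "J \<in> P" "e \<in> D J"
    and iso: "iso_to_simplex (lower_cone P le J) le r"
  shows "iso_to_simplex (lower_cone (inflation P D) (inflation_le le Dm) (J,e)) (inflation_le le Dm) r"
proof -
  obtain f where f: "bij_betw f (lower_cone P le J) {S. S \<noteq> {} \<and> S \<subseteq> {..<r}}"
    "\<forall>x\<in>lower_cone P le J. \<forall>y\<in>lower_cone P le J. le x y \<longleftrightarrow> f x \<subseteq> f y"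
    using iso unfolding iso_to_simplex_def by blast
  show ?thesis
    unfolding iso_to_simplex_def using inflation_lower_cone_iso[OF P D J f] by blast
qed

text \<open>If \<open>J\<close> were strictly above \<open>I\<close>, the images of \<open>x\<close>
  on the faces of \<open>I\<close> would extend to an element over \<open>J\<close>, and it would
  lie above \<open>(I,x)\<close>.\<close>

lemma maximal_inflation:
  assumes P: "finite_poset P le" and D: "diagram P le D Dm" and fl: "loc_flabby P le D Dm"
    and max: "maximal_elem (inflation P D) (inflation_le le Dm) (I,x)"
  shows "maximal_elem P le I"
proof -
  have I: "I \<in> P" "x \<in> D I" using max by (simp_all add: maximal_elem_def)
  have "J = I" if J: "J \<in> P" "le I J" for J
  proof (rule ccontr)
    assume "J \<noteq> I"
    let ?V = "lower_cone P le I"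
    note trans = finite_poset_trans[OF P] and antisym = finite_poset_antisym[OF P]
    have "lower_ideal P le ?V"
      using trans[of _ _ I] I by (auto simp: lower_ideal_def lower_cone_def)
    moreover have "le K J \<and> K \<noteq> J" if "K \<in> ?V" for K
      using that trans[of K I J] antisym[of I J] I J \<open>J \<noteq> I\<close> by (auto simp: lower_cone_def)
    moreover have "compatible le D Dm ?V (\<lambda>K. Dm I K x)"
      by (rule compatibleI) (use diagramD(2,4)[OF D] I in \<open>auto simp: lower_cone_def\<close>)
    ultimately obtain e where e: "e \<in> D J" "\<forall>K\<in>?V. Dm J K e = Dm I K x"
      using loc_flabbyD[OF fl J(1), of ?V "\<lambda>K. Dm I K x"] by blast
    then have "Dm J I e = x"
      using I finite_poset_refl[OF P I(1)] diagramD(3)[OF D I] by (simp add: lower_cone_def)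
    then have "inflation_le le Dm (I,x) (J,e)" using J by (simp add: inflation_le_def)
    moreover have "(J,e) \<in> inflation P D" using J e by simp
    ultimately have "(J,e) = (I,x)" using max unfolding maximal_elem_def by blast
    then show False using \<open>J \<noteq> I\<close> by simp
  qed
  then show ?thesis using I by (simp add: maximal_elem_def)
qed

theorem theorem5p3:
  fixes P :: "'a set" and le :: "'a \<Rightarrow> 'a \<Rightarrow> bool"
    and D :: "'a \<Rightarrow> 'b set" and Dm :: "'a \<Rightarrow> 'a \<Rightarrow> 'b \<Rightarrow> 'b" and n :: nat
  assumes "geometric_simplicial_poset P le"
    and "htpy_CM P le n"
    and "diagram P le D Dm"
    and "sheaf_inhabited P le D Dm"
    and "sheaf_flabby P le D Dm"
  shows "geometric_simplicial_poset (inflation P D) (inflation_le le Dm)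
       \<and> htpy_CM (inflation P D) (inflation_le le Dm) n"
proof
  let ?Q = "inflation P D" and ?le = "inflation_le le Dm"
  define rk where "rk I = nat (elem_dim P le I + 1)" for I
  note D = assms(3)
  have P: "finite_poset P le" using assms(1) by (simp add: geometric_simplicial_poset_def)
  have bc: "bool_cones P le rk"
    using geometric_bool_cones(1)[OF assms(1)] unfolding rk_def[abs_def] .
  have rk: "int (rk I) = elem_dim P le I + 1" if "I \<in> P" for I
    using geometric_bool_cones(2)[OF assms(1) that] by (simp add: rk_def)
  have fl: "loc_flabby P le D Dm" by (rule flabby_imp_loc_flabby[OF P D assms(4,5)])
  note Dne = loc_flabby_nonempty[OF fl]
  have iso: "\<exists>r\<ge>1. iso_to_simplex (lower_cone P le I) le r" if "I \<in> P" for I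
    using assms(1) that unfolding geometric_simplicial_poset_def by blast
  have isoQ: "\<exists>r\<ge>1. iso_to_simplex (lower_cone ?Q ?le y) ?le r \<and> elem_dim ?Q ?le y = elem_dim P le (fst y)"
    if "y \<in> ?Q" for y
  proof -
    have y: "fst y \<in> P" "snd y \<in> D (fst y)" using that by simp_all
    obtain r where r: "r \<ge> 1" "iso_to_simplex (lower_cone P le (fst y)) le r" using iso[OF y(1)] by blast
    have "iso_to_simplex (lower_cone ?Q ?le y) ?le r"
      using inflation_iso_to_simplex[OF P D y r(2)] by simp
    then show ?thesis using r elem_dim_eq[OF r(2,1)] elem_dim_eq[of ?Q ?le y r] by auto
  qed
  show "geometric_simplicial_poset ?Q ?le"
    unfolding geometric_simplicial_poset_def
    using inflation_finite_poset[OF P D] isoQ by blast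

  have pure: "pure_of_dim P le (int n - 1)"
    and wedge: "htpy_wedge_of_spheres (realization P le) (int n - 1)"
    and links: "\<And>I. I \<in> P \<Longrightarrow> htpy_wedge_of_spheres (realization (upper_link P le I) le)
      (int n - 2 - elem_dim P le I)"
    using assms(2) unfolding htpy_CM_def by blast+
  have dim: "elem_dim P le I \<le> int n - 1" if "I \<in> P" for I
    using pure that finite_poset_finite[OF P] Max_ge[of "elem_dim P le ` P" "elem_dim P le I"]
    by (simp add: pure_of_dim_def poset_dim_def)
  have sp: "spherical P le rk n"
    unfolding spherical_def
  proof (intro conjI ballI wedge)
    fix I assume I: "I \<in> P"
    show "rk I \<le> n" using rk[OF I] dim[OF I] by linarith
    have 1: "int n - 1 - int (rk I) = int n - 2 - elem_dim P le I" using rk[OF I] by simp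
    show "htpy_wedge_of_spheres (realization (upper_link P le I) le) (int n - 1 - int (rk I))"
      unfolding 1 by (rule links[OF I])
  qed
  show "htpy_CM ?Q ?le n"
    unfolding htpy_CM_def
  proof (intro conjI ballI)
    show "htpy_wedge_of_spheres (realization ?Q ?le) (int n - 1)"
      by (rule inflation_htpy_wedge[OF bc sp D fl])
    show "pure_of_dim ?Q ?le (int n - 1)"
      unfolding pure_of_dim_def
    proof (intro conjI allI impI)
      obtain I x where "I \<in> P" "x \<in> D I" using pure Dne unfolding pure_of_dim_def by blast
      then have "(I,x) \<in> ?Q" by simp
      then show "?Q \<noteq> {}" by blast
      \<comment> \<open>Every \<open>D I\<close> is nonempty, so each dimension occurring in
        \<open>P\<close> also occurs in the inflation.\<close>
      have "elem_dim ?Q ?le ` ?Q = elem_dim P le ` P"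
      proof
        show "elem_dim ?Q ?le ` ?Q \<subseteq> elem_dim P le ` P"
        proof
          fix k assume "k \<in> elem_dim ?Q ?le ` ?Q"
          then obtain y where y: "y \<in> ?Q" "k = elem_dim ?Q ?le y" by blast
          then have "k = elem_dim P le (fst y)" "fst y \<in> P" using isoQ[OF y(1)] by auto
          then show "k \<in> elem_dim P le ` P" by blast
        qed
        show "elem_dim P le ` P \<subseteq> elem_dim ?Q ?le ` ?Q"
        proof
          fix k assume "k \<in> elem_dim P le ` P"
          then obtain I where I: "I \<in> P" "k = elem_dim P le I" by blast
          obtain x where "x \<in> D I" using Dne[OF I(1)] by blast
          then have Ix: "(I,x) \<in> ?Q" using I by simp
          then have "elem_dim ?Q ?le (I,x) = k" using isoQ[OF Ix] I(2) by (metis fst_conv)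
          then show "k \<in> elem_dim ?Q ?le ` ?Q" using Ix by blast
        qed
      qed
      then show "poset_dim ?Q ?le = int n - 1" using pure by (simp add: pure_of_dim_def poset_dim_def)
      fix y w assume yw: "maximal_elem ?Q ?le y \<and> maximal_elem ?Q ?le w"
      then have "maximal_elem P le (fst y)" "maximal_elem P le (fst w)"
        using maximal_inflation[OF P D fl, of "fst y" "snd y"] maximal_inflation[OF P D fl, of "fst w" "snd w"]
        by simp_all
      moreover have "y \<in> ?Q" "w \<in> ?Q" using yw unfolding maximal_elem_def by blast+
      ultimately show "elem_dim ?Q ?le y = elem_dim ?Q ?le w"
        using pure isoQ[of y] isoQ[of w] unfolding pure_of_dim_def by metis
    qed
    fix y assume y: "y \<in> ?Q"
    define I x where "I = fst y" and "x = snd y"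
    have I: "I \<in> P" "x \<in> D I" and yI: "y = (I,x)" using y by (auto simp: I_def x_def)
    \<comment> \<open>\<open>inflation_htpy_wedge\<close> again, now over the link of
      \<open>I\<close>: the upper link of \<open>y\<close> is an inflation of that link.\<close>
    have 1: "htpy_wedge_of_spheres (realization (inflation (upper_link P le I) (link_diagram D Dm I x)) ?le)
        (int (n - rk I) - 1)"
      by (rule inflation_htpy_wedge[OF bool_cones_upper_link(1)[OF bc I(1)] spherical_link[OF bc sp I(1)]
            diagram_link[OF P D I(1)] loc_flabby_link[OF bc D fl I]])
    \<comment> \<open>\<open>rk I\<close> is the dimension plus one and at most \<open>n\<close>, so
      the truncated difference is the true one.\<close>
    have 2: "int n - 2 - elem_dim ?Q ?le y = int (n - rk I) - 1"
      using isoQ[OF y] rk[OF I(1)] sphericalD(1)[OF sp I(1)] by (auto simp: I_def of_nat_diff)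
    show "htpy_wedge_of_spheres (realization (upper_link ?Q ?le y) ?le)
        (int n - 2 - elem_dim ?Q ?le y)"
      unfolding 2 unfolding yI upper_link_inflation[OF D I] by (rule 1)
  qed
qed

end
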